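(* Let $(R,\mathfrak m)$ be a local Buchsbaum ring of dimension $d>0$ with infinite residue field, let $I$ be an $\mathfrak m$-primary ideal and let $J$ be any minimal reduction of $I$. Then the multiplicity $f_0(I)$ of the special fiber ring $\mathcal F(I)$ of $I$ satisfies $$f_0(I)\le e_1(I)+I(R)-e_1(J)+1.$$ Furthermore, if equality holds then $I$ has minimal multiplicity in the sense of Goto, that is, $\mathfrak m I=\mathfrak m K$ for any minimal reduction $K$ of $I$.
   Context: Let $\lambda(\cdot)$ denote length. For an $\mathfrak m$-primary ideal $I$ of a local Noetherian ring $(R,\mathfrak m)$ of dimension $d>0$, the Hilbert coefficients $e_0(I),\dots,e_d(I)$ are the integers such that, for $n\gg 0$, $\lambda(R/I^n)=e_0(I)\binom{n+d-1}{d}-e_1(I)\binom{n+d-2}{d-1}+\cdots+(-1)^d e_d(I)$. A local Noetherian ring $(R,\mathfrak m)$ of dimension $d>0$ is a Buchsbaum ring if there is a non-negative integer $I(R)$, called the Buchsbaum invariant of $R$, such that $\lambda(R/Q)-e_0(Q)=I(R)$ for every ideal $Q=(x_1,\dots,x_d)$ generated by a system of parameters of $R$. A minimal reduction $J$ of $I$ is an ideal $J\subseteq I$ generated by $d$ elements such that $I^{r+1}=JI^r$ for some integer $r\ge 0$ (so $J$ is itself $\mathfrak m$-primary and $e_i(J)$ is defined). The special fiber ring of $I$ is $\mathcal F(I)=\mathcal R(I)\otimes_R R/\mathfrak m=\bigoplus_{n\ge 0}I^n/\mathfrak m I^n$, where $\mathcal R(I)=\bigoplus_{n\ge0}I^nt^n$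 is the Rees algebra; it is a standard graded algebra of dimension $d$ over the residue field, and $f_0(I)$ denotes its multiplicity, i.e. $(d-1)!$ times the leading coefficient of its Hilbert polynomial. *)

theory Defs
  imports "HOL-Algebra.Algebra" "HOL-Library.Extended_Nat"
    "HOL-Computational_Algebra.Polynomial"
begin

section \<open>Chains, dimension and length\<close>

text \<open>Supremum of the lengths \<open>n\<close> of strict chains \<open>C 0 \<subset> \<dots> \<subset> C n\<close> of members of a family of sets.\<close>

definition chain_height :: "'a set set \<Rightarrow> enat" where
  "chain_height S =
     Sup {enat n | n. \<exists>C. (\<forall>i\<le>n. C i \<in> S) \<and> (\<forall>i<n. C i \<subset> C (Suc i))}"

definition krull_dim :: "('a, 'b) ring_scheme \<Rightarrow> enat" where
  "krull_dim R = chain_height {P. primeideal P R}"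

definition module_length :: "('a, 'b) ring_scheme \<Rightarrow> ('a, 'c, 'e) module_scheme \<Rightarrow> enat" where
  "module_length R M = chain_height {N. submodule N R M}"

definition self_module :: "('a, 'b) ring_scheme \<Rightarrow> ('a, 'a) module" where
  "self_module R =
     \<lparr>carrier = carrier R, monoid.mult = monoid.mult R, monoid.one = \<one>\<^bsub>R\<^esub>,
      ring.zero = \<zero>\<^bsub>R\<^esub>, ring.add = ring.add R, module.smult = monoid.mult R\<rparr>"

text \<open>The quotient \<open>M / N\<close> with its scalar action. Its ring part is \<^const>\<open>FactRing\<close>, so for an
  \<open>R\<close>-algebra \<open>M\<close> and an ideal \<open>N\<close> of \<open>M\<close> this is the quotient \<open>R\<close>-algebra.\<close>

definition quot_module :: "('a, 'c, 'e) module_scheme \<Rightarrow> 'c set \<Rightarrow> ('a, 'c set) module" where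
  "quot_module M N =
     \<lparr>carrier = carrier (M Quot N), monoid.mult = monoid.mult (M Quot N),
      monoid.one = \<one>\<^bsub>M Quot N\<^esub>, ring.zero = \<zero>\<^bsub>M Quot N\<^esub>,
      ring.add = ring.add (M Quot N),
      module.smult = (\<lambda>r C. \<Union>x\<in>C. N +>\<^bsub>M\<^esub> (r \<odot>\<^bsub>M\<^esub> x))\<rparr>"

text \<open>\<open>\<lambda>(R/I)\<close>. It is finite in all uses below, where \<open>I\<close> is a power of an \<open>\<mm>\<close>-primary ideal
  of a Noetherian local ring.\<close>

definition colength :: "('a, 'b) ring_scheme \<Rightarrow> 'a set \<Rightarrow> nat" where
  "colength R I = the_enat (module_length R (quot_module (self_module R) I))"


section \<open>Local rings and primary ideals\<close>

definition local_noetherian_ring :: "('a, 'b) ring_scheme \<Rightarrow> 'a set \<Rightarrow> nat \<Rightarrow> bool" where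
  "local_noetherian_ring R \<mm> d \<longleftrightarrow>
     cring R \<and> noetherian_ring R \<and> (\<forall>M. maximalideal M R \<longleftrightarrow> M = \<mm>) \<and> krull_dim R = enat d"

definition radical :: "('a, 'b) ring_scheme \<Rightarrow> 'a set \<Rightarrow> 'a set" where
  "radical R I = {a \<in> carrier R. \<exists>n::nat. a [^]\<^bsub>R\<^esub> n \<in> I}"

definition primary_ideal :: "('a, 'b) ring_scheme \<Rightarrow> 'a set \<Rightarrow> bool" where
  "primary_ideal R Q \<longleftrightarrow> ideal Q R \<and> Q \<noteq> carrier R \<and>
     (\<forall>a\<in>carrier R. \<forall>b\<in>carrier R. a \<otimes>\<^bsub>R\<^esub> b \<in> Q \<longrightarrow> a \<in> Q \<or> b \<in> radical R Q)"

definition m_primary :: "('a, 'b) ring_scheme \<Rightarrow> 'a set \<Rightarrow> 'a set \<Rightarrow> bool" where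
  "m_primary R \<mm> I \<longleftrightarrow> primary_ideal R I \<and> radical R I = \<mm>"

abbreviation ideal_pow :: "('a, 'b) ring_scheme \<Rightarrow> 'a set \<Rightarrow> nat \<Rightarrow> 'a set" where
  "ideal_pow R I n \<equiv> I [^]\<^bsub>ideals_set R\<^esub> n"


section \<open>Hilbert coefficients\<close>

definition hilbert_expansion ::
  "('a, 'b) ring_scheme \<Rightarrow> nat \<Rightarrow> 'a set \<Rightarrow> (nat \<Rightarrow> int) \<Rightarrow> bool" where
  "hilbert_expansion R d I e \<longleftrightarrow>
     (\<forall>\<^sub>F n in sequentially. int (colength R (ideal_pow R I n)) =
        (\<Sum>i\<le>d. (- 1) ^ i * e i * int ((n + d - Suc i) choose (d - i))))"

text \<open>The coefficient \<open>e\<^sub>i(I)\<close>, for \<open>i \<le> d\<close>, where \<open>d\<close> is the dimension of \<open>R\<close>.\<close>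

definition hilbert_coeff :: "('a, 'b) ring_scheme \<Rightarrow> nat \<Rightarrow> 'a set \<Rightarrow> nat \<Rightarrow> int" where
  "hilbert_coeff R d I i = (THE c. \<exists>e. hilbert_expansion R d I e \<and> c = e i)"


section \<open>Buchsbaum rings\<close>

definition system_of_parameters ::
  "('a, 'b) ring_scheme \<Rightarrow> 'a set \<Rightarrow> nat \<Rightarrow> (nat \<Rightarrow> 'a) \<Rightarrow> bool" where
  "system_of_parameters R \<mm> d x \<longleftrightarrow> x ` {..<d} \<subseteq> \<mm> \<and> m_primary R \<mm> (Idl\<^bsub>R\<^esub> (x ` {..<d}))"

definition is_buchsbaum_invariant ::
  "('a, 'b) ring_scheme \<Rightarrow> 'a set \<Rightarrow> nat \<Rightarrow> nat \<Rightarrow> bool" where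
  "is_buchsbaum_invariant R \<mm> d c \<longleftrightarrow>
     (\<forall>x. system_of_parameters R \<mm> d x \<longrightarrow>
        (let Q = Idl\<^bsub>R\<^esub> (x ` {..<d}) in int (colength R Q) - hilbert_coeff R d Q 0 = int c))"

definition buchsbaum_ring :: "('a, 'b) ring_scheme \<Rightarrow> 'a set \<Rightarrow> nat \<Rightarrow> bool" where
  "buchsbaum_ring R \<mm> d \<longleftrightarrow>
     local_noetherian_ring R \<mm> d \<and> d > 0 \<and> (\<exists>c. is_buchsbaum_invariant R \<mm> d c)"

definition buchsbaum_invariant :: "('a, 'b) ring_scheme \<Rightarrow> 'a set \<Rightarrow> nat \<Rightarrow> nat" where
  "buchsbaum_invariant R \<mm> d = (THE c. is_buchsbaum_invariant R \<mm> d c)"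


section \<open>Minimal reductions\<close>

definition minimal_reduction ::
  "('a, 'b) ring_scheme \<Rightarrow> nat \<Rightarrow> 'a set \<Rightarrow> 'a set \<Rightarrow> bool" where
  "minimal_reduction R d I J \<longleftrightarrow>
     J \<subseteq> I \<and>
     (\<exists>x. x ` {..<d} \<subseteq> carrier R \<and> J = Idl\<^bsub>R\<^esub> (x ` {..<d})) \<and>
     (\<exists>r. ideal_pow R I (r + 1) = ideal_prod R J (ideal_pow R I r))"

definition goto_minimal_multiplicity ::
  "('a, 'b) ring_scheme \<Rightarrow> 'a set \<Rightarrow> nat \<Rightarrow> 'a set \<Rightarrow> bool" where
  "goto_minimal_multiplicity R \<mm> d I \<longleftrightarrow>
     (\<forall>K. minimal_reduction R d I K \<longrightarrow> ideal_prod R \<mm> I = ideal_prod R \<mm> K)"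


section \<open>The special fiber ring\<close>

text \<open>The Rees algebra \<open>\<Oplus>\<^sub>n I\<^sup>n t\<^sup>n\<close> as a subalgebra of the polynomial ring \<open>R[t]\<close>.\<close>

definition rees_algebra :: "('a, 'b) ring_scheme \<Rightarrow> 'a set \<Rightarrow> ('a, nat \<Rightarrow> 'a) up_ring" where
  "rees_algebra R I =
     (UP R)\<lparr>carrier := {p \<in> carrier (UP R). \<forall>n. up_ring.coeff (UP R) p n \<in> ideal_pow R I n}\<rparr>"

text \<open>The ideal \<open>\<mm>\<R>(I)\<close> of the Rees algebra generated by \<open>\<mm>\<close>, placed in degree 0.\<close>

definition rees_ext_ideal :: "('a, 'b) ring_scheme \<Rightarrow> 'a set \<Rightarrow> 'a set \<Rightarrow> (nat \<Rightarrow> 'a) set" where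
  "rees_ext_ideal R \<mm> I = Idl\<^bsub>rees_algebra R I\<^esub> ((\<lambda>a. up_ring.monom (UP R) a 0) ` \<mm>)"

text \<open>\<open>\<F>(I) = \<R>(I) \<otimes>\<^sub>R R/\<mm>\<close>, realised as the \<open>R\<close>-algebra \<open>\<R>(I)/\<mm>\<R>(I)\<close>.\<close>

definition special_fiber_ring ::
  "('a, 'b) ring_scheme \<Rightarrow> 'a set \<Rightarrow> 'a set \<Rightarrow> ('a, (nat \<Rightarrow> 'a) set) module" where
  "special_fiber_ring R \<mm> I = quot_module (rees_algebra R I) (rees_ext_ideal R \<mm> I)"

text \<open>The component of degree \<open>n\<close>, the image of \<open>I\<^sup>n t\<^sup>n\<close>; it is isomorphic to \<open>I\<^sup>n/\<mm>I\<^sup>n\<close>.\<close>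

definition special_fiber_component ::
  "('a, 'b) ring_scheme \<Rightarrow> 'a set \<Rightarrow> 'a set \<Rightarrow> nat \<Rightarrow> ('a, (nat \<Rightarrow> 'a) set) module" where
  "special_fiber_component R \<mm> I n =
     (special_fiber_ring R \<mm> I)\<lparr>carrier :=
        (\<lambda>a. rees_ext_ideal R \<mm> I +>\<^bsub>rees_algebra R I\<^esub> up_ring.monom (UP R) a n) ` ideal_pow R I n\<rparr>"

text \<open>The components are annihilated by \<open>\<mm>\<close>, so the length over \<open>R\<close> is the dimension over the
  residue field.\<close>

definition special_fiber_hilbert_function ::
  "('a, 'b) ring_scheme \<Rightarrow> 'a set \<Rightarrow> 'a set \<Rightarrow> nat \<Rightarrow> nat" where
  "special_fiber_hilbert_function R \<mm> I n =
     the_enat (module_length R (special_fiber_component R \<mm> I n))"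

definition special_fiber_hilbert_poly ::
  "('a, 'b) ring_scheme \<Rightarrow> 'a set \<Rightarrow> 'a set \<Rightarrow> rat poly" where
  "special_fiber_hilbert_poly R \<mm> I =
     (THE P. \<forall>\<^sub>F n in sequentially.
        of_nat (special_fiber_hilbert_function R \<mm> I n) = poly P (of_nat n))"

text \<open>\<open>f\<^sub>0(I)\<close>, where \<open>d\<close> is the dimension of \<open>R\<close> and hence of \<open>\<F>(I)\<close>.\<close>

definition special_fiber_multiplicity ::
  "('a, 'b) ring_scheme \<Rightarrow> 'a set \<Rightarrow> nat \<Rightarrow> 'a set \<Rightarrow> rat" where
  "special_fiber_multiplicity R \<mm> d I = fact (d - 1) * lead_coeff (special_fiber_hilbert_poly R \<mm> I)"

end

theory Submission
  imports Defs Complex_Main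
begin

text \<open>
  Since \<open>\<mm>J\<^sup>n \<subseteq> \<mm>I\<^sup>n\<close>, the length of \<open>I\<^sup>n/\<mm>I\<^sup>n\<close> is at most \<open>\<lambda>(J\<^sup>n/\<mm>J\<^sup>n) + \<lambda>(I\<^sup>n/J\<^sup>n)\<close>. The first
  summand is at most the number of monomials of degree \<open>n\<close> in \<open>d\<close> variables; the second is
  eventually a polynomial of degree less than \<open>d\<close> with leading term governed by
  \<open>e\<^sub>1(I) - e\<^sub>1(J)\<close>. Hence \<open>f\<^sub>0(I) \<le> e\<^sub>1(I) - e\<^sub>1(J) + 1\<close>, and \<open>I(R) \<ge> 0\<close> gives the bound.

  In the case of equality \<open>I(R) = 0\<close>, so \<open>\<lambda>(R/K) = e\<^sub>0(K) = e\<^sub>0(I)\<close> for every minimal reduction \<open>K\<close>.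
  An element of \<open>\<mm>I\<close> outside \<open>J\<close> would improve the bound by one, so \<open>\<mm>I \<subseteq> J\<close>. Because \<open>I\<close> has no
  reduction with fewer than \<open>d\<close> generators, \<open>J \<inter> \<mm>I = \<mm>J\<close> and \<open>\<lambda>(R/\<mm>K) = \<lambda>(R/K) + d\<close>. So
  \<open>\<mm>I = \<mm>J\<close>, and \<open>\<mm>K \<subseteq> \<mm>I\<close> has the same colength as \<open>\<mm>J\<close>.

  Hilbert functions are handled inside the lattice of ideals of \<open>R\<close>: filtering
  \<open>(x, Y)\<^sup>n E\<close> by powers of \<open>x\<close> reduces the number of generators, as in Hilbert's basis theorem.
\<close>

text \<open>Two points shape the argument. The degree bound \<open>d - 1\<close> must come from the
  \<open>d\<close> generators of \<open>J\<close>, not from those of \<open>I\<close>: since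
  \<open>I^(n+r) = J^n I^r\<close>, the shifted powers of \<open>I\<close> form a graded module over
  the Rees algebra of \<open>J\<close> generated in degree 0, and a graded quotient of it with
  finite length in degree 0 has a Hilbert function of degree less than the number of generators of
  \<open>J\<close>. The other point is a lower bound: that the fiber polynomial has degree exactly
  \<open>d - 1\<close>, and that \<open>I\<close> has no reduction with fewer generators, both rest
  on the fiber function not being \<open>o(n^(d-1))\<close>. This comes from a chain of primes of
  length \<open>d\<close>. Each step raises the growth of the colength of \<open>P + I^n\<close> by
  one power of \<open>n\<close>, by Artin-Rees, and the length of \<open>I^n/I^(n+1)\<close> is at
  most a constant times that of \<open>I^n/\<mm>I^n\<close>. The gain of one in the case of equality
  arises because \<open>J^n\<close> modulo \<open>J^(n+1) + aJ^n\<close> is governed by the length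
  of \<open>R/(J + aR)\<close>, which is at most \<open>e_0(J) - 1\<close> when \<open>R/J\<close>
  has length \<open>e_0(J)\<close>, while \<open>J^n/J^(n+1)\<close> is governed by
  \<open>e_0(J)\<close>.\<close>

no_notation Sum_Type.Plus (infixr \<open><+>\<close> 65)

section \<open>Chains of ideals\<close>

lemma chain_height_geI:
  "(\<And>i. i \<le> n \<Longrightarrow> C i \<in> S) \<Longrightarrow> (\<And>i. i < n \<Longrightarrow> C i \<subset> C (Suc i)) \<Longrightarrow> enat n \<le> chain_height S"
  unfolding chain_height_def by (rule Sup_upper) blast

lemma chain_height_leI:
  "(\<And>n C. (\<And>i. i \<le> n \<Longrightarrow> C i \<in> S) \<Longrightarrow> (\<And>i. i < n \<Longrightarrow> C i \<subset> C (Suc i)) \<Longrightarrow> enat n \<le> b)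
    \<Longrightarrow> chain_height S \<le> b"
  unfolding chain_height_def by (rule Sup_least) blast

text \<open>A finite supremum of a nonempty set in \<open>enat\<close> is a maximum.
  \<open>S \<noteq> {}\<close> excludes the empty supremum, which is 0 without any chain.\<close>

lemma chain_height_attained:
  assumes "chain_height S = enat n" "S \<noteq> {}"
  shows "\<exists>C. (\<forall>i\<le>n. C i \<in> S) \<and> (\<forall>i<n. C i \<subset> C (Suc i))"
proof -
  let ?A = "{enat n | n. \<exists>C. (\<forall>i\<le>n. C i \<in> S) \<and> (\<forall>i<n. C i \<subset> C (Suc i))}"
  from assms(2) obtain s where "s \<in> S" by blast
  then have "enat 0 \<in> ?A" by (auto intro!: exI[of _ "\<lambda>_. s"])
  then have ne: "?A \<noteq> {}" by blast
  have "Sup ?A = enat n" using assms(1) unfolding chain_height_def .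
  then have fin: "finite ?A" and max: "Max ?A = enat n"
    using ne unfolding Sup_enat_def by (auto split: if_splits)
  have "enat n \<in> ?A" using Max_in[OF fin ne] unfolding max .
  then show ?thesis by auto
qed

lemma chain_height_mono_map:
  assumes "\<And>A. A \<in> S \<Longrightarrow> F A \<in> T"
    and "\<And>A B. A \<in> S \<Longrightarrow> B \<in> S \<Longrightarrow> A \<subset> B \<Longrightarrow> F A \<subset> F B"
  shows "chain_height S \<le> chain_height T"
proof (rule chain_height_leI)
  fix n :: nat and C assume C: "\<And>i. i \<le> n \<Longrightarrow> C i \<in> S" "\<And>i. i < n \<Longrightarrow> C i \<subset> C (Suc i)"
  show "enat n \<le> chain_height T"
    by (rule chain_height_geI[of _ "\<lambda>i. F (C i)"]) (simp_all add: assms C less_imp_le Suc_le_eq)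
qed

text \<open>Dropping the repetitions of a weak chain leaves one strict step for each strict
  inclusion. The induction also keeps the top member \<open>C n\<close>, to which the next strict
  step is appended.\<close>

lemma chain_height_weak_chain:
  assumes "\<And>i. i \<le> n \<Longrightarrow> C i \<in> S" "\<And>i. i < n \<Longrightarrow> C i \<subseteq> C (Suc i)"
  shows "enat (card {i. i < n \<and> C i \<noteq> C (Suc i)}) \<le> chain_height S"
proof -
  have "\<exists>D. (\<forall>i\<le>card {i. i < n \<and> C i \<noteq> C (Suc i)}. D i \<in> S)
      \<and> (\<forall>i<card {i. i < n \<and> C i \<noteq> C (Suc i)}. D i \<subset> D (Suc i))
      \<and> D (card {i. i < n \<and> C i \<noteq> C (Suc i)}) = C n"
    using assms
  proof (induction n)
    case 0
    then show ?case by (intro exI[of _ C]) auto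
  next
    case (Suc n)
    let ?k = "card {i. i < n \<and> C i \<noteq> C (Suc i)}"
    have "\<And>i. i \<le> n \<Longrightarrow> C i \<in> S" "\<And>i. i < n \<Longrightarrow> C i \<subseteq> C (Suc i)"
      using Suc.prems by auto
    from Suc.IH[OF this] obtain D where D: "\<forall>i\<le>?k. D i \<in> S" "\<forall>i<?k. D i \<subset> D (Suc i)" "D ?k = C n"
      by blast
    show ?case
    proof (cases "C n = C (Suc n)")
      case True
      then have "{i. i < Suc n \<and> C i \<noteq> C (Suc i)} = {i. i < n \<and> C i \<noteq> C (Suc i)}"
        by (auto simp: less_Suc_eq)
      then show ?thesis using D True by (intro exI[of _ D]) simp
    next
      case False
      then have "{i. i < Suc n \<and> C i \<noteq> C (Suc i)} = insert n {i. i < n \<and> C i \<noteq> C (Suc i)}"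
        by (auto simp: less_Suc_eq)
      then have k: "card {i. i < Suc n \<and> C i \<noteq> C (Suc i)} = Suc ?k" by simp
      have "C n \<subset> C (Suc n)" using False Suc.prems(2)[of n] by auto
      then show ?thesis unfolding k using D Suc.prems(1)[of "Suc n"]
        by (intro exI[of _ "\<lambda>i. if i = Suc ?k then C (Suc n) else D i"])
          (auto simp: less_Suc_eq le_Suc_eq)
    qed
  qed
  then show ?thesis using chain_height_geI by blast
qed

section \<open>Ideals and the length of an interval of ideals\<close>

context cring
begin

lemma ideal_memI:
  assumes "A \<subseteq> carrier R" "\<zero> \<in> A" "\<And>x y. x \<in> A \<Longrightarrow> y \<in> A \<Longrightarrow> x \<oplus> y \<in> A"
    "\<And>r x. r \<in> carrier R \<Longrightarrow> x \<in> A \<Longrightarrow> r \<otimes> x \<in> A"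
  shows "ideal A R"
proof (rule idealI[OF ring_axioms])
  show "subgroup A (add_monoid R)"
  proof (unfold_locales, goal_cases)
    case (4 x)
    then have "(\<ominus> \<one>) \<otimes> x \<in> A" using assms by simp
    then show ?case using 4 assms(1) by (auto simp: a_inv_def[symmetric] l_minus subset_iff)
  qed (use assms in auto)
  fix a x assume "a \<in> A" "x \<in> carrier R"
  then show "x \<otimes> a \<in> A" "a \<otimes> x \<in> A" using assms m_comm[of a x] by auto
qed

lemma ideal_mem_carrier: "ideal A R \<Longrightarrow> x \<in> A \<Longrightarrow> x \<in> carrier R"
  by (rule ideal.Icarr)

lemma ideal_sub_carrier: "ideal A R \<Longrightarrow> A \<subseteq> carrier R"
  by (auto intro: ideal.Icarr)

lemma ideal_mem_zero: "ideal A R \<Longrightarrow> \<zero> \<in> A"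
  by (simp add: additive_subgroup.zero_closed ideal.axioms(1))

lemma ideal_mem_add: "ideal A R \<Longrightarrow> x \<in> A \<Longrightarrow> y \<in> A \<Longrightarrow> x \<oplus> y \<in> A"
  by (simp add: additive_subgroup.a_closed ideal.axioms(1))

lemma ideal_mem_mult: "ideal A R \<Longrightarrow> r \<in> carrier R \<Longrightarrow> x \<in> A \<Longrightarrow> r \<otimes> x \<in> A"
  by (rule ideal.I_l_closed)

lemma ideal_mem_minus: "ideal A R \<Longrightarrow> x \<in> A \<Longrightarrow> y \<in> A \<Longrightarrow> x \<ominus> y \<in> A"
  unfolding a_minus_def
  by (simp add: additive_subgroup.a_closed additive_subgroup.a_inv_closed ideal.axioms(1))

lemma ideal_sum_mem: "x \<in> A <+> B \<longleftrightarrow> (\<exists>a\<in>A. \<exists>b\<in>B. x = a \<oplus> b)"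
  by (auto simp: set_add_def')

lemma ideal_sum_upper1: "ideal A R \<Longrightarrow> ideal B R \<Longrightarrow> A \<subseteq> A <+> B"
proof
  fix x assume "ideal A R" "ideal B R" "x \<in> A"
  then have "x = x \<oplus> \<zero>" "\<zero> \<in> B" by (simp_all add: ideal_mem_carrier ideal_mem_zero)
  then show "x \<in> A <+> B" using \<open>x \<in> A\<close> unfolding ideal_sum_mem by blast
qed

lemma ideal_sum_upper2: "ideal A R \<Longrightarrow> ideal B R \<Longrightarrow> B \<subseteq> A <+> B"
proof
  fix x assume "ideal A R" "ideal B R" "x \<in> B"
  then have "x = \<zero> \<oplus> x" "\<zero> \<in> A" by (simp_all add: ideal_mem_carrier ideal_mem_zero)
  then show "x \<in> A <+> B" using \<open>x \<in> B\<close> unfolding ideal_sum_mem by blast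
qed

lemma ideal_sum_least: "ideal C R \<Longrightarrow> A \<subseteq> C \<Longrightarrow> B \<subseteq> C \<Longrightarrow> A <+> B \<subseteq> C"
  by (auto simp: ideal_sum_mem intro!: ideal_mem_add)

lemma ideal_sum_mono: "A \<subseteq> A' \<Longrightarrow> B \<subseteq> B' \<Longrightarrow> A <+> B \<subseteq> A' <+> B'"
  by (auto simp: ideal_sum_mem subset_iff)

lemma ideal_sum_commute: "ideal A R \<Longrightarrow> ideal B R \<Longrightarrow> A <+> B = B <+> A"
  by (simp add: equalityI ideal_sum_least add_ideals ideal_sum_upper1 ideal_sum_upper2)

lemma ideal_sum_absorb: "ideal B R \<Longrightarrow> ideal A R \<Longrightarrow> A \<subseteq> B \<Longrightarrow> A <+> B = B"
  by (simp add: equalityI ideal_sum_least ideal_sum_upper2)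

text \<open>Modular law: for \<open>b = a + c\<close> with \<open>a \<in> A\<close> and
  \<open>c \<in> C\<close>, the difference \<open>c = b - a\<close> lies in
  \<open>B \<inter> C\<close>, hence in \<open>A\<close>.\<close>

lemma ideal_modular:
  assumes "ideal A R" "ideal B R" "ideal C R" "A \<subseteq> B" "B \<inter> C \<subseteq> A" "B \<subseteq> A <+> C"
  shows "A = B"
proof
  show "B \<subseteq> A"
  proof
    fix b assume b: "b \<in> B"
    then obtain a c where ac: "a \<in> A" "c \<in> C" "b = a \<oplus> c" using assms(6) ideal_sum_mem by blast
    have "a \<in> carrier R" "c \<in> carrier R" using ac assms ideal_mem_carrier by auto
    then have cb: "b \<ominus> a = c" unfolding ac(3) by algebra
    have "b \<ominus> a \<in> B" using b ac(1) assms by (intro ideal_mem_minus) auto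
    then have "c \<in> B" unfolding cb .
    then show "b \<in> A" using ac assms by (auto intro: ideal_mem_add)
  qed
qed fact

definition scale :: "'a \<Rightarrow> 'a set \<Rightarrow> 'a set" where
  "scale c A = (\<lambda>a. c \<otimes> a) ` A"

lemma scale_ideal:
  assumes "c \<in> carrier R" "ideal A R" shows "ideal (scale c A) R"
proof (rule ideal_memI)
  show "scale c A \<subseteq> carrier R" using assms by (auto simp: scale_def intro: ideal_mem_carrier)
  have "\<zero> = c \<otimes> \<zero>" using assms by simp
  then show "\<zero> \<in> scale c A" using ideal_mem_zero[OF assms(2)] unfolding scale_def by blast
next
  fix x y assume "x \<in> scale c A" "y \<in> scale c A"
  then obtain a b where ab: "a \<in> A" "b \<in> A" "x = c \<otimes> a" "y = c \<otimes> b" unfolding scale_def by blast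
  then have "x \<oplus> y = c \<otimes> (a \<oplus> b)" using assms by (simp add: ideal_mem_carrier r_distr)
  then show "x \<oplus> y \<in> scale c A" using ab ideal_mem_add[OF assms(2)] unfolding scale_def by blast
next
  fix r x assume r: "r \<in> carrier R" and "x \<in> scale c A"
  then obtain a where a: "a \<in> A" "x = c \<otimes> a" unfolding scale_def by blast
  then have "r \<otimes> x = c \<otimes> (r \<otimes> a)" using assms r by (simp add: ideal_mem_carrier m_lcomm)
  then show "r \<otimes> x \<in> scale c A" using a r ideal_mem_mult[OF assms(2)] unfolding scale_def by blast
qed

lemma scale_subset: "ideal B R \<Longrightarrow> c \<in> carrier R \<Longrightarrow> A \<subseteq> B \<Longrightarrow> scale c A \<subseteq> B"
  by (auto simp: scale_def intro: ideal_mem_mult)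

lemma scale_mono: "A \<subseteq> B \<Longrightarrow> scale c A \<subseteq> scale c B"
  by (auto simp: scale_def)

text \<open>The kernel of the map from \<open>A\<close> to \<open>R/S\<close> given by
  multiplication with \<open>c\<close>.\<close>

lemma colon_ideal:
  assumes "c \<in> carrier R" "ideal A R" "ideal S R"
  shows "ideal {a \<in> A. c \<otimes> a \<in> S} R"
  by (rule ideal_memI)
    (use assms in \<open>auto simp: ideal_mem_carrier r_distr m_lcomm[of c] intro: ideal_mem_zero
      ideal_mem_add ideal_mem_mult\<close>)

text \<open>The length of the module \<open>B/A\<close>, whose submodules correspond to the ideals
  between \<open>A\<close> and \<open>B\<close>. Intervals of ideals of one fixed ring keep quotient
  modules out of the theory of Hilbert functions.\<close>

definition len :: "'a set \<Rightarrow> 'a set \<Rightarrow> enat" where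
  "len A B = chain_height {K. ideal K R \<and> A \<subseteq> K \<and> K \<subseteq> B}"

lemma len_self: "len A A = 0"
proof -
  have "len A A \<le> 0" unfolding len_def
  proof (rule chain_height_leI)
    fix n :: nat and C :: "nat \<Rightarrow> 'a set"
    assume C: "\<And>i. i \<le> n \<Longrightarrow> C i \<in> {K. ideal K R \<and> A \<subseteq> K \<and> K \<subseteq> A}"
      "\<And>i. i < n \<Longrightarrow> C i \<subset> C (Suc i)"
    have "\<not> 0 < n" using C(1)[of 0] C(1)[of 1] C(2)[of 0] by (auto simp: Suc_le_eq)
    then show "enat n \<le> 0" by (simp add: zero_enat_def)
  qed
  then show ?thesis by simp
qed

lemma len_ge_1:
  assumes "ideal A R" "ideal B R" "A \<subset> B" shows "1 \<le> len A B"
proof -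
  have "enat 1 \<le> len A B" unfolding len_def
    by (rule chain_height_geI[of _ "\<lambda>i. if i = 0 then A else B"]) (use assms in auto)
  then show ?thesis by (simp add: one_enat_def)
qed

lemma len_maximal:
  assumes "ideal A R" "ideal B R" "A \<subset> B"
    "\<And>K. ideal K R \<Longrightarrow> A \<subseteq> K \<Longrightarrow> K \<subseteq> B \<Longrightarrow> K = A \<or> K = B"
  shows "len A B = 1"
proof (rule antisym)
  show "len A B \<le> 1" unfolding len_def
  proof (rule chain_height_leI)
    fix n :: nat and C :: "nat \<Rightarrow> 'a set"
    assume C: "\<And>i. i \<le> n \<Longrightarrow> C i \<in> {K. ideal K R \<and> A \<subseteq> K \<and> K \<subseteq> B}"
      "\<And>i. i < n \<Longrightarrow> C i \<subset> C (Suc i)"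
    have "\<not> 2 \<le> n"
    proof
      assume "2 \<le> n"
      then have "C 0 \<subset> C 1" "C 1 \<subset> C 2" using C(2)[of 0] C(2)[of 1] by (auto simp: numeral_2_eq_2)
      moreover have "C 0 \<in> {A, B}" "C 1 \<in> {A, B}" "C 2 \<in> {A, B}"
        using C(1)[of 0] C(1)[of 1] C(1)[of 2] \<open>2 \<le> n\<close> assms(4) by auto
      ultimately show False using assms(3) by auto
    qed
    then show "enat n \<le> 1" by (simp add: one_enat_def)
  qed
qed (use assms len_ge_1 in auto)

text \<open>Upper bound: a strict step of a chain between \<open>A\<close> and \<open>C\<close>
  stays strict after meeting with \<open>B\<close> or after adding \<open>B\<close>, by
  \<open>ideal_modular\<close>. Lower bound: chains below and above \<open>B\<close> are
  concatenated.\<close>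

lemma len_add:
  assumes "ideal A R" "ideal B R" "ideal C R" "A \<subseteq> B" "B \<subseteq> C"
  shows "len A C = len A B + len B C"
proof (rule antisym)
  show "len A C \<le> len A B + len B C"
    unfolding len_def[of A C]
  proof (rule chain_height_leI)
    fix n :: nat and K :: "nat \<Rightarrow> 'a set"
    assume K: "\<And>i. i \<le> n \<Longrightarrow> K i \<in> {K. ideal K R \<and> A \<subseteq> K \<and> K \<subseteq> C}"
      and st: "\<And>i. i < n \<Longrightarrow> K i \<subset> K (Suc i)"
    let ?P = "{i. i < n \<and> K i \<inter> B \<noteq> K (Suc i) \<inter> B}"
    let ?Q = "{i. i < n \<and> K i <+> B \<noteq> K (Suc i) <+> B}"
    have "{..<n} \<subseteq> ?P \<union> ?Q"
    proof
      fix i assume "i \<in> {..<n}"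
      then have i: "i < n" by simp
      show "i \<in> ?P \<union> ?Q"
      proof (rule ccontr)
        assume "i \<notin> ?P \<union> ?Q"
        then have "K i \<inter> B = K (Suc i) \<inter> B" "K i <+> B = K (Suc i) <+> B" using i by auto
        then have "K i = K (Suc i)"
          using K[of i] K[of "Suc i"] i st[of i] assms(2) ideal_sum_upper1[of "K (Suc i)" B]
          by (intro ideal_modular[of _ _ B]) auto
        then show False using st[OF i] by simp
      qed
    qed
    then have "n \<le> card (?P \<union> ?Q)" using card_mono[of "?P \<union> ?Q" "{..<n}"] by simp
    also have "\<dots> \<le> card ?P + card ?Q" by (rule card_Un_le)
    finally have "enat n \<le> enat (card ?P) + enat (card ?Q)" by simp
    also have "enat (card ?P) \<le> len A B" unfolding len_def
    proof (rule chain_height_weak_chain)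
      fix i assume "i \<le> n"
      then show "K i \<inter> B \<in> {K. ideal K R \<and> A \<subseteq> K \<and> K \<subseteq> B}"
        using K[of i] assms by (simp add: i_intersect)
    qed (use st in blast)
    also have "enat (card ?Q) \<le> len B C" unfolding len_def
    proof (rule chain_height_weak_chain)
      fix i assume "i \<le> n"
      then show "K i <+> B \<in> {K. ideal K R \<and> B \<subseteq> K \<and> K \<subseteq> C}"
        using K[of i] assms by (simp add: add_ideals ideal_sum_upper2 ideal_sum_least)
    next
      fix i assume "i < n"
      then show "K i <+> B \<subseteq> K (Suc i) <+> B" using st[of i] by (intro ideal_sum_mono) auto
    qed
    finally show "enat n \<le> len A B + len B C" by (simp add: add_mono)
  qed
next
  have ineq: "enat (p + q) \<le> len A C"
    if CF: "\<And>i. i \<le> p \<Longrightarrow> CF i \<in> {K. ideal K R \<and> A \<subseteq> K \<and> K \<subseteq> B}" "\<And>i. i < p \<Longrightarrow> CF i \<subset> CF (Suc i)"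
    and CG: "\<And>i. i \<le> q \<Longrightarrow> CG i \<in> {K. ideal K R \<and> B \<subseteq> K \<and> K \<subseteq> C}" "\<And>i. i < q \<Longrightarrow> CG i \<subset> CG (Suc i)"
    for p q :: nat and CF CG :: "nat \<Rightarrow> 'a set"
  proof -
    \<comment> \<open>The junction from \<open>CF p\<close> to \<open>CG 0\<close> may be an
      equality, so the joined chain has \<open>Suc (p + q)\<close> weak steps, of which only
      \<open>p + q\<close> are claimed to be strict.\<close>
    let ?K = "\<lambda>i. if i \<le> p then CF i else CG (i - Suc p)"
    let ?S = "{i. i < Suc (p + q) \<and> ?K i \<noteq> ?K (Suc i)}"
    have "{..<p} \<union> (\<lambda>i. Suc (p + i)) ` {..<q} \<subseteq> ?S"
      using CF(2) CG(2) by (fastforce)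
    then have "card ({..<p} \<union> (\<lambda>i. Suc (p + i)) ` {..<q}) \<le> card ?S"
      by (intro card_mono) auto
    moreover have "card ({..<p} \<union> (\<lambda>i. Suc (p + i)) ` {..<q}) = p + q"
      by (subst card_Un_disjoint) (auto simp: card_image inj_on_def)
    ultimately have c1: "p + q \<le> card ?S" by simp
    have c2: "enat (card ?S) \<le> len A C" unfolding len_def
    proof (rule chain_height_weak_chain)
      fix i assume i: "i \<le> Suc (p + q)"
      show "?K i \<in> {K. ideal K R \<and> A \<subseteq> K \<and> K \<subseteq> C}"
      proof (cases "i \<le> p")
        case True
        then show ?thesis using CF(1)[of i] assms by auto
      next
        case False
        moreover have "i - Suc p \<le> q" using i by auto
        ultimately show ?thesis using CG(1)[of "i - Suc p"] assms by auto
      qed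
    next
      fix i assume i: "i < Suc (p + q)"
      consider "i < p" | "i = p" | "i > p" by linarith
      then show "?K i \<subseteq> ?K (Suc i)"
      proof cases
        case 1
        then show ?thesis using CF(2)[of i] by auto
      next
        case 2
        then show ?thesis using CF(1)[of p] CG(1)[of 0] by auto
      next
        case 3
        then have "Suc (i - Suc p) = i - p" "i - Suc p < q" using i by auto
        then show ?thesis using CG(2)[of "i - Suc p"] 3 by auto
      qed
    qed
    show ?thesis by (rule order_trans[OF _ c2]) (use c1 in simp)
  qed
  have triv: "A \<in> {K. ideal K R \<and> A \<subseteq> K \<and> K \<subseteq> B}" "B \<in> {K. ideal K R \<and> B \<subseteq> K \<and> K \<subseteq> C}"
    using assms by auto
  show "len A B + len B C \<le> len A C"
  proof (cases "len A C")
    case (enat c)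
    \<comment> \<open>Finiteness of \<open>len A C\<close> passes to both summands, by
      \<open>ineq\<close> with a trivial chain on the other side; then both suprema are
      attained.\<close>
    have "len A B \<le> len A C" unfolding len_def[of A B]
    proof (rule chain_height_leI)
      fix n :: nat and D :: "nat \<Rightarrow> 'a set"
      assume D: "\<And>i. i \<le> n \<Longrightarrow> D i \<in> {K. ideal K R \<and> A \<subseteq> K \<and> K \<subseteq> B}"
        "\<And>i. i < n \<Longrightarrow> D i \<subset> D (Suc i)"
      have "enat (n + 0) \<le> len A C"
        by (rule ineq[of n D 0 "\<lambda>_. B"]) (use D triv in simp_all)
      then show "enat n \<le> len A C" by simp
    qed
    then obtain a where a: "len A B = enat a" using enat by (cases "len A B") auto
    have "len B C \<le> len A C" unfolding len_def[of B C]
    proof (rule chain_height_leI)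
      fix n :: nat and D :: "nat \<Rightarrow> 'a set"
      assume D: "\<And>i. i \<le> n \<Longrightarrow> D i \<in> {K. ideal K R \<and> B \<subseteq> K \<and> K \<subseteq> C}"
        "\<And>i. i < n \<Longrightarrow> D i \<subset> D (Suc i)"
      have "enat (0 + n) \<le> len A C"
        by (rule ineq[of 0 "\<lambda>_. A" n D]) (use D triv in simp_all)
      then show "enat n \<le> len A C" by simp
    qed
    then obtain b where b: "len B C = enat b" using enat by (cases "len B C") auto
    have ne: "{K. ideal K R \<and> A \<subseteq> K \<and> K \<subseteq> B} \<noteq> {}" "{K. ideal K R \<and> B \<subseteq> K \<and> K \<subseteq> C} \<noteq> {}"
      using triv by blast+
    obtain CF where
      CF: "\<And>i. i \<le> a \<Longrightarrow> CF i \<in> {K. ideal K R \<and> A \<subseteq> K \<and> K \<subseteq> B}" "\<And>i. i < a \<Longrightarrow> CF i \<subset> CF (Suc i)"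
      using chain_height_attained[OF a[unfolded len_def] ne(1)] by blast
    obtain CG where
      CG: "\<And>i. i \<le> b \<Longrightarrow> CG i \<in> {K. ideal K R \<and> B \<subseteq> K \<and> K \<subseteq> C}" "\<And>i. i < b \<Longrightarrow> CG i \<subset> CG (Suc i)"
      using chain_height_attained[OF b[unfolded len_def] ne(2)] by blast
    have "enat (a + b) \<le> len A C" by (rule ineq[of a CF b CG]) (use CF CG in simp_all)
    then show ?thesis using a b by simp
  qed simp
qed

text \<open>The isomorphism of \<open>A/(S : c)\<close> with \<open>(S + cA)/S\<close> on the level
  of ideals: \<open>K\<close> is sent to \<open>S + cK\<close>, and \<open>L\<close> to its preimage
  under multiplication by \<open>c\<close>. Each map is strictly monotone and gives one
  inequality.\<close>

lemma len_scale:
  assumes c: "c \<in> carrier R" and A: "ideal A R" and S: "ideal S R"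
  shows "len S (S <+> scale c A) = len {a \<in> A. c \<otimes> a \<in> S} A"
proof (rule antisym)
  let ?N = "{a \<in> A. c \<otimes> a \<in> S}"
  show "len ?N A \<le> len S (S <+> scale c A)" unfolding len_def
  proof (rule chain_height_mono_map[where F = "\<lambda>K. S <+> scale c K"])
    fix K assume "K \<in> {K. ideal K R \<and> ?N \<subseteq> K \<and> K \<subseteq> A}"
    then show "S <+> scale c K \<in> {K. ideal K R \<and> S \<subseteq> K \<and> K \<subseteq> S <+> scale c A}"
      using c S by (simp add: add_ideals scale_ideal ideal_sum_upper1 ideal_sum_mono scale_mono)
  next
    fix K L assume K: "K \<in> {K. ideal K R \<and> ?N \<subseteq> K \<and> K \<subseteq> A}"
      and L: "L \<in> {K. ideal K R \<and> ?N \<subseteq> K \<and> K \<subseteq> A}" and KL: "K \<subset> L"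
    have "S <+> scale c K \<subseteq> S <+> scale c L" using KL by (intro ideal_sum_mono scale_mono) auto
    moreover have "S <+> scale c K \<noteq> S <+> scale c L"
    proof
      assume eq: "S <+> scale c K = S <+> scale c L"
      from KL obtain a where a: "a \<in> L" "a \<notin> K" by blast
      have acar: "a \<in> carrier R" using a L ideal_mem_carrier by blast
      have "c \<otimes> a \<in> scale c L" using a unfolding scale_def by blast
      moreover have "scale c L \<subseteq> S <+> scale c L" using L c S by (simp add: ideal_sum_upper2 scale_ideal)
      ultimately have "c \<otimes> a \<in> S <+> scale c K" unfolding eq by blast
      then obtain s k where sk: "s \<in> S" "k \<in> K" "c \<otimes> a = s \<oplus> c \<otimes> k"
        unfolding ideal_sum_mem scale_def by blast
      have kc: "k \<in> carrier R" "s \<in> carrier R" using sk K S ideal_mem_carrier by auto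
      have "c \<otimes> (a \<ominus> k) = c \<otimes> a \<ominus> c \<otimes> k" using acar kc c by algebra
      also have "\<dots> = s" unfolding sk(3) using kc c by algebra
      finally have "c \<otimes> (a \<ominus> k) \<in> S" using sk by simp
      moreover have "a \<ominus> k \<in> A" using a sk K L A by (intro ideal_mem_minus) auto
      ultimately have "a \<ominus> k \<in> K" using K by blast
      then have "(a \<ominus> k) \<oplus> k \<in> K" using sk K by (auto intro: ideal_mem_add)
      moreover have "(a \<ominus> k) \<oplus> k = a" using acar kc by algebra
      ultimately show False using a by simp
    qed
    ultimately show "S <+> scale c K \<subset> S <+> scale c L" by blast
  qed
  show "len S (S <+> scale c A) \<le> len ?N A" unfolding len_def
  proof (rule chain_height_mono_map[where F = "\<lambda>L. {a \<in> A. c \<otimes> a \<in> L}"])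
    fix L assume "L \<in> {K. ideal K R \<and> S \<subseteq> K \<and> K \<subseteq> S <+> scale c A}"
    then show "{a \<in> A. c \<otimes> a \<in> L} \<in> {K. ideal K R \<and> ?N \<subseteq> K \<and> K \<subseteq> A}"
      using c A by (auto intro!: colon_ideal)
  next
    fix K L assume K: "K \<in> {K. ideal K R \<and> S \<subseteq> K \<and> K \<subseteq> S <+> scale c A}"
      and L: "L \<in> {K. ideal K R \<and> S \<subseteq> K \<and> K \<subseteq> S <+> scale c A}" and KL: "K \<subset> L"
    from KL obtain l where l: "l \<in> L" "l \<notin> K" by blast
    then obtain s a where sa: "s \<in> S" "a \<in> A" "l = s \<oplus> c \<otimes> a"
      using L unfolding ideal_sum_mem scale_def by (auto simp: ideal_sum_mem subset_iff)
    have car: "s \<in> carrier R" "a \<in> carrier R" using sa S A ideal_mem_carrier by auto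
    have "l \<ominus> s \<in> L" using l sa L by (intro ideal_mem_minus) auto
    moreover have "l \<ominus> s = c \<otimes> a" unfolding sa(3) using car c by algebra
    ultimately have "c \<otimes> a \<in> L" by simp
    moreover have "c \<otimes> a \<notin> K"
    proof
      assume "c \<otimes> a \<in> K"
      then have "l \<in> K" unfolding sa(3) using sa K by (auto intro: ideal_mem_add)
      then show False using l by simp
    qed
    ultimately show "{a \<in> A. c \<otimes> a \<in> K} \<subset> {a \<in> A. c \<otimes> a \<in> L}" using KL sa by blast
  qed
qed

lemma len_antimono: "ideal A R \<Longrightarrow> ideal A' R \<Longrightarrow> ideal B R \<Longrightarrow> A \<subseteq> A' \<Longrightarrow> A' \<subseteq> B \<Longrightarrow> len A' B \<le> len A B"
  using len_add[of A A' B] by simp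

lemma len_mono: "ideal A R \<Longrightarrow> ideal B' R \<Longrightarrow> ideal B R \<Longrightarrow> A \<subseteq> B' \<Longrightarrow> B' \<subseteq> B \<Longrightarrow> len A B' \<le> len A B"
  using len_add[of A B' B] by simp

lemma scale_one: "ideal A R \<Longrightarrow> scale \<one> A = A"
  by (force simp: scale_def image_iff dest: ideal_mem_carrier)

text \<open>Second isomorphism theorem, the case \<open>c = 1\<close> of
  \<open>len_scale\<close>.\<close>

lemma len_diamond:
  assumes "ideal A R" "ideal S R"
  shows "len S (S <+> A) = len (A \<inter> S) A"
proof -
  have "{a \<in> A. \<one> \<otimes> a \<in> S} = A \<inter> S" using assms by (auto dest: ideal_mem_carrier)
  then show ?thesis using len_scale[of \<one> A S] assms by (simp add: scale_one)
qed

end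

section \<open>Numerical polynomials\<close>

text \<open>Functions that eventually agree with a numerical polynomial of degree less than \<open>d\<close>.\<close>

primrec numpoly :: "nat \<Rightarrow> (nat \<Rightarrow> int) \<Rightarrow> bool" where
  "numpoly 0 h \<longleftrightarrow> (\<forall>\<^sub>F n in sequentially. h n = 0)"
| "numpoly (Suc d) h \<longleftrightarrow> numpoly d (\<lambda>n. h (Suc n) - h n)"

lemma eventually_seq_Suc: "\<forall>\<^sub>F n in sequentially. P n \<Longrightarrow> \<forall>\<^sub>F n in sequentially. P (Suc n)"
  by (rule eventually_compose_filterlim[OF _ filterlim_Suc])

lemma eventually_seq_diff:
  "\<forall>\<^sub>F n in sequentially. P n \<Longrightarrow> \<forall>\<^sub>F n in sequentially. P (n - k :: nat)"
  by (rule eventually_compose_filterlim[OF _ filterlim_minus_const_nat_at_top])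

lemma numpoly_cong:
  assumes "numpoly d h" "\<forall>\<^sub>F n in sequentially. g n = h n" shows "numpoly d g"
  using assms
proof (induction d arbitrary: g h)
  case 0
  then show ?case by (auto elim: eventually_elim2)
next
  case (Suc d)
  have "\<forall>\<^sub>F n in sequentially. g (Suc n) - g n = h (Suc n) - h n"
    using Suc.prems(2) eventually_seq_Suc[OF Suc.prems(2)] by eventually_elim simp
  then show ?case using Suc.IH[of "\<lambda>n. h (Suc n) - h n"] Suc.prems(1) by simp
qed

lemma numpoly_zero: "numpoly d (\<lambda>_. 0)"
  by (induction d) auto

lemma numpoly_add: "numpoly d g \<Longrightarrow> numpoly d h \<Longrightarrow> numpoly d (\<lambda>n. g n + h n)"
proof (induction d arbitrary: g h)
  case 0
  then show ?case by (auto elim: eventually_elim2)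
next
  case (Suc d)
  have "numpoly d (\<lambda>n. (g (Suc n) - g n) + (h (Suc n) - h n))" using Suc by simp
  then show ?case by (simp add: algebra_simps)
qed

lemma numpoly_sum: "finite A \<Longrightarrow> (\<And>a. a \<in> A \<Longrightarrow> numpoly d (g a)) \<Longrightarrow> numpoly d (\<lambda>n. \<Sum>a\<in>A. g a n)"
  by (induction rule: finite_induct) (auto intro: numpoly_zero numpoly_add)

lemma numpoly_Suc_arg: "numpoly d h \<Longrightarrow> numpoly d (\<lambda>n. h (Suc n))"
proof (induction d arbitrary: h)
  case 0
  then show ?case using eventually_seq_Suc[of "\<lambda>n. h n = 0"] by simp
next
  case (Suc d)
  then show ?case using Suc.IH[of "\<lambda>n. h (Suc n) - h n"] by simp
qed

lemma numpoly_shift: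
  assumes "numpoly d h" shows "numpoly d (\<lambda>n. h (n - k))"
  using assms
proof (induction d arbitrary: h)
  case 0
  then show ?case using eventually_seq_diff[of "\<lambda>n. h n = 0"] by simp
next
  case (Suc d)
  have "numpoly d (\<lambda>n. h (Suc (n - k)) - h (n - k))"
    using Suc.IH[of "\<lambda>n. h (Suc n) - h n"] Suc.prems by simp
  moreover have "\<forall>\<^sub>F n in sequentially. h (Suc n - k) - h (n - k) = h (Suc (n - k)) - h (n - k)"
    using eventually_ge_at_top[of k] by eventually_elim (simp add: Suc_diff_le)
  ultimately show ?case using numpoly_cong by simp
qed

lemma numpoly_unshift:
  assumes "numpoly d (\<lambda>n. h (n + k))" shows "numpoly d h"
proof (rule numpoly_cong[OF numpoly_shift[OF assms, of k]])
  show "\<forall>\<^sub>F n in sequentially. h n = h (n - k + k)"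
    using eventually_ge_at_top[of k] by eventually_elim simp
qed

lemma numpoly_SucI: "numpoly d h \<Longrightarrow> numpoly (Suc d) h"
proof (induction d arbitrary: h)
  case 0
  from 0 have "\<forall>\<^sub>F n in sequentially. h n = 0" by simp
  from this eventually_seq_Suc[OF this] have "\<forall>\<^sub>F n in sequentially. h (Suc n) - h n = 0"
    by eventually_elim simp
  then show ?case by simp
next
  case (Suc d)
  then show ?case by (metis numpoly.simps(2))
qed

lemma numpoly_mono: "numpoly p h \<Longrightarrow> p \<le> q \<Longrightarrow> numpoly q h"
  by (induction q) (auto simp: le_Suc_eq simp del: numpoly.simps intro: numpoly_SucI)

text \<open>The right-hand side of the expansion that defines the Hilbert coefficients, as a
  function of \<open>n\<close>. The summand \<open>i = d\<close> is constant, so its truncated upper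
  index at \<open>n = 0\<close> is harmless.\<close>

definition binom_exp :: "nat \<Rightarrow> (nat \<Rightarrow> int) \<Rightarrow> nat \<Rightarrow> int" where
  "binom_exp d e n = (\<Sum>i\<le>d. (- 1) ^ i * e i * int ((n + d - Suc i) choose (d - i)))"

text \<open>Pascal's rule in each summand; the last one is constant and cancels. The right-hand side
  is taken at \<open>Suc n\<close>, which fixes the shift when a difference is summed up
  again.\<close>

lemma binom_exp_diff:
  "binom_exp (Suc d) e (Suc n) - binom_exp (Suc d) e n = binom_exp d e (Suc n)"
proof -
  have "binom_exp (Suc d) e (Suc n) - binom_exp (Suc d) e n
    = (\<Sum>i\<le>Suc d. (- 1) ^ i * e i * (int ((Suc n + Suc d - Suc i) choose (Suc d - i))
        - int ((n + Suc d - Suc i) choose (Suc d - i))))"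
    unfolding binom_exp_def by (simp add: sum_subtractf[symmetric] right_diff_distrib)
  also have "\<dots> = (\<Sum>i\<le>d. (- 1) ^ i * e i * (int ((Suc n + Suc d - Suc i) choose (Suc d - i))
        - int ((n + Suc d - Suc i) choose (Suc d - i))))" by simp
  also have "\<dots> = binom_exp d e (Suc n)" unfolding binom_exp_def
  proof (rule sum.cong)
    fix i assume "i \<in> {..d}"
    then have i: "Suc n + Suc d - Suc i = Suc (n + d - i)" "Suc d - i = Suc (d - i)"
      "n + Suc d - Suc i = n + d - i" "Suc n + d - Suc i = n + d - i" by auto
    show "(- 1) ^ i * e i * (int ((Suc n + Suc d - Suc i) choose (Suc d - i))
        - int ((n + Suc d - Suc i) choose (Suc d - i)))
      = (- 1) ^ i * e i * int ((Suc n + d - Suc i) choose (d - i))"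
      unfolding i by simp
  qed simp
  finally show ?thesis .
qed

lemma binom_exp_cong: "(\<And>i. i \<le> d \<Longrightarrow> e i = e' i) \<Longrightarrow> binom_exp d e n = binom_exp d e' n"
  unfolding binom_exp_def by (rule sum.cong) auto

lemma eventually_const:
  fixes h :: "nat \<Rightarrow> int"
  assumes "\<forall>\<^sub>F n in sequentially. h (Suc n) = h n"
  shows "\<exists>c. \<forall>\<^sub>F n in sequentially. h n = c"
proof -
  obtain N where N: "\<And>n. n \<ge> N \<Longrightarrow> h (Suc n) = h n"
    using assms unfolding eventually_sequentially by blast
  have "h n = h N" if "n \<ge> N" for n using that by (induction rule: dec_induct) (auto simp: N)
  then show ?thesis unfolding eventually_sequentially by blast
qed

text \<open>Discrete integration: expand the difference function, raise the degree by one with the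
  same coefficients, and absorb the eventually constant remainder into the last coefficient.\<close>

lemma numpoly_binom_exp:
  "numpoly (Suc d) h \<Longrightarrow> \<exists>e. \<forall>\<^sub>F n in sequentially. h n = binom_exp d e n"
proof (induction d arbitrary: h)
  case 0
  then obtain c where "\<forall>\<^sub>F n in sequentially. h n = c" using eventually_const[of h] by auto
  then show ?case by (intro exI[of _ "\<lambda>_. c"]) (simp add: binom_exp_def)
next
  case (Suc d)
  let ?g = "\<lambda>n. h (Suc (n - 1)) - h (n - 1)"
  have "numpoly (Suc d) ?g"
    using numpoly_shift[of "Suc d" "\<lambda>n. h (Suc n) - h n" 1] Suc.prems by simp
  then obtain e where e: "\<forall>\<^sub>F n in sequentially. ?g n = binom_exp d e n" using Suc.IH by blast
  define e0 where "e0 = e(Suc d := 0)"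
  have "\<forall>\<^sub>F n in sequentially. h (Suc n) - binom_exp (Suc d) e0 (Suc n) = h n - binom_exp (Suc d) e0 n"
    using eventually_seq_Suc[OF e]
  proof eventually_elim
    case (elim n)
    have "binom_exp d e (Suc n) = binom_exp d e0 (Suc n)"
      by (rule binom_exp_cong) (simp add: e0_def)
    with elim binom_exp_diff[of d e0 n] show ?case by simp
  qed
  from eventually_const[OF this] obtain c
    where c: "\<forall>\<^sub>F n in sequentially. h n - binom_exp (Suc d) e0 n = c" ..
  \<comment> \<open>The sign cancels the factor \<open>(- 1) ^ Suc d\<close> which the expansion
    puts on its last coefficient.\<close>
  define e1 where "e1 = e(Suc d := (- 1) ^ Suc d * c)"
  have "binom_exp (Suc d) e1 n = binom_exp (Suc d) e0 n + c" for n
  proof -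
    have "(\<Sum>i\<le>d. (- 1) ^ i * e1 i * int ((n + Suc d - Suc i) choose (Suc d - i)))
      = (\<Sum>i\<le>d. (- 1) ^ i * e0 i * int ((n + Suc d - Suc i) choose (Suc d - i)))"
      by (rule sum.cong) (auto simp: e0_def e1_def)
    moreover have "(- 1) ^ Suc d * e1 (Suc d) = c"
    proof -
      have "(- 1) ^ Suc d * (- 1) ^ Suc d = (1 :: int)" by (simp flip: power_mult_distrib)
      then show ?thesis unfolding e1_def fun_upd_same mult.assoc[symmetric] by simp
    qed
    moreover have "e0 (Suc d) = 0" by (simp add: e0_def)
    ultimately show ?thesis unfolding binom_exp_def sum.atMost_Suc by simp
  qed
  then have "\<forall>\<^sub>F n in sequentially. h n = binom_exp (Suc d) e1 n"
    using c by (auto elim!: eventually_mono)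
  then show ?case by blast
qed

lemma choose_poly:
  fixes m k n :: nat
  shows "of_nat ((n + m) choose k) = ((\<Prod>j<k. of_nat n + (of_nat m - of_nat j)) / fact k :: 'a :: field_char_0)"
proof -
  have "of_nat ((n + m) choose k) = (of_nat (n + m) gchoose k :: 'a)" by (rule binomial_gbinomial)
  also have "\<dots> = (\<Prod>j<k. of_nat n + (of_nat m - of_nat j)) / fact k"
    by (simp add: gbinomial_prod_rev atLeast0LessThan algebra_simps)
  finally show ?thesis .
qed

lemma choose_lim: "(\<lambda>n. real ((n + m) choose k) / real n ^ k) \<longlonglongrightarrow> 1 / fact k"
proof -
  have "(\<lambda>n. (\<Prod>j<k. (1 + (real m - real j) / real n)) / fact k) \<longlonglongrightarrow> (\<Prod>j<k. 1 + 0) / fact k"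
    by (intro tendsto_intros lim_const_over_n) auto
  moreover have "\<forall>\<^sub>F n in sequentially. (\<Prod>j<k. (1 + (real m - real j) / real n)) / fact k
      = real ((n + m) choose k) / real n ^ k"
    using eventually_gt_at_top[of 0]
  proof eventually_elim
    case (elim n)
    have "(\<Prod>j<k. real n + (real m - real j)) = (\<Prod>j<k. real n * (1 + (real m - real j) / real n))"
      using elim by (intro prod.cong) (auto simp: field_simps)
    also have "\<dots> = real n ^ k * (\<Prod>j<k. 1 + (real m - real j) / real n)"
      by (simp add: prod.distrib)
    finally show ?case using elim by (simp add: choose_poly)
  qed
  ultimately show ?thesis by (auto dest: Lim_transform_eventually)
qed

lemma binom_exp_lim: "(\<lambda>n. real_of_int (binom_exp d e n) / real n ^ d) \<longlonglongrightarrow> real_of_int (e 0) / fact d"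
proof -
  have t: "(\<lambda>n. real_of_int ((- 1) ^ i * e i) * (real ((n + d - Suc i) choose (d - i)) / real n ^ d))
      \<longlonglongrightarrow> (if i = 0 then real_of_int (e 0) / fact d else 0)" if "i \<le> d" for i
  proof (cases "i = 0")
    case True
    show ?thesis
    proof (cases d)
      case (Suc d')
      have "(\<lambda>n. real ((n + d') choose d) / real n ^ d) \<longlonglongrightarrow> 1 / fact d" by (rule choose_lim)
      then show ?thesis using True tendsto_mult_left[of _ _ _ "real_of_int (e 0)"] Suc by fastforce
    qed (use True in simp)
  next
    case False
    have l: "(\<lambda>n. real ((n + d - Suc i) choose (d - i)) / real n ^ (d - i)) \<longlonglongrightarrow> 1 / fact (d - i)"
    proof (cases "i = d")
      case False
      with that have "\<And>n. n + d - Suc i = n + (d - Suc i)" by auto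
      then show ?thesis using choose_lim by simp
    qed simp
    have "(\<lambda>n. (1 / real n) ^ i) \<longlonglongrightarrow> 0"
      by (rule tendsto_null_power[OF lim_const_over_n]) (use False in simp)
    from tendsto_mult[OF l this]
    have "(\<lambda>n. real ((n + d - Suc i) choose (d - i)) / real n ^ (d - i) * (1 / real n) ^ i) \<longlonglongrightarrow> 0"
      by (simp only: mult_zero_right)
    moreover have "real n ^ (d - i) * real n ^ i = real n ^ d" for n
      using that by (simp flip: power_add)
    ultimately have "(\<lambda>n. real ((n + d - Suc i) choose (d - i)) / real n ^ d) \<longlonglongrightarrow> 0"
      by (simp add: power_one_over)
    from tendsto_mult_left[OF this] False show ?thesis by simp
  qed
  have "(\<lambda>n. \<Sum>i\<le>d. real_of_int ((- 1) ^ i * e i) * (real ((n + d - Suc i) choose (d - i)) / real n ^ d))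
     \<longlonglongrightarrow> (\<Sum>i\<le>d. if i = 0 then real_of_int (e 0) / fact d else 0)"
    by (intro tendsto_sum t) auto
  then show ?thesis by (simp add: binom_exp_def sum_divide_distrib)
qed

lemma numpoly_lim_zero:
  assumes "numpoly p h" "p \<le> d"
  shows "(\<lambda>n. real_of_int (h n) / real n ^ d) \<longlonglongrightarrow> 0"
proof (cases p)
  case 0
  with assms show ?thesis by (intro tendsto_eventually) (auto elim: eventually_mono)
next
  case (Suc q)
  then obtain e where e: "\<forall>\<^sub>F n in sequentially. h n = binom_exp q e n"
    using assms numpoly_binom_exp by blast
  have "(\<lambda>n. (1 / real n) ^ (d - q)) \<longlonglongrightarrow> 0"
    by (rule tendsto_null_power[OF lim_const_over_n]) (use Suc assms(2) in simp)
  from tendsto_mult[OF binom_exp_lim this]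
  have "(\<lambda>n. real_of_int (binom_exp q e n) / real n ^ q * (1 / real n) ^ (d - q)) \<longlonglongrightarrow> 0"
    by (simp only: mult_zero_right)
  moreover have "real n ^ q * real n ^ (d - q) = real n ^ d" for n
    using Suc assms(2) by (simp flip: power_add)
  ultimately have "(\<lambda>n. real_of_int (binom_exp q e n) / real n ^ d) \<longlonglongrightarrow> 0"
    by (simp add: power_one_over)
  then show ?thesis by (rule Lim_transform_eventually) (use e in eventually_elim, simp)
qed

text \<open>Reindexing by \<open>i = Suc j\<close> produces the sign. Once multiplicities cancel,
  this turns a difference of coefficients with index 1 into a leading coefficient.\<close>

lemma binom_exp_drop:
  assumes "e 0 = 0" shows "binom_exp (Suc d) e n = - binom_exp d (\<lambda>i. e (Suc i)) n"
  unfolding binom_exp_def using assms by (subst sum.atMost_Suc_shift) (simp add: sum_negf)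

lemma binom_exp_minus: "binom_exp d e n - binom_exp d e' n = binom_exp d (\<lambda>i. e i - e' i) n"
  unfolding binom_exp_def by (simp add: sum_subtractf[symmetric] algebra_simps)

text \<open>By linearity it suffices to treat the zero function: the limit after division by the top
  power of \<open>n\<close> kills the leading coefficient, and \<open>binom_exp_drop\<close> lowers
  the degree.\<close>

lemma binom_exp_unique:
  assumes "\<forall>\<^sub>F n in sequentially. binom_exp d e n = binom_exp d e' n" "i \<le> d"
  shows "e i = e' i"
proof -
  have "e i = 0" if "\<forall>\<^sub>F n in sequentially. binom_exp d e n = 0" "i \<le> d" for e i
    using that
  proof (induction d arbitrary: e i)
    case 0
    then show ?case by (simp add: binom_exp_def)
  next
    case (Suc d)
    have "\<forall>\<^sub>F n in sequentially. real_of_int (binom_exp (Suc d) e n) / real n ^ Suc d = 0"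
      using Suc.prems(1) by eventually_elim simp
    then have "(\<lambda>n. real_of_int (binom_exp (Suc d) e n) / real n ^ Suc d) \<longlonglongrightarrow> 0"
      by (rule tendsto_eventually)
    with binom_exp_lim[of "Suc d" e] have "real_of_int (e 0) / fact (Suc d) = 0"
      by (rule LIMSEQ_unique)
    then have e0: "e 0 = 0" by simp
    show ?case
    proof (cases i)
      case (Suc j)
      then show ?thesis using Suc.IH[of "\<lambda>i. e (Suc i)" j] Suc.prems binom_exp_drop[of e] e0 by simp
    qed (use e0 in simp)
  qed
  from this[of "\<lambda>i. e i - e' i" i] assms show ?thesis by (simp flip: binom_exp_minus)
qed

lemma binom_exp_poly:
  "\<exists>P :: rat poly. (\<forall>n>0. of_int (binom_exp d e n) = poly P (of_nat n)) \<and>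
    degree P \<le> d \<and> poly.coeff P d = of_int (e 0) / fact d"
proof -
  define B :: "nat \<Rightarrow> nat \<Rightarrow> rat poly" where
    "B m k = smult (1 / fact k) (\<Prod>j<k. [:of_nat m - of_nat j, 1:])" for m k
  have Bpoly: "poly (B m k) (of_nat n) = of_nat ((n + m) choose k)" for m k n
    by (simp add: B_def choose_poly poly_prod algebra_simps)
  have deg: "degree (\<Prod>j<k. [:of_nat m - of_nat j, 1:] :: rat poly) = k" for m k
    by (subst degree_prod_eq_sum_degree) auto
  have lead: "poly.coeff (\<Prod>j<k. [:of_nat m - of_nat j, 1:] :: rat poly) k = 1" for m k
    using deg[of m k] lead_coeff_prod[of "\<lambda>j. [:of_nat m - of_nat j, 1:] :: rat poly" "{..<k}"] by simp
  have Bdeg: "degree (B m k) = k" for m k by (simp add: B_def deg)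
  have Blead: "poly.coeff (B m k) k = 1 / fact k" for m k by (simp add: B_def lead)
  define P where "P = (\<Sum>i\<le>d. smult (of_int ((- 1) ^ i * e i)) (B (d - Suc i) (d - i)))"
  show ?thesis
  proof (intro exI[of _ P] conjI allI impI)
    fix n :: nat assume n: "n > 0"
    have "of_int (binom_exp d e n)
      = (\<Sum>i\<le>d. of_int ((- 1) ^ i * e i) * (of_nat ((n + (d - Suc i)) choose (d - i)) :: rat))"
      unfolding binom_exp_def of_int_sum
    proof (rule sum.cong)
      fix i assume "i \<in> {..d}"
      then have "(n + d - Suc i) choose (d - i) = (n + (d - Suc i)) choose (d - i)"
        by (cases "i = d") auto
      then show "of_int ((- 1) ^ i * e i * int ((n + d - Suc i) choose (d - i)))
        = of_int ((- 1) ^ i * e i) * (of_nat ((n + (d - Suc i)) choose (d - i)) :: rat)" by simp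
    qed simp
    then show "of_int (binom_exp d e n) = poly P (of_nat n)"
      by (simp add: P_def poly_sum Bpoly)
  next
    show "degree P \<le> d" unfolding P_def
      by (intro degree_sum_le) (auto intro: order_trans[OF degree_smult_le] simp: Bdeg)
    have "poly.coeff P d = (\<Sum>i\<le>d. of_int ((- 1) ^ i * e i) * poly.coeff (B (d - Suc i) (d - i)) d)"
      by (simp add: P_def coeff_sum)
    also have "\<dots> = (\<Sum>i\<le>d. if i = 0 then of_int (e 0) / fact d else 0)"
    proof (rule sum.cong)
      fix i assume "i \<in> {..d}"
      then show "of_int ((- 1) ^ i * e i) * poly.coeff (B (d - Suc i) (d - i)) d
        = (if i = 0 then of_int (e 0) / fact d else 0)"
        using Bdeg[of "d - Suc i" "d - i"] by (auto simp: Blead intro!: coeff_eq_0)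
    qed simp
    finally show "poly.coeff P d = of_int (e 0) / fact d" by simp
  qed
qed

text \<open>Polynomials that agree at infinitely many natural numbers are equal, so the description
  is unique. \<open>e 0 \<noteq> 0\<close> ensures that \<open>lead_coeff\<close> reads the
  coefficient at \<open>d\<close> and not a lower one.\<close>

lemma the_hilbert_poly:
  fixes h :: "nat \<Rightarrow> nat"
  assumes h: "\<forall>\<^sub>F n in sequentially. int (h n) = binom_exp d e n" and e0: "e 0 \<noteq> 0"
  shows "lead_coeff (THE P :: rat poly. \<forall>\<^sub>F n in sequentially. of_nat (h n) = poly P (of_nat n))
    = of_int (e 0) / fact d"
proof -
  obtain P :: "rat poly" where P: "\<And>n. n > 0 \<Longrightarrow> of_int (binom_exp d e n) = poly P (of_nat n)"
    "degree P \<le> d" "poly.coeff P d = of_int (e 0) / fact d" using binom_exp_poly[of d e] by blast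
  have hP: "\<forall>\<^sub>F n in sequentially. of_nat (h n) = poly P (of_nat n)"
    using h eventually_gt_at_top[of 0]
  proof eventually_elim
    case (elim n)
    then have "(of_nat (h n) :: rat) = of_int (binom_exp d e n)" by (metis of_int_of_nat_eq)
    then show ?case using P(1) elim by simp
  qed
  have "Q = P" if "\<forall>\<^sub>F n in sequentially. of_nat (h n) = poly Q (of_nat n)" for Q
  proof (rule ccontr)
    assume "Q \<noteq> P"
    then have fin: "finite {x. poly (Q - P) x = 0}" by (intro poly_roots_finite) simp
    from that hP have "\<forall>\<^sub>F n in sequentially. poly (Q - P) (of_nat n) = 0"
      by eventually_elim simp
    then obtain N where "\<And>n. n \<ge> N \<Longrightarrow> poly (Q - P) (of_nat n) = 0"
      unfolding eventually_sequentially by blast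
    then have "of_nat ` {N..} \<subseteq> {x. poly (Q - P) x = 0}" by auto
    with fin have "finite ((of_nat :: nat \<Rightarrow> rat) ` {N..})" by (rule rev_finite_subset)
    then have "finite {N..}" by (rule finite_imageD) (simp add: inj_on_def)
    then show False using infinite_Ici by blast
  qed
  with hP have "(THE P. \<forall>\<^sub>F n in sequentially. of_nat (h n) = poly P (of_nat n)) = P"
    by (intro the_equality)
  moreover have "degree P = d" using P(2,3) e0 by (intro antisym le_degree) auto
  ultimately show ?thesis using P(3) by simp
qed

text \<open>The number of monomials of degree \<open>n\<close> in \<open>d\<close> variables. Truncated subtraction makes this
  correct for \<open>d = 0\<close> too.\<close>

definition monomials :: "nat \<Rightarrow> nat \<Rightarrow> nat" where
  "monomials d n = (n + d - 1) choose n"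

lemma monomials_zero: "monomials 0 n = (if n = 0 then 1 else 0)"
  by (simp add: monomials_def)

text \<open>A monomial in \<open>Suc d\<close> variables consists of the exponent \<open>a\<close>
  of one variable and a monomial of degree \<open>n - a\<close> in the others. The sum has the shape
  of the one in \<open>len_slices\<close>.\<close>

lemma monomials_Suc: "monomials (Suc d) n = (\<Sum>a\<le>n. monomials d (n - a))"
proof -
  have "(\<Sum>a\<le>n. monomials d (n - a)) = (\<Sum>a\<le>n. monomials d a)"
    by (rule sum.reindex_bij_witness[of _ "\<lambda>a. n - a" "\<lambda>a. n - a"]) auto
  also have "\<dots> = (n + d) choose n"
  proof (cases d)
    case 0
    then show ?thesis by (simp add: monomials_zero sum.delta)
  next
    case (Suc c)
    then show ?thesis using sum_choose_lower[of c n] by (simp add: monomials_def add.commute)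
  qed
  finally show ?thesis by (simp add: monomials_def)
qed

lemma monomials_Suc_arg: "0 < d \<Longrightarrow> monomials d n \<le> monomials d (Suc n)"
proof -
  assume "0 < d"
  then obtain e where d: "d = Suc e" by (cases d) auto
  have "monomials d (Suc n) = monomials d n + monomials e (Suc n)"
    using sum.atMost_Suc_shift[of "\<lambda>a. monomials e (Suc n - a)" n] unfolding d monomials_Suc by simp
  then show ?thesis by simp
qed

lemma monomials_mono: "p \<le> q \<Longrightarrow> monomials p n \<le> monomials q n"
proof (induction q)
  case (Suc q)
  have "monomials q n \<le> monomials (Suc q) n"
    unfolding monomials_Suc by (rule order_trans[OF _ member_le_sum[of 0]]) auto
  with Suc show ?case by (auto simp: le_Suc_eq)
qed simp

lemma monomials_lim: "(\<lambda>n. real (monomials (Suc d) n) / real n ^ d) \<longlonglongrightarrow> 1 / fact d"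
proof -
  have "monomials (Suc d) n = (n + d) choose d" for n
    using binomial_symmetric[of n "n + d"] by (simp add: monomials_def)
  then show ?thesis using choose_lim[of d d] by simp
qed

lemma monomials_lim_zero: "p \<le> d \<Longrightarrow> (\<lambda>n. real (monomials p n) / real n ^ d) \<longlonglongrightarrow> 0"
proof -
  assume pd: "p \<le> d"
  have "numpoly p (\<lambda>n. int (monomials p n))"
  proof (induction p)
    case 0
    show ?case using eventually_gt_at_top[of 0] by (auto simp: monomials_zero elim: eventually_mono)
  next
    case (Suc p)
    have "int (monomials (Suc p) (Suc n)) - int (monomials (Suc p) n) = int (monomials p (Suc n))" for n
      using sum.atMost_Suc_shift[of "\<lambda>a. monomials p (Suc n - a)" n] by (simp add: monomials_Suc)
    then show ?case using numpoly_Suc_arg[OF Suc] by simp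
  qed
  then show ?thesis using numpoly_lim_zero[OF _ pd, of "\<lambda>n. int (monomials p n)"] by simp
qed

text \<open>Discrete integration of a lower bound: applying the inequality for \<open>h\<close>
  about \<open>n / (2t)\<close> times collects that many values of \<open>g\<close>, all at
  arguments at least \<open>n / 2\<close>.\<close>

lemma growth_step:
  fixes h g :: "nat \<Rightarrow> nat" and c :: real
  assumes c: "c > 0" and t: "t > 0" and g: "\<And>n. n \<ge> N \<Longrightarrow> c * real n ^ k \<le> real (g n)"
    and h: "\<And>n. n \<ge> t \<Longrightarrow> g n + h (n - t) \<le> h n"
  shows "\<exists>c'>0. \<exists>N'. \<forall>n\<ge>N'. c' * real n ^ Suc k \<le> real (h n)"
proof -
  have iter: "real j * (c * real (n - j * t) ^ k) \<le> real (h n)" if "n - j * t \<ge> max N t" for j n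
    using that
  proof (induction j arbitrary: n)
    case (Suc j)
    then have n: "n \<ge> t" "n \<ge> N" "n - t - j * t \<ge> max N t" "n - Suc j * t = n - t - j * t"
      by (auto simp: algebra_simps)
    have "c * real (n - t - j * t) ^ k \<le> c * real n ^ k"
      using c by (intro mult_left_mono power_mono) auto
    also have "\<dots> \<le> real (g n)" by (rule g[OF n(2)])
    finally have "c * real (n - t - j * t) ^ k \<le> real (g n)" .
    moreover have "real j * (c * real (n - t - j * t) ^ k) \<le> real (h (n - t))"
      by (rule Suc.IH[OF n(3)])
    moreover have "real (g n) + real (h (n - t)) \<le> real (h n)"
      using h[OF n(1)] by (simp flip: of_nat_add)
    ultimately show ?case unfolding n(4) by (simp add: algebra_simps)
  qed simp
  \<comment> \<open>The factor \<open>1 / (4t)\<close> comes from \<open>j \<ge> n / (4t)\<close>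
    and \<open>1 / 2^k\<close> from \<open>n - j t \<ge> n / 2\<close>. The threshold
    \<open>4t + 2N\<close> below makes the first hold and keeps the arguments above \<open>N\<close>
    and \<open>t\<close>.\<close>
  define c' where "c' = c / (4 * real t * 2 ^ k)"
  have "c' * real n ^ Suc k \<le> real (h n)" if n: "n \<ge> 4 * t + 2 * N" for n
  proof -
    define j where "j = n div (2 * t)"
    have jt: "2 * (j * t) \<le> n" unfolding j_def
      using div_times_less_eq_dividend[of n "2 * t"] by (simp add: algebra_simps)
    have jlow: "n < 2 * t * (j + 1)" unfolding j_def
      using t by (metis Suc_eq_plus1 dividend_less_times_div mult_pos_pos mult_Suc_right add.commute zero_less_numeral)
    have "real n \<le> 2 * real t * (real j + 1)"
    proof -
      have "real n < real (2 * t * (j + 1))" using jlow by (simp only: of_nat_less_iff)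
      then show ?thesis by (simp add: algebra_simps)
    qed
    moreover have "4 * real t \<le> real n" using n by simp
    ultimately have j: "real n / (4 * real t) \<le> real j" using t by (simp add: field_simps)
    have half: "real n / 2 \<le> real (n - j * t)"
    proof -
      have "real (2 * (j * t)) \<le> real n" using jt by (simp only: of_nat_le_iff)
      moreover have "real (n - j * t) = real n - real (j * t)" using jt by (intro of_nat_diff) simp
      ultimately show ?thesis by simp
    qed
    have "c' * real n ^ Suc k = real n / (4 * real t) * (c * (real n / 2) ^ k)"
      by (simp add: c'_def power_divide)
    also have "\<dots> \<le> real j * (c * real (n - j * t) ^ k)"
      using j half c t by (intro mult_mono power_mono) auto
    also have "\<dots> \<le> real (h n)" by (rule iter) (use jt n t in linarith)
    finally show ?thesis .
  qed
  moreover have "c' > 0" using c t by (simp add: c'_def)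
  ultimately show ?thesis by blast
qed

section \<open>Graded submodules\<close>

context cring
begin

lemma prod_mono: "A \<subseteq> A' \<Longrightarrow> B \<subseteq> B' \<Longrightarrow> A \<cdot> B \<subseteq> A' \<cdot> B'"
proof
  fix z assume AB: "A \<subseteq> A'" "B \<subseteq> B'" "z \<in> A \<cdot> B"
  from AB(3) show "z \<in> A' \<cdot> B'"
    by induction (use AB(1,2) in \<open>auto intro: ideal_prod.intros\<close>)
qed

lemma prod_least:
  assumes "ideal C R" "\<And>a b. a \<in> A \<Longrightarrow> b \<in> B \<Longrightarrow> a \<otimes> b \<in> C" shows "A \<cdot> B \<subseteq> C"
proof
  fix z assume "z \<in> A \<cdot> B"
  then show "z \<in> C" by induction (auto intro: assms ideal_mem_add)
qed

definition ipow :: "'a set \<Rightarrow> nat \<Rightarrow> 'a set" where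
  "ipow Q n = ideal_pow R Q n"

lemma ipow_0: "ipow Q 0 = carrier R"
  by (simp add: ipow_def nat_pow_def) (simp add: ideals_set_def)

lemma ipow_Suc: "ipow Q (Suc n) = ipow Q n \<cdot> Q"
  by (simp add: ipow_def nat_pow_def) (simp add: ideals_set_def)

lemma ipow_ideal: "ideal Q R \<Longrightarrow> ideal (ipow Q n) R"
  by (induction n) (simp_all add: ipow_0 ipow_Suc oneideal ideal_prod_is_ideal)

lemma ipow_Suc': "ideal Q R \<Longrightarrow> ipow Q (Suc n) = Q \<cdot> ipow Q n"
  unfolding ipow_Suc by (rule ideal_prod_commute[OF ipow_ideal])

lemma ipow_1: "ideal Q R \<Longrightarrow> ipow Q (Suc 0) = Q"
  using ipow_Suc'[of Q 0] by (simp only: ipow_0 ideal_prod_one)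

lemma ipow_mono: "A \<subseteq> B \<Longrightarrow> ipow A n \<subseteq> ipow B n"
  by (induction n) (simp_all add: ipow_0 ipow_Suc prod_mono)

lemma carrier_prod: "ideal E R \<Longrightarrow> carrier R \<cdot> E = E"
  using ideal_prod_commute[OF oneideal] ideal_prod_one by simp

lemma ipow_add: "ideal Q R \<Longrightarrow> ipow Q (m + n) = ipow Q m \<cdot> ipow Q n"
proof (induction m)
  case 0
  then show ?case by (simp add: ipow_0 carrier_prod ipow_ideal)
next
  case (Suc m)
  then show ?case
    by (simp add: ipow_Suc' ideal_prod_assoc ipow_ideal)
qed

lemma pow_mem_ipow: "ideal Q R \<Longrightarrow> x \<in> Q \<Longrightarrow> x [^] n \<in> ipow Q n"
  by (induction n) (simp_all add: ipow_0 ipow_Suc ideal_prod.prod)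

lemma prod_subset_right: "ideal A R \<Longrightarrow> ideal B R \<Longrightarrow> A \<cdot> B \<subseteq> B"
  using ideal_prod_inter by blast

lemma ipow_antimono: "ideal Q R \<Longrightarrow> m \<le> n \<Longrightarrow> ipow Q n \<subseteq> ipow Q m"
  using ipow_add[of Q "n - m" m] prod_subset_right[of "ipow Q (n - m)" "ipow Q m"]
  by (simp add: ipow_ideal)

text \<open>The filtration of \<open>(x, Y)^n E\<close> by degree in \<open>x\<close>: step
  \<open>a\<close> collects the terms \<open>x^b Y^(n-b) E\<close> with \<open>b < a\<close>, and
  step \<open>Suc n\<close> is everything (\<open>slices_full\<close>).\<close>

primrec slices :: "'a \<Rightarrow> 'a set \<Rightarrow> 'a set \<Rightarrow> nat \<Rightarrow> nat \<Rightarrow> 'a set" where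
  "slices x Y E n 0 = {\<zero>}"
| "slices x Y E n (Suc a) = slices x Y E n a <+> scale (x [^] a) (ipow Y (n - a) \<cdot> E)"

text \<open>A graded submodule of \<open>\<Oplus> Q\<^sup>n E\<close> over the Rees algebra of \<open>Q\<close>.\<close>

definition graded :: "'a set \<Rightarrow> 'a set \<Rightarrow> (nat \<Rightarrow> 'a set) \<Rightarrow> bool" where
  "graded Q E D \<longleftrightarrow> (\<forall>n. ideal (D n) R \<and> D n \<subseteq> ipow Q n \<cdot> E \<and> (\<forall>c\<in>Q. \<forall>e\<in>D n. c \<otimes> e \<in> D (Suc n)))"

text \<open>Leading coefficients of \<open>D\<close> with respect to \<open>x\<^sup>a\<close>.\<close>

definition slice :: "'a \<Rightarrow> 'a set \<Rightarrow> 'a set \<Rightarrow> (nat \<Rightarrow> 'a set) \<Rightarrow> nat \<Rightarrow> nat \<Rightarrow> 'a set" where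
  "slice x Y E D a m = {e \<in> ipow Y m \<cdot> E. x [^] a \<otimes> e \<in> slices x Y E (a + m) a <+> D (a + m)}"

lemma gradedD:
  assumes "graded Q E D"
  shows "ideal (D n) R" "D n \<subseteq> ipow Q n \<cdot> E" "c \<in> Q \<Longrightarrow> e \<in> D n \<Longrightarrow> c \<otimes> e \<in> D (Suc n)"
  using assms unfolding graded_def by auto

context
  fixes x Y E Q
  assumes x: "x \<in> carrier R" and Y: "ideal Y R" and E: "ideal E R" and Q: "Q = PIdl x <+> Y"
begin

lemma Q_ideal: "ideal Q R"
  unfolding Q by (intro add_ideals cgenideal_ideal x Y)

lemma x_Q: "x \<in> Q"
  using ideal_sum_upper1[OF cgenideal_ideal[OF x] Y] cgenideal_self[OF x] Q by blast

lemma Y_Q: "Y \<subseteq> Q"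
  using ideal_sum_upper2[OF cgenideal_ideal[OF x] Y] Q by blast

lemma powYE_ideal: "ideal (ipow Y n \<cdot> E) R"
  by (intro ideal_prod_is_ideal ipow_ideal Y E)

lemma slices_ideal: "ideal (slices x Y E n a) R"
  by (induction a) (simp_all add: zeroideal add_ideals scale_ideal powYE_ideal x)

lemma slices_Suc_sub: "slices x Y E n a \<subseteq> slices x Y E n (Suc a)"
  by (simp add: ideal_sum_upper1 slices_ideal scale_ideal powYE_ideal x)

lemma slices_top: "e \<in> ipow Y (n - a) \<cdot> E \<Longrightarrow> x [^] a \<otimes> e \<in> slices x Y E n (Suc a)"
  using ideal_sum_upper2[OF slices_ideal[of n a] scale_ideal[of "x [^] a", OF _ powYE_ideal[of "n - a"]]] x
  by (auto simp: scale_def)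

lemma slices_x: "s \<in> slices x Y E n a \<Longrightarrow> x \<otimes> s \<in> slices x Y E (Suc n) (Suc a)"
proof (induction a arbitrary: s)
  case 0
  then show ?case using ideal_mem_zero[OF slices_ideal] x by (simp del: slices.simps(2))
next
  case (Suc a)
  then obtain s' e where s: "s' \<in> slices x Y E n a" "e \<in> ipow Y (n - a) \<cdot> E" "s = s' \<oplus> x [^] a \<otimes> e"
    by (auto simp: ideal_sum_mem scale_def)
  have c: "s' \<in> carrier R" "e \<in> carrier R"
    using s ideal_mem_carrier slices_ideal powYE_ideal by blast+
  have "x \<otimes> s = x \<otimes> s' \<oplus> x [^] Suc a \<otimes> e"
    using c x by (simp add: s(3) r_distr m_ac)
  moreover have "x \<otimes> s' \<in> slices x Y E (Suc n) (Suc (Suc a))"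
    using Suc.IH[OF s(1)] slices_Suc_sub by blast
  moreover have "x [^] Suc a \<otimes> e \<in> slices x Y E (Suc n) (Suc (Suc a))"
    by (rule slices_top) (use s in simp)
  ultimately show ?case using ideal_mem_add[OF slices_ideal] by metis
qed

lemma slices_Y: "s \<in> slices x Y E n a \<Longrightarrow> a \<le> Suc n \<Longrightarrow> y \<in> Y \<Longrightarrow> y \<otimes> s \<in> slices x Y E (Suc n) a"
proof (induction a arbitrary: s)
  case 0
  then show ?case using ideal_mem_carrier[OF Y] by simp
next
  case (Suc a)
  then obtain s' e where s: "s' \<in> slices x Y E n a" "e \<in> ipow Y (n - a) \<cdot> E" "s = s' \<oplus> x [^] a \<otimes> e"
    by (auto simp: ideal_sum_mem scale_def)
  have c: "s' \<in> carrier R" "e \<in> carrier R" "y \<in> carrier R"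
    using s ideal_mem_carrier slices_ideal powYE_ideal Y Suc.prems by blast+
  have "y \<otimes> s = y \<otimes> s' \<oplus> x [^] a \<otimes> (y \<otimes> e)"
    using c x by (simp add: s(3) r_distr m_ac)
  moreover have "y \<otimes> s' \<in> slices x Y E (Suc n) (Suc a)"
    using Suc.IH[OF s(1)] Suc.prems slices_Suc_sub by (meson Suc_leD subsetD)
  moreover have "x [^] a \<otimes> (y \<otimes> e) \<in> slices x Y E (Suc n) (Suc a)"
  proof (rule slices_top)
    have "y \<otimes> e \<in> Y \<cdot> (ipow Y (n - a) \<cdot> E)" using Suc.prems s by (intro ideal_prod.prod)
    also have "\<dots> = ipow Y (Suc (n - a)) \<cdot> E"
      by (simp only: ipow_Suc'[OF Y] ideal_prod_assoc[OF Y ipow_ideal[OF Y] E])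
    also have "Suc (n - a) = Suc n - a" using Suc.prems by simp
    finally show "y \<otimes> e \<in> ipow Y (Suc n - a) \<cdot> E" .
  qed
  ultimately show ?case using ideal_mem_add[OF slices_ideal] by metis
qed

lemma slices_sub: "a \<le> Suc n \<Longrightarrow> slices x Y E n a \<subseteq> ipow Q n \<cdot> E"
proof (induction a)
  case 0
  show ?case using ideal_mem_zero[OF ideal_prod_is_ideal[OF ipow_ideal[OF Q_ideal] E]] by simp
next
  case (Suc a)
  have "scale (x [^] a) (ipow Y (n - a) \<cdot> E) \<subseteq> ipow Q n \<cdot> E"
  proof
    fix z assume "z \<in> scale (x [^] a) (ipow Y (n - a) \<cdot> E)"
    then obtain e where e: "e \<in> ipow Y (n - a) \<cdot> E" "z = x [^] a \<otimes> e" by (auto simp: scale_def)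
    have "e \<in> ipow Q (n - a) \<cdot> E" using e(1) prod_mono[OF ipow_mono[OF Y_Q] order_refl] by blast
    then have "z \<in> ipow Q a \<cdot> (ipow Q (n - a) \<cdot> E)"
      unfolding e(2) by (intro ideal_prod.prod pow_mem_ipow Q_ideal x_Q)
    also have "\<dots> = ipow Q (a + (n - a)) \<cdot> E"
      by (simp only: ipow_add[OF Q_ideal] ideal_prod_assoc[OF ipow_ideal[OF Q_ideal] ipow_ideal[OF Q_ideal] E])
    also have "a + (n - a) = n" using Suc.prems by simp
    finally show "z \<in> ipow Q n \<cdot> E" .
  qed
  then show ?case using Suc
    by (simp add: ideal_sum_least ideal_prod_is_ideal ipow_ideal Q_ideal E)
qed

text \<open>By induction on \<open>n\<close>: for \<open>c = r x + y\<close> in \<open>Q\<close>,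
  the factor \<open>x\<close> moves a term one slice up, while \<open>y\<close> leaves it in its
  slice.\<close>

lemma slices_full: "slices x Y E n (Suc n) = ipow Q n \<cdot> E"
proof
  show "ipow Q n \<cdot> E \<subseteq> slices x Y E n (Suc n)"
  proof (induction n)
    case 0
    have "ipow Q 0 \<cdot> E = E" by (simp only: ipow_0 carrier_prod[OF E])
    moreover have "e \<in> slices x Y E 0 (Suc 0)" if "e \<in> E" for e
    proof -
      have "e \<in> ipow Y (0 - 0) \<cdot> E" using that by (simp add: ipow_0 carrier_prod[OF E])
      from slices_top[OF this] that show ?thesis by (simp add: ideal_mem_carrier[OF E] del: slices.simps)
    qed
    ultimately show ?case by blast
  next
    case (Suc n)
    have "ipow Q (Suc n) \<cdot> E = Q \<cdot> (ipow Q n \<cdot> E)"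
      by (simp only: ipow_Suc'[OF Q_ideal] ideal_prod_assoc[OF Q_ideal ipow_ideal[OF Q_ideal] E])
    also have "\<dots> \<subseteq> slices x Y E (Suc n) (Suc (Suc n))"
    proof (rule prod_least[OF slices_ideal])
      fix c e assume c: "c \<in> Q" and "e \<in> ipow Q n \<cdot> E"
      then have e: "e \<in> slices x Y E n (Suc n)" using Suc.IH by blast
      have ec: "e \<in> carrier R" using e slices_ideal ideal_mem_carrier by blast
      from c obtain r y where ry: "r \<in> carrier R" "y \<in> Y" "c = r \<otimes> x \<oplus> y"
        unfolding Q ideal_sum_mem cgenideal_def by blast
      have "c \<otimes> e = r \<otimes> (x \<otimes> e) \<oplus> y \<otimes> e"
        using ry ec x ideal_mem_carrier[OF Y] by (simp add: l_distr m_assoc)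
      moreover have "r \<otimes> (x \<otimes> e) \<in> slices x Y E (Suc n) (Suc (Suc n))"
        by (rule ideal_mem_mult[OF slices_ideal ry(1) slices_x[OF e]])
      moreover have "y \<otimes> e \<in> slices x Y E (Suc n) (Suc (Suc n))"
        using slices_Y[OF e _ ry(2)] slices_Suc_sub by blast
      ultimately show "c \<otimes> e \<in> slices x Y E (Suc n) (Suc (Suc n))"
        using ideal_mem_add[OF slices_ideal] by metis
    qed
    finally show ?case .
  qed
qed (rule slices_sub, simp)

lemma sumD_ideal: "graded Q E D \<Longrightarrow> ideal (slices x Y E n a <+> D n) R"
  by (intro add_ideals slices_ideal gradedD(1))

text \<open>An element of \<open>Y\<close> does not raise the degree in \<open>x\<close>, so
  multiplying the defining relation of a leading coefficient by it gives a relation for the same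
  power of \<open>x\<close>, one step higher in the family.\<close>

lemma slice_graded:
  assumes D: "graded Q E D" shows "graded Y E (slice x Y E D a)"
  unfolding graded_def
proof (intro allI conjI ballI)
  fix m
  show "ideal (slice x Y E D a m) R" unfolding slice_def
    by (intro colon_ideal powYE_ideal sumD_ideal[OF D] nat_pow_closed x)
  show "slice x Y E D a m \<subseteq> ipow Y m \<cdot> E" by (auto simp: slice_def)
  fix y e assume y: "y \<in> Y" and e: "e \<in> slice x Y E D a m"
  then have e1: "e \<in> ipow Y m \<cdot> E" by (simp add: slice_def)
  from e obtain s g where sg: "s \<in> slices x Y E (a + m) a" "g \<in> D (a + m)" "x [^] a \<otimes> e = s \<oplus> g"
    by (auto simp: slice_def ideal_sum_mem)
  have c: "y \<in> carrier R" "e \<in> carrier R" "s \<in> carrier R" "g \<in> carrier R"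
    using y e1 sg ideal_mem_carrier Y powYE_ideal slices_ideal gradedD(1)[OF D] by blast+
  have "x [^] a \<otimes> (y \<otimes> e) = y \<otimes> (s \<oplus> g)" using c x by (simp flip: sg(3) add: m_lcomm)
  also have "\<dots> = y \<otimes> s \<oplus> y \<otimes> g" using c by (simp add: r_distr)
  also have "\<dots> \<in> slices x Y E (a + Suc m) a <+> D (a + Suc m)"
    unfolding ideal_sum_mem
    using slices_Y[OF sg(1) _ y] gradedD(3)[OF D _ sg(2), of y] y Y_Q by auto
  finally have 1: "x [^] a \<otimes> (y \<otimes> e) \<in> slices x Y E (a + Suc m) a <+> D (a + Suc m)" .
  have "y \<otimes> e \<in> Y \<cdot> (ipow Y m \<cdot> E)" using y e1 by (rule ideal_prod.prod)
  also have "\<dots> = ipow Y (Suc m) \<cdot> E"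
    by (simp only: ipow_Suc'[OF Y] ideal_prod_assoc[OF Y ipow_ideal[OF Y] E])
  finally show "y \<otimes> e \<in> slice x Y E D a (Suc m)" using 1 by (simp add: slice_def)
qed

text \<open>Multiplication by \<open>x\<close> carries the defining relation from \<open>x^a\<close>
  to \<open>x^(a+1)\<close> with the same leading coefficient. Thus the leading coefficients ascend
  with \<open>a\<close>.\<close>

lemma slice_Suc:
  assumes D: "graded Q E D" shows "slice x Y E D a m \<subseteq> slice x Y E D (Suc a) m"
proof
  fix e assume e: "e \<in> slice x Y E D a m"
  then have e1: "e \<in> ipow Y m \<cdot> E" by (simp add: slice_def)
  from e obtain s g where sg: "s \<in> slices x Y E (a + m) a" "g \<in> D (a + m)" "x [^] a \<otimes> e = s \<oplus> g"
    by (auto simp: slice_def ideal_sum_mem)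
  have c: "e \<in> carrier R" "s \<in> carrier R" "g \<in> carrier R"
    using e1 sg ideal_mem_carrier powYE_ideal slices_ideal gradedD(1)[OF D] by blast+
  have "x [^] Suc a \<otimes> e = x \<otimes> (s \<oplus> g)" using c x by (simp flip: sg(3) add: m_ac)
  also have "\<dots> = x \<otimes> s \<oplus> x \<otimes> g" using c x by (simp add: r_distr)
  also have "\<dots> \<in> slices x Y E (Suc a + m) (Suc a) <+> D (Suc a + m)"
    unfolding ideal_sum_mem
    using slices_x[OF sg(1)] gradedD(3)[OF D x_Q sg(2)] by (auto simp del: slices.simps)
  finally show "e \<in> slice x Y E D (Suc a) m" using e1 unfolding slice_def by blast
qed

lemma slice_mono: "(\<And>n. D n \<subseteq> D' n) \<Longrightarrow> slice x Y E D a m \<subseteq> slice x Y E D' a m"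
  unfolding slice_def using ideal_sum_mono[OF order_refl] by blast

text \<open>As in Hilbert's basis theorem: an element of \<open>D'\<close> is reduced by subtracting
  an element of \<open>D\<close> with the same leading term, which lowers its degree in
  \<open>x\<close>.\<close>

lemma slice_determines:
  assumes D: "graded Q E D" and D': "graded Q E D'" and sub: "\<And>n. D n \<subseteq> D' n"
    and eq: "\<And>a m. slice x Y E D' a m \<subseteq> slice x Y E D a m"
  shows "D = D'"
proof (rule ext, rule antisym[OF sub])
  fix n
  have "D' n \<inter> slices x Y E n a \<subseteq> D n" if "a \<le> Suc n" for a
    using that
  proof (induction a)
    case 0
    show ?case using ideal_mem_zero[OF gradedD(1)[OF D]] by auto
  next
    case (Suc a)
    show ?case
    proof
      fix u assume u: "u \<in> D' n \<inter> slices x Y E n (Suc a)"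
      then obtain s e where s: "s \<in> slices x Y E n a" "e \<in> ipow Y (n - a) \<cdot> E" "u = s \<oplus> x [^] a \<otimes> e"
        by (auto simp: ideal_sum_mem scale_def)
      have n: "a + (n - a) = n" using Suc.prems by simp
      have c: "e \<in> carrier R" "s \<in> carrier R" "u \<in> carrier R" "x [^] a \<otimes> e \<in> carrier R"
        using s u ideal_mem_carrier powYE_ideal slices_ideal gradedD(1)[OF D'] x by blast+
      have ms: "\<zero> \<ominus> s \<in> slices x Y E n a"
        using s by (intro ideal_mem_minus[OF slices_ideal] ideal_mem_zero[OF slices_ideal])
      have "x [^] a \<otimes> e = (\<zero> \<ominus> s) \<oplus> u" unfolding s(3) using c(2,4) by algebra
      then have "e \<in> slice x Y E D' a (n - a)"
        unfolding slice_def n ideal_sum_mem using s ms u by blast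
      then have "e \<in> slice x Y E D a (n - a)" using eq by blast
      then obtain t g where t: "t \<in> slices x Y E n a" "g \<in> D n" "x [^] a \<otimes> e = t \<oplus> g"
        unfolding slice_def n by (auto simp: ideal_sum_mem)
      have tc: "t \<in> carrier R" "g \<in> carrier R"
        using t ideal_mem_carrier slices_ideal gradedD(1)[OF D] by blast+
      have ug: "u \<ominus> g = s \<oplus> t" unfolding s(3) t(3) using c(2) tc by algebra
      have "u \<ominus> g \<in> slices x Y E n a"
        unfolding ug by (rule ideal_mem_add[OF slices_ideal s(1) t(1)])
      moreover have "u \<ominus> g \<in> D' n" using u t(2) sub by (intro ideal_mem_minus[OF gradedD(1)[OF D']]) auto
      ultimately have "u \<ominus> g \<in> D n" using Suc by auto
      then have "(u \<ominus> g) \<oplus> g \<in> D n" using t(2) by (intro ideal_mem_add[OF gradedD(1)[OF D]])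
      moreover have "(u \<ominus> g) \<oplus> g = u" using c(3) tc(2) by algebra
      ultimately show "u \<in> D n" by simp
    qed
  qed
  from this[of "Suc n"] show "D' n \<subseteq> D n"
    using gradedD(2)[OF D', of n] unfolding slices_full by blast
qed

text \<open>Filter \<open>Q^n E / D n\<close> by degree in \<open>x\<close>. Multiplication by
  \<open>x^a\<close> identifies the factor of step \<open>a\<close> with \<open>Y^(n-a) E\<close>
  modulo the leading coefficients, by \<open>len_scale\<close>. This drives the inductions on the
  number of generators.\<close>

lemma len_slices:
  assumes D: "graded Q E D"
  shows "len (D n) (ipow Q n \<cdot> E) = (\<Sum>a\<le>n. len (slice x Y E D a (n - a)) (ipow Y (n - a) \<cdot> E))"
proof -
  note DI = gradedD(1)[OF D]
  have "len (D n) (slices x Y E n a <+> D n)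
    = (\<Sum>b<a. len (slice x Y E D b (n - b)) (ipow Y (n - b) \<cdot> E))" if "a \<le> Suc n" for a
    using that
  proof (induction a)
    case 0
    have "{\<zero>} <+> D n = D n" using DI ideal_mem_zero by (intro ideal_sum_absorb zeroideal) auto
    then show ?case by (simp add: len_self)
  next
    case (Suc a)
    let ?T = "slices x Y E n a <+> D n" and ?c = "scale (x [^] a) (ipow Y (n - a) \<cdot> E)"
    have sc: "ideal ?c R" by (intro scale_ideal nat_pow_closed x powYE_ideal)
    have T: "ideal ?T R" by (rule sumD_ideal[OF D])
    have "slices x Y E n (Suc a) <+> D n = ?T <+> ?c"
    proof
      have "?c \<subseteq> ?T <+> ?c" by (rule ideal_sum_upper2[OF T sc])
      moreover have "?T \<subseteq> ?T <+> ?c" by (rule ideal_sum_upper1[OF T sc])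
      moreover have "slices x Y E n a \<subseteq> ?T" "D n \<subseteq> ?T"
        by (simp_all add: ideal_sum_upper1 ideal_sum_upper2 slices_ideal DI)
      ultimately show "slices x Y E n (Suc a) <+> D n \<subseteq> ?T <+> ?c"
        unfolding slices.simps by (intro ideal_sum_least[OF add_ideals[OF T sc]]) blast+
      have "slices x Y E n (Suc a) \<subseteq> slices x Y E n (Suc a) <+> D n"
          "D n \<subseteq> slices x Y E n (Suc a) <+> D n"
        by (simp_all add: ideal_sum_upper1 ideal_sum_upper2 slices_ideal DI del: slices.simps)
      moreover have "?c \<subseteq> slices x Y E n (Suc a)" by (simp add: ideal_sum_upper2 slices_ideal sc)
      ultimately show "?T <+> ?c \<subseteq> slices x Y E n (Suc a) <+> D n"
        using slices_Suc_sub[of n a] by (intro ideal_sum_least sumD_ideal[OF D]) auto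
    qed
    moreover have "len (D n) (?T <+> ?c) = len (D n) ?T + len ?T (?T <+> ?c)"
      by (intro len_add DI T add_ideals sc ideal_sum_upper1 ideal_sum_upper2 slices_ideal)
    moreover have "len ?T (?T <+> ?c) = len (slice x Y E D a (n - a)) (ipow Y (n - a) \<cdot> E)"
      using Suc.prems unfolding slice_def
      by (subst len_scale[OF nat_pow_closed[OF x] powYE_ideal T]) simp
    ultimately show ?case using Suc by simp
  qed
  from this[of "Suc n"] have "len (D n) (slices x Y E n (Suc n) <+> D n)
    = (\<Sum>b<Suc n. len (slice x Y E D b (n - b)) (ipow Y (n - b) \<cdot> E))" by simp
  moreover have "slices x Y E n (Suc n) <+> D n = ipow Q n \<cdot> E"
  proof -
    have P: "ideal (ipow Q n \<cdot> E) R" by (rule ideal_prod_is_ideal[OF ipow_ideal[OF Q_ideal] E])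
    show ?thesis unfolding slices_full ideal_sum_commute[OF P DI]
      by (rule ideal_sum_absorb[OF P DI gradedD(2)[OF D]])
  qed
  ultimately show ?thesis by (simp only: lessThan_Suc_atMost)
qed

end

lemma Idl_insert:
  assumes "x \<in> carrier R" "S \<subseteq> carrier R"
  shows "Idl (insert x S) = PIdl x <+> Idl S"
proof
  have "ideal (PIdl x <+> Idl S) R" by (intro add_ideals cgenideal_ideal genideal_ideal assms)
  moreover have "insert x S \<subseteq> PIdl x <+> Idl S"
    using ideal_sum_upper1[OF cgenideal_ideal genideal_ideal, of x S]
      ideal_sum_upper2[OF cgenideal_ideal genideal_ideal, of x S]
      cgenideal_self[of x] genideal_self[of S] assms by blast
  ultimately show "Idl (insert x S) \<subseteq> PIdl x <+> Idl S" by (rule genideal_minimal)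
  show "PIdl x <+> Idl S \<subseteq> Idl (insert x S)"
    using genideal_self[of "insert x S"] assms
    by (intro ideal_sum_least genideal_ideal cgenideal_minimal genideal_minimal) auto
qed

lemma Idl_empty: "Idl {} = {\<zero>}"
proof
  show "Idl {} \<subseteq> {\<zero>}" by (rule genideal_minimal[OF zeroideal]) simp
  show "{\<zero>} \<subseteq> Idl {}" using ideal_mem_zero[OF genideal_ideal[of "{}"]] by simp
qed

lemma ipow_zero_ideal:
  assumes "ideal E R" shows "ipow {\<zero>} (Suc n) \<cdot> E = {\<zero>}"
proof -
  have "ipow {\<zero>} (Suc n) = {\<zero>}"
    by (simp only: ipow_Suc ideal_prod_zero[OF ipow_ideal[OF zeroideal]])
  then show ?thesis using ideal_prod_commute[OF zeroideal assms] ideal_prod_zero[OF assms] by simp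
qed

lemma graded_empty_Suc:
  assumes "graded (Idl {}) E D" "ideal E R" shows "D (Suc n) = {\<zero>}"
  using gradedD(1,2)[OF assms(1), of "Suc n"] ideal_mem_zero
  unfolding Idl_empty ipow_zero_ideal[OF assms(2)] by blast

text \<open>The graded quotient is generated in degree 0, so each monomial contributes at most the
  length \<open>len (D 0) E\<close>. In the induction the leading coefficients in degree 0 contain
  \<open>D 0\<close>, so this constant does not grow.\<close>

lemma len_graded_bound:
  assumes "finite S" "S \<subseteq> carrier R" "ideal E R" "graded (Idl S) E D"
  shows "len (D n) (ipow (Idl S) n \<cdot> E) \<le> len (D 0) E * enat (monomials (card S) n)"
  using assms
proof (induction S arbitrary: D n rule: finite_induct)
  case empty
  show ?case
  proof (cases n)
    case 0
    then show ?thesis using empty by (cases "len (D 0) E") (simp_all add: ipow_0 carrier_prod monomials_zero one_enat_def[symmetric])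
  next
    case (Suc m)
    then have "len (D n) (ipow (Idl {}) n \<cdot> E) = 0"
      using graded_empty_Suc[OF empty(3,2)] ipow_zero_ideal[OF empty(2)]
      by (simp only: Idl_empty len_self)
    then show ?thesis by simp
  qed
next
  case (insert x S)
  let ?Y = "Idl S"
  have x: "x \<in> carrier R" and S: "S \<subseteq> carrier R" using insert.prems by auto
  have Y: "ideal ?Y R" by (rule genideal_ideal[OF S])
  note Q = Idl_insert[OF x S]
  note E = insert.prems(2) and D = insert.prems(3)
  have D0: "D 0 \<subseteq> slice x ?Y E D a 0" for a
  proof -
    have "D 0 \<subseteq> slice x ?Y E D 0 0"
    proof
      fix e assume e: "e \<in> D 0"
      then have eE: "e \<in> E" using gradedD(2)[OF D, of 0] by (auto simp only: ipow_0 carrier_prod[OF E])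
      then have "e \<in> carrier R" using E ideal_mem_carrier by blast
      then have "x [^] (0::nat) \<otimes> e \<in> {\<zero>} <+> D 0" using e by (auto simp: ideal_sum_mem intro!: bexI[of _ e])
      then show "e \<in> slice x ?Y E D 0 0" unfolding slice_def using eE
        by (simp add: ipow_0 carrier_prod[OF E])
    qed
    also have "\<dots> \<subseteq> slice x ?Y E D a 0"
      by (rule lift_Suc_mono_le[of "\<lambda>a. slice x ?Y E D a 0", OF slice_Suc[OF x Y E Q D]]) simp
    finally show ?thesis .
  qed
  have "len (slice x ?Y E D a m) (ipow ?Y m \<cdot> E) \<le> len (D 0) E * enat (monomials (card S) m)" for a m
  proof -
    note sg = slice_graded[OF x Y E Q D, of a]
    have "len (slice x ?Y E D a m) (ipow ?Y m \<cdot> E) \<le> len (slice x ?Y E D a 0) E * enat (monomials (card S) m)"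
      by (rule insert.IH[OF S E sg])
    also have "len (slice x ?Y E D a 0) E \<le> len (D 0) E"
      using gradedD(1)[OF D] gradedD(1,2)[OF sg, of 0] E D0
      by (intro len_antimono) (auto simp: ipow_0 carrier_prod[OF E])
    finally show ?thesis by (simp add: mult_right_mono)
  qed
  then have "len (D n) (ipow (Idl (insert x S)) n \<cdot> E)
    \<le> (\<Sum>a\<le>n. len (D 0) E * enat (monomials (card S) (n - a)))"
    unfolding len_slices[OF x Y E Q D] by (rule sum_mono)
  also have "\<dots> = len (D 0) E * enat (monomials (Suc (card S)) n)"
  proof -
    have "(\<Sum>a\<le>n. enat (f a)) = enat (\<Sum>a\<le>n. f a)" for f by (induction n) auto
    then show ?thesis by (simp add: monomials_Suc flip: sum_distrib_left)
  qed
  finally show ?case using insert.hyps by simp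
qed

end

section \<open>Noetherian property and Hilbert functions of graded families\<close>

locale noetherian_cring = cring R + noetherian_ring R for R (structure)
begin

lemma ideal_seq_stable:
  assumes "\<And>k. ideal (D k) R" "\<And>k. D k \<subseteq> D (Suc k)"
  shows "\<exists>K. \<forall>k\<ge>K. D k = D K"
proof -
  have mono: "D i \<subseteq> D j" if "i \<le> j" for i j
    using assms(2) that by (rule lift_Suc_mono_le)
  have "D i \<subseteq> D j \<or> D j \<subseteq> D i" for i j using mono[of i j] mono[of j i] by (cases "i \<le> j") auto
  then have "subset.chain {I. ideal I R} (range D)"
    unfolding subset_chain_def using assms(1) by auto
  then have "\<Union>(range D) \<in> range D" by (intro ideal_chain_is_trivial) auto
  then obtain K where "\<Union>(range D) = D K" by blast
  then have "D k = D K" if "k \<ge> K" for k using mono[OF that] by blast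
  then show ?thesis by blast
qed

text \<open>The Rees algebra of \<open>Idl S\<close> is Noetherian. As in the proof of Hilbert's basis theorem, the
  leading coefficients are indexed by two parameters, of which the diagonal is stabilised first.\<close>

lemma graded_stable:
  assumes "finite S" "S \<subseteq> carrier R" "ideal E R" "\<And>k. graded (Idl S) E (D k)"
    "\<And>k n. D k n \<subseteq> D (Suc k) n"
  shows "\<exists>K. \<forall>k\<ge>K. D k = D K"
  using assms
proof (induction S arbitrary: D rule: finite_induct)
  case empty
  obtain K where K: "\<And>k. k \<ge> K \<Longrightarrow> D k 0 = D K 0"
    using ideal_seq_stable[of "\<lambda>k. D k 0"] gradedD(1)[OF empty(3)] empty(4) by blast
  have "D k = D K" if "k \<ge> K" for k
  proof
    fix n
    show "D k n = D K n"
      using K[OF that] graded_empty_Suc[OF empty(3) empty(2)] by (cases n) auto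
  qed
  then show ?case by blast
next
  case (insert x S)
  let ?Y = "Idl S"
  have x: "x \<in> carrier R" and S: "S \<subseteq> carrier R" using insert.prems by auto
  have Y: "ideal ?Y R" by (rule genideal_ideal[OF S])
  note Q = Idl_insert[OF x S]
  note E = insert.prems(2) and D = insert.prems(3)
  let ?s = "\<lambda>k a. slice x ?Y E (D k) a"
  have mono1: "?s k a m \<subseteq> ?s k' a m" if "k \<le> k'" for k k' a m
    by (rule slice_mono[OF x Y E Q], rule lift_Suc_mono_le[of "\<lambda>k. D k _", OF insert.prems(4) that])
  have mono2: "?s k a m \<subseteq> ?s k a' m" if "a \<le> a'" for k a a' m
    by (rule lift_Suc_mono_le[of "\<lambda>a. ?s k a m", OF slice_Suc[OF x Y E Q D] that])
  have mono: "?s k a m \<subseteq> ?s k' a' m" if "k \<le> k'" "a \<le> a'" for k k' a a' m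
    using mono1[OF that(1)] mono2[OF that(2)] by blast
  have "\<exists>K. \<forall>k\<ge>K. ?s k k = ?s K K"
    using mono by (intro insert.IH[OF S E] slice_graded[OF x Y E Q D]) auto
  then obtain K0 where K0: "\<And>k. k \<ge> K0 \<Longrightarrow> ?s k k = ?s K0 K0" by blast
  have "\<exists>K. \<forall>k\<ge>K. ?s k a = ?s K a" for a
    using mono by (intro insert.IH[OF S E] slice_graded[OF x Y E Q D]) auto
  then obtain Ka where Ka: "\<And>a k. k \<ge> Ka a \<Longrightarrow> ?s k a = ?s (Ka a) a" by metis
  \<comment> \<open>For \<open>a \<ge> K0\<close> the rows are controlled by the stable diagonal;
    the finitely many rows \<open>a < K0\<close> have their own bounds \<open>Ka a\<close>.\<close>
  define K where "K = Max (insert K0 (Ka ` {..<K0}))"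
  have KK0: "K0 \<le> K" unfolding K_def by simp
  have KKa: "Ka a \<le> K" if "a < K0" for a unfolding K_def using that by simp
  have "D K = D k" if k: "k \<ge> K" for k
  proof (rule slice_determines[OF x Y E Q D D])
    show "D K n \<subseteq> D k n" for n by (rule lift_Suc_mono_le[of "\<lambda>k. D k n", OF insert.prems(4) k])
    fix a m
    show "?s k a m \<subseteq> ?s K a m"
    proof (cases "a < K0")
      case True
      then show ?thesis using Ka[of a K] Ka[of a k] KKa[OF True] k by simp
    next
      case False
      have "?s k a m \<subseteq> ?s (max k a) (max k a) m" by (rule mono) auto
      also have "\<dots> = ?s K0 K0 m" using K0[of "max k a"] False by simp
      also have "\<dots> \<subseteq> ?s K a m" using False KK0 by (intro mono) auto
      finally show ?thesis .
    qed
  qed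
  then show ?case by metis
qed

text \<open>By induction on the generators, \<open>len_slices\<close> writes the function as a sum
  of \<open>h a (n - a)\<close>, and from some \<open>K\<close> on \<open>h a\<close> no longer
  depends on \<open>a\<close>. The first \<open>K\<close> summands keep their degree; the others
  form a partial sum of \<open>h K\<close>, which raises the degree by one.\<close>

theorem hilbert_function_numpoly:
  assumes "finite S" "S \<subseteq> carrier R" "ideal E R" "graded (Idl S) E D" "len (D 0) E \<noteq> \<infinity>"
  shows "\<exists>h. (\<forall>n. len (D n) (ipow (Idl S) n \<cdot> E) = enat (h n)) \<and> numpoly (card S) (\<lambda>n. int (h n))"
  using assms
proof (induction S arbitrary: D rule: finite_induct)
  case empty
  have z: "len (D (Suc n)) (ipow (Idl {}) (Suc n) \<cdot> E) = 0" for n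
    using graded_empty_Suc[OF empty(3,2)] ipow_zero_ideal[OF empty(2)] by (simp only: Idl_empty len_self)
  obtain c where c: "len (D 0) (ipow (Idl {}) 0 \<cdot> E) = enat c"
    using empty(4) by (simp only: ipow_0 carrier_prod[OF empty(2)]) blast
  have "len (D n) (ipow (Idl {}) n \<cdot> E) = enat (if n = 0 then c else 0)" for n
    using z c by (cases n) (simp_all only: zero_enat_def if_True if_False nat.distinct refl)
  moreover have "numpoly 0 (\<lambda>n. int (if n = 0 then c else 0))"
    unfolding numpoly.simps using eventually_gt_at_top[of 0] by eventually_elim simp
  ultimately show ?case by (intro exI[of _ "\<lambda>n. if n = 0 then c else 0"]) simp
next
  case (insert x S)
  let ?Y = "Idl S"
  have x: "x \<in> carrier R" and S: "S \<subseteq> carrier R" using insert.prems by auto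
  have Y: "ideal ?Y R" by (rule genideal_ideal[OF S])
  note Q = Idl_insert[OF x S]
  note E = insert.prems(2) and D = insert.prems(3)
  let ?s = "\<lambda>a. slice x ?Y E D a"
  note sg = slice_graded[OF x Y E Q D]
  \<comment> \<open>The induction hypothesis asks for finite length in degree 0. Here it is one
    summand of the length in degree \<open>a\<close>, which \<open>len_graded_bound\<close> shows to
    be finite.\<close>
  have fin: "len (?s a 0) E \<noteq> \<infinity>" for a
  proof -
    have "len (?s a 0) E \<le> len (D a) (ipow (Idl (insert x S)) a \<cdot> E)"
      unfolding len_slices[OF x Y E Q D]
      using member_le_sum[of a "{..a}" "\<lambda>b. len (?s b (a - b)) (ipow ?Y (a - b) \<cdot> E)"]
      by (simp add: ipow_0 carrier_prod[OF E])
    also have "\<dots> \<le> len (D 0) E * enat (monomials (card (insert x S)) a)"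
      using insert.hyps by (intro len_graded_bound insert.prems) auto
    also have "\<dots> < \<infinity>" using insert.prems(4) by (cases "len (D 0) E") auto
    finally show ?thesis by simp
  qed
  have "\<exists>h. (\<forall>n. len (?s a n) (ipow ?Y n \<cdot> E) = enat (h n)) \<and> numpoly (card S) (\<lambda>n. int (h n))" for a
    by (rule insert.IH[OF S E sg fin])
  then obtain h where h: "\<And>a n. len (?s a n) (ipow ?Y n \<cdot> E) = enat (h a n)"
    and np: "\<And>a. numpoly (card S) (\<lambda>n. int (h a n))" by metis
  obtain K where K: "\<And>a. a \<ge> K \<Longrightarrow> ?s a = ?s K"
  proof -
    have "\<exists>K. \<forall>k\<ge>K. ?s k = ?s K"
      by (rule graded_stable[OF insert.hyps(1) S E]) (use sg slice_Suc[OF x Y E Q D] in auto)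
    then show thesis using that by blast
  qed
  have hK: "h a n = h K n" if "a \<ge> K" for a n
    using h[of a n] h[of K n] K[OF that] by simp
  let ?H = "\<lambda>n. \<Sum>a\<le>n. h a (n - a)"
  have "len (D n) (ipow (Idl (insert x S)) n \<cdot> E) = enat (?H n)" for n
  proof -
    have "(\<Sum>a\<le>k. enat (f a)) = enat (\<Sum>a\<le>k. f a)" for f and k :: nat by (induction k) auto
    then show ?thesis unfolding len_slices[OF x Y E Q D] h by simp
  qed
  moreover have "numpoly (Suc (card S)) (\<lambda>n. int (?H n))"
  proof (rule numpoly_cong)
    show "numpoly (Suc (card S)) (\<lambda>n. (\<Sum>a<K. int (h a (n - a))) + (\<Sum>m\<le>n - K. int (h K m)))"
    proof (rule numpoly_add)
      show "numpoly (Suc (card S)) (\<lambda>n. \<Sum>a<K. int (h a (n - a)))"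
        by (intro numpoly_SucI numpoly_sum numpoly_shift[of _ "\<lambda>n. int (h _ n)"] np) simp
      have "numpoly (Suc (card S)) (\<lambda>n. \<Sum>m\<le>n. int (h K m))"
        using numpoly_Suc_arg[OF np[of K]] by simp
      then show "numpoly (Suc (card S)) (\<lambda>n. \<Sum>m\<le>n - K. int (h K m))" by (rule numpoly_shift)
    qed
    show "\<forall>\<^sub>F n in sequentially. int (?H n) = (\<Sum>a<K. int (h a (n - a))) + (\<Sum>m\<le>n - K. int (h K m))"
      using eventually_ge_at_top[of K]
    proof eventually_elim
      case (elim n)
      have split: "{..n} = {..<K} \<union> {K..n}" using elim by auto
      have "?H n = (\<Sum>a<K. h a (n - a)) + (\<Sum>a=K..n. h a (n - a))"
        unfolding split by (rule sum.union_disjoint) auto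
      moreover have "(\<Sum>a=K..n. h a (n - a)) = (\<Sum>a=K..n. h K (n - a))"
        by (intro sum.cong refl hK) simp
      moreover have "(\<Sum>a=K..n. h K (n - a)) = (\<Sum>m\<le>n - K. h K m)"
        by (rule sum.reindex_bij_witness[of _ "\<lambda>m. n - m" "\<lambda>a. n - a"]) (use elim in auto)
      ultimately show ?case by simp
    qed
  qed
  ultimately show ?case using insert.hyps by (intro exI[of _ ?H]) simp
qed

end

section \<open>Noetherian local rings\<close>

context cring
begin

lemma len_sum_le:
  assumes "ideal A R" "ideal B R" "ideal S R" "B \<subseteq> A" "B \<subseteq> S"
  shows "len S (S <+> A) \<le> len B A"
  unfolding len_diamond[OF assms(1,3)] by (rule len_antimono) (use assms in \<open>auto intro: i_intersect\<close>)

lemma PIdl_prod: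
  assumes "z \<in> carrier R" "ideal E R" shows "(PIdl z) \<cdot> E = scale z E"
proof
  show "(PIdl z) \<cdot> E \<subseteq> scale z E"
  proof (rule prod_least[OF scale_ideal[OF assms]])
    fix a e assume "a \<in> PIdl z" "e \<in> E"
    then obtain r where r: "r \<in> carrier R" "a = r \<otimes> z" "e \<in> E" by (auto simp: cgenideal_def)
    then have "a \<otimes> e = z \<otimes> (r \<otimes> e)" using assms by (simp add: ideal_mem_carrier m_ac)
    then show "a \<otimes> e \<in> scale z E" using r ideal_mem_mult[OF assms(2)] unfolding scale_def by blast
  qed
  show "scale z E \<subseteq> (PIdl z) \<cdot> E"
    using cgenideal_self[OF assms(1)] by (auto simp: scale_def intro: ideal_prod.prod)
qed

text \<open>With \<open>K\<close> generated by the other elements, multiplication by a generator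
  \<open>z\<close> maps \<open>E/D\<close> onto the factor between \<open>zD + KE\<close> and
  \<open>zE + KE\<close>, so each generator contributes at most \<open>len D E\<close>.\<close>

lemma len_prod_le:
  assumes "finite S" "S \<subseteq> carrier R" "ideal D R" "ideal E R" "D \<subseteq> E"
  shows "len ((Idl S) \<cdot> D) ((Idl S) \<cdot> E) \<le> enat (card S) * len D E"
  using assms
proof (induction S rule: finite_induct)
  case empty
  have "{\<zero>} \<cdot> B = {\<zero>}" if "ideal B R" for B
    using ideal_prod_commute[OF zeroideal that] ideal_prod_zero[OF that] by simp
  then show ?case using empty by (simp add: Idl_empty len_self)
next
  case (insert z S)
  then have z: "z \<in> carrier R" and S: "S \<subseteq> carrier R" by auto
  let ?K = "Idl S"
  have K: "ideal ?K R" by (rule genideal_ideal[OF S])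
  have decomp: "(Idl (insert z S)) \<cdot> B = scale z B <+> ?K \<cdot> B" if "ideal B R" for B
    unfolding Idl_insert[OF z S] PIdl_prod[OF z that, symmetric]
    by (rule ideal_prod_distr(2)[OF that cgenideal_ideal[OF z] K])
  note D = insert.prems(2) and E = insert.prems(3) and DE = insert.prems(4)
  have KD: "ideal (?K \<cdot> D) R" and KE: "ideal (?K \<cdot> E) R" and zD: "ideal (scale z D) R"
    and zE: "ideal (scale z E) R"
    using K D E z by (auto intro: ideal_prod_is_ideal scale_ideal)
  let ?T = "scale z D <+> ?K \<cdot> E"
  let ?L = "scale z D <+> ?K \<cdot> D" and ?M = "scale z E <+> ?K \<cdot> E"
  have T: "ideal ?T R" and L: "ideal ?L R" and M: "ideal ?M R"
    by (auto intro: add_ideals KD KE zD zE)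
  have KDE: "?K \<cdot> D \<subseteq> ?K \<cdot> E" using DE by (intro prod_mono) auto
  have LT: "?L \<subseteq> ?T" by (intro ideal_sum_mono KDE order_refl)
  have TM: "?T \<subseteq> ?M" by (intro ideal_sum_mono order_refl scale_mono DE)
  have "?T = ?L <+> ?K \<cdot> E"
  proof
    have "scale z D \<subseteq> ?L" "?L \<subseteq> ?L <+> ?K \<cdot> E" "?K \<cdot> E \<subseteq> ?L <+> ?K \<cdot> E"
      by (rule ideal_sum_upper1 ideal_sum_upper2; intro zD KD L KE)+
    then show "?T \<subseteq> ?L <+> ?K \<cdot> E" by (intro ideal_sum_least add_ideals L KE) auto
    show "?L <+> ?K \<cdot> E \<subseteq> ?T" by (rule ideal_sum_least[OF T LT ideal_sum_upper2[OF zD KE]])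
  qed
  then have "len ?L ?T = len ?L (?L <+> ?K \<cdot> E)" by simp
  also have "\<dots> \<le> len (?K \<cdot> D) (?K \<cdot> E)"
    by (rule len_sum_le[OF KE KD L KDE ideal_sum_upper2[OF zD KD]])
  also have "\<dots> \<le> enat (card S) * len D E" by (rule insert.IH[OF S D E DE])
  finally have 1: "len ?L ?T \<le> enat (card S) * len D E" .
  have "?M = ?T <+> scale z E"
  proof
    show "?M \<subseteq> ?T <+> scale z E"
      using ideal_sum_upper1[OF T zE] ideal_sum_upper2[OF T zE] ideal_sum_upper2[OF zD KE]
      by (intro ideal_sum_least add_ideals T zE) auto
    show "?T <+> scale z E \<subseteq> ?M" by (rule ideal_sum_least[OF M TM ideal_sum_upper1[OF zE KE]])
  qed
  then have "len ?T ?M = len {e \<in> E. z \<otimes> e \<in> ?T} E" using len_scale[OF z E T] by simp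
  also have "\<dots> \<le> len D E"
  proof (rule len_antimono)
    have "D \<subseteq> {e \<in> E. z \<otimes> e \<in> scale z D}" using DE by (auto simp: scale_def)
    then show "D \<subseteq> {e \<in> E. z \<otimes> e \<in> ?T}" using ideal_sum_upper1[OF zD KE] by blast
  qed (auto intro: D E colon_ideal z T)
  finally have 2: "len ?T ?M \<le> len D E" .
  have "len ?L ?M = len ?L ?T + len ?T ?M" by (rule len_add[OF L T M LT TM])
  also have "\<dots> \<le> enat (card S) * len D E + len D E" using 1 2 by (rule add_mono)
  also have "\<dots> = enat (card (insert z S)) * len D E"
    using insert.hyps by (cases "len D E") (auto simp: algebra_simps zero_enat_def)
  finally show ?case unfolding decomp[OF D] decomp[OF E] .
qed

text \<open>A product of \<open>p + q\<close> factors either contains \<open>x\<close> at least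
  \<open>p\<close> times or leaves a factor in \<open>Y^q\<close>. The decomposition is
  \<open>slices_full\<close> with \<open>E = R\<close>.\<close>

lemma ipow_subset_of_gens:
  assumes "finite S" "S \<subseteq> carrier R" "ideal A R" "\<And>s. s \<in> S \<Longrightarrow> \<exists>n::nat. s [^] n \<in> A"
  shows "\<exists>k. ipow (Idl S) k \<subseteq> A"
  using assms
proof (induction S rule: finite_induct)
  case empty
  have "ipow (Idl {}) (Suc 0) = {\<zero>}" unfolding Idl_empty by (rule ipow_1[OF zeroideal])
  then show ?case using ideal_mem_zero[OF empty(2)] by (intro exI[of _ "Suc 0"]) simp
next
  case (insert x S)
  then have x: "x \<in> carrier R" and S: "S \<subseteq> carrier R" by auto
  note A = insert.prems(2)
  let ?Y = "Idl S" and ?Q = "Idl (insert x S)"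
  have Y: "ideal ?Y R" by (rule genideal_ideal[OF S])
  have Q: "ideal ?Q R" by (rule genideal_ideal[OF insert.prems(1)])
  obtain q where q: "ipow ?Y q \<subseteq> A" using insert by auto
  obtain p :: nat where p: "x [^] p \<in> A" using insert.prems(3) by blast
  have "slices x ?Y (carrier R) (p + q) a \<subseteq> A" if "a \<le> Suc (p + q)" for a
    using that
  proof (induction a)
    case 0
    then show ?case using ideal_mem_zero[OF A] by simp
  next
    case (Suc a)
    have "x [^] a \<otimes> e \<in> A" if e: "e \<in> ipow ?Y (p + q - a) \<cdot> carrier R" for e
    proof -
      have eY: "e \<in> ipow ?Y (p + q - a)" using e ideal_prod_one[OF ipow_ideal[OF Y]] by simp
      then have ec: "e \<in> carrier R" using ipow_ideal[OF Y] ideal_mem_carrier by blast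
      show ?thesis
      proof (cases "p \<le> a")
        case True
        have "x [^] a = x [^] (a - p) \<otimes> x [^] p" using x True by (simp add: nat_pow_mult)
        then have "x [^] a \<in> A" using ideal_mem_mult[OF A _ p] x by simp
        then show ?thesis using ideal.I_r_closed[OF A] ec by blast
      next
        case False
        then have "ipow ?Y (p + q - a) \<subseteq> ipow ?Y q" by (intro ipow_antimono Y) simp
        then show ?thesis using eY q x by (intro ideal_mem_mult[OF A]) auto
      qed
    qed
    then have "scale (x [^] a) (ipow ?Y (p + q - a) \<cdot> carrier R) \<subseteq> A" unfolding scale_def by blast
    moreover have "slices x ?Y (carrier R) (p + q) a \<subseteq> A" using Suc by simp
    ultimately show ?case unfolding slices.simps by (intro ideal_sum_least[OF A])
  qed
  from this[of "Suc (p + q)"] have "ipow ?Q (p + q) \<cdot> carrier R \<subseteq> A"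
    using slices_full[OF x Y oneideal Idl_insert[OF x S]] by simp
  then show ?case using ideal_prod_one[OF ipow_ideal[OF Q]] by auto
qed

end

section \<open>Maximal ideals and Artin-Rees\<close>

context noetherian_cring
begin

lemma proper_in_maximal:
  assumes A: "ideal A R" "A \<noteq> carrier R"
  shows "\<exists>M. maximalideal M R \<and> A \<subseteq> M"
proof -
  let ?S = "{K. ideal K R \<and> A \<subseteq> K \<and> \<one> \<notin> K}"
  have AS: "A \<in> ?S" using A ideal.one_imp_carrier by blast
  have "\<exists>M\<in>?S. \<forall>K\<in>?S. M \<subseteq> K \<longrightarrow> K = M"
  proof (rule subset_Zorn)
    fix C assume C: "subset.chain ?S C"
    show "\<exists>U\<in>?S. \<forall>K\<in>C. K \<subseteq> U"
    proof (cases "C = {}")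
      case False
      have "subset.chain {K. ideal K R} C" using C unfolding subset_chain_def by auto
      then have "\<Union>C \<in> C" by (rule ideal_chain_is_trivial[OF False])
      moreover have "C \<subseteq> ?S" using C unfolding subset_chain_def by (rule conjunct1)
      ultimately have "\<Union>C \<in> ?S" by (rule subsetD[rotated])
      then show ?thesis by (rule bexI[rotated]) (auto simp: Union_upper)
    qed (use AS in auto)
  qed
  then obtain M where M: "M \<in> ?S" and max: "\<forall>K\<in>?S. M \<subseteq> K \<longrightarrow> K = M" by (rule bexE)
  have "maximalideal M R"
  proof (rule maximalidealI)
    fix K assume "ideal K R" "M \<subseteq> K" "K \<subseteq> carrier R"
    then show "K = M \<or> K = carrier R"
      using M max[rule_format, of K] ideal.one_imp_carrier[of K R] by (cases "\<one> \<in> K") auto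
  qed (use M in auto)
  then show ?thesis using M by auto
qed

text \<open>Rees algebra argument: \<open>?D k\<close> is the submodule of the sum of all
  \<open>A \<inter> Q^n\<close> generated by the components of degree at most \<open>k\<close>. It
  ascends with \<open>k\<close> and becomes stationary by \<open>graded_stable\<close>.\<close>

lemma artin_rees:
  assumes A: "ideal A R" and Q: "ideal Q R"
  shows "\<exists>K. \<forall>n\<ge>K. A \<inter> ipow Q n \<subseteq> ipow Q (n - K) \<cdot> A"
proof -
  obtain S where S: "S \<subseteq> carrier R" "finite S" "Q = Idl S" using finetely_gen[OF Q] by blast
  let ?B = "\<lambda>n. A \<inter> ipow Q n"
  \<comment> \<open>\<open>n - k\<close> truncates to 0 for \<open>n \<le> k\<close>, so this is
    \<open>?B n\<close> up to degree \<open>k\<close> and \<open>Q^(n-k) ?B k\<close>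
    beyond.\<close>
  let ?D = "\<lambda>k n. ipow Q (n - k) \<cdot> ?B (min n k)"
  have B: "ideal (?B n) R" for n by (intro i_intersect A ipow_ideal Q)
  have QB: "c \<otimes> e \<in> ?B (Suc n)" if "c \<in> Q" "e \<in> ?B n" for c e n
    using that A Q ideal_mem_carrier unfolding ipow_Suc'[OF Q]
    by (auto intro: ideal_mem_mult ideal_prod.prod)
  have "\<exists>K. \<forall>k\<ge>K. ?D k = ?D K"
  proof (rule graded_stable[OF S(2,1) oneideal])
    fix k
    show "graded (Idl S) (carrier R) (?D k)" unfolding graded_def S(3)[symmetric]
    proof (intro allI conjI ballI)
      fix n
      show "ideal (?D k n) R" by (intro ideal_prod_is_ideal ipow_ideal Q B)
      have "?D k n \<subseteq> ipow Q (n - k) \<cdot> ipow Q (min n k)" by (intro prod_mono) auto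
      also have "\<dots> = ipow Q n" by (simp add: min_def flip: ipow_add[OF Q])
      also have "\<dots> = ipow Q n \<cdot> carrier R" by (rule ideal_prod_one[OF ipow_ideal[OF Q], symmetric])
      finally show "?D k n \<subseteq> ipow Q n \<cdot> carrier R" .
      fix c e assume c: "c \<in> Q" and e: "e \<in> ?D k n"
      show "c \<otimes> e \<in> ?D k (Suc n)"
      proof (cases "n < k")
        case True
        then have "e \<in> ?B n" using e by (simp add: ipow_0 carrier_prod B)
        from QB[OF c this] show ?thesis using True by (simp add: ipow_0 carrier_prod B)
      next
        case False
        have "c \<otimes> e \<in> Q \<cdot> ?D k n" using c e by (rule ideal_prod.prod)
        also have "\<dots> = ipow Q (Suc (n - k)) \<cdot> ?B (min n k)"
          by (simp only: ipow_Suc'[OF Q] ideal_prod_assoc[OF Q ipow_ideal[OF Q] B])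
        finally show ?thesis using False by (simp add: Suc_diff_le)
      qed
    qed
    fix n
    show "?D k n \<subseteq> ?D (Suc k) n"
    proof (cases "n \<le> k")
      case False
      then have n: "n - k = Suc (n - Suc k)" "min n k = k" "min n (Suc k) = Suc k" by auto
      have "?D k n = ipow Q (n - Suc k) \<cdot> (Q \<cdot> ?B k)"
        unfolding n by (simp only: ipow_Suc ideal_prod_assoc[OF ipow_ideal[OF Q] Q B])
      also have "\<dots> \<subseteq> ?D (Suc k) n"
        unfolding n using QB by (intro prod_mono order_refl prod_least B)
      finally show ?thesis .
    qed simp
  qed
  then obtain K where K: "\<And>k. k \<ge> K \<Longrightarrow> ?D k = ?D K" by blast
  have "?B n \<subseteq> ipow Q (n - K) \<cdot> A" if "n \<ge> K" for n
  proof -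
    have "?B n = ?D n n" by (simp add: ipow_0 carrier_prod B)
    also have "\<dots> = ?D K n" using K[OF that] by metis
    also have "\<dots> \<subseteq> ipow Q (n - K) \<cdot> A" by (intro prod_mono) auto
    finally show ?thesis .
  qed
  then show ?thesis by blast
qed

text \<open>Modulo \<open>P\<close> the element \<open>x\<close> is a nonzerodivisor. Artin-Rees
  writes an element of \<open>xR + P\<close> lying in \<open>Q^n\<close> as \<open>x w + p'\<close>
  with \<open>w \<in> Q^(n-K)\<close> and \<open>p' \<in> P\<close>, and primality cancels
  \<open>x\<close>.\<close>

lemma prime_colon:
  assumes P: "primeideal P R" and x: "x \<in> carrier R" "x \<notin> P" and Q: "ideal Q R"
  shows "\<exists>K. \<forall>n\<ge>K. {y \<in> carrier R. x \<otimes> y \<in> P <+> ipow Q n} \<subseteq> P <+> ipow Q (n - K)"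
proof -
  interpret P: primeideal P R by fact
  have PI: "ideal P R" by (rule P.is_ideal)
  let ?A = "scale x (carrier R) <+> P"
  have A: "ideal ?A R" by (intro add_ideals scale_ideal x oneideal PI)
  obtain K where K: "\<And>n. n \<ge> K \<Longrightarrow> ?A \<inter> ipow Q n \<subseteq> ipow Q (n - K) \<cdot> ?A"
    using artin_rees[OF A Q] by blast
  have "y \<in> P <+> ipow Q (n - K)" if n: "n \<ge> K" and y: "y \<in> carrier R" "x \<otimes> y \<in> P <+> ipow Q n" for n y
  proof -
    let ?q = "ipow Q (n - K)"
    have q: "ideal ?q R" by (rule ipow_ideal[OF Q])
    from y(2) obtain p z where pz: "p \<in> P" "z \<in> ipow Q n" "x \<otimes> y = p \<oplus> z"
      by (auto simp: ideal_sum_mem)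
    have c: "p \<in> carrier R" "z \<in> carrier R"
      using pz PI ipow_ideal[OF Q] ideal_mem_carrier by blast+
    have "z = x \<otimes> y \<oplus> (\<zero> \<ominus> p)" unfolding pz(3) using c by algebra
    moreover have "\<zero> \<ominus> p \<in> P" using pz ideal_mem_zero[OF PI] by (intro ideal_mem_minus[OF PI])
    moreover have "x \<otimes> y \<in> scale x (carrier R)" using y by (auto simp: scale_def)
    ultimately have "z \<in> ?A" unfolding ideal_sum_mem by blast
    then have "z \<in> ?q \<cdot> ?A" using K[OF n] pz by blast
    also have "?q \<cdot> ?A \<subseteq> scale x ?q <+> P"
    proof (rule prod_least)
      show "ideal (scale x ?q <+> P) R" by (intro add_ideals scale_ideal x q PI)
      fix a b assume a: "a \<in> ?q" and b: "b \<in> ?A"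
      from b obtain r p' where r: "r \<in> carrier R" "p' \<in> P" "b = x \<otimes> r \<oplus> p'"
        by (auto simp: ideal_sum_mem scale_def)
      have ac: "a \<in> carrier R" "p' \<in> carrier R" using a r PI q ideal_mem_carrier by blast+
      have "a \<otimes> b = x \<otimes> (r \<otimes> a) \<oplus> a \<otimes> p'" unfolding r(3) using ac r x by algebra
      moreover have "r \<otimes> a \<in> ?q" by (rule ideal_mem_mult[OF q r(1) a])
      moreover have "a \<otimes> p' \<in> P" by (rule ideal_mem_mult[OF PI ac(1) r(2)])
      ultimately show "a \<otimes> b \<in> scale x ?q <+> P" unfolding ideal_sum_mem scale_def by blast
    qed
    finally obtain w p' where w: "w \<in> ?q" "p' \<in> P" "z = x \<otimes> w \<oplus> p'"
      by (auto simp: ideal_sum_mem scale_def)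
    have wc: "w \<in> carrier R" "p' \<in> carrier R" using w PI q ideal_mem_carrier by blast+
    have "x \<otimes> (y \<ominus> w) = x \<otimes> y \<ominus> x \<otimes> w" using x y wc by algebra
    also have "\<dots> = p \<oplus> p'" unfolding pz(3) w(3) using c wc x by algebra
    finally have "x \<otimes> (y \<ominus> w) \<in> P" using pz w by (simp add: ideal_mem_add[OF PI])
    then have "y \<ominus> w \<in> P" using P.I_prime[of x "y \<ominus> w"] x y wc by auto
    moreover have "y = (y \<ominus> w) \<oplus> w" using y wc by algebra
    ultimately show ?thesis unfolding ideal_sum_mem using w by blast
  qed
  then show ?thesis by blast
qed

text \<open>\<open>\<lambda>(R/A)\<close>; unspecified if the length is infinite.\<close>

definition clen :: "'a set \<Rightarrow> nat" where
  "clen A = the_enat (len A (carrier R))"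

lemma finite_clen: "len A (carrier R) \<noteq> \<infinity> \<Longrightarrow> len A (carrier R) = enat (clen A)"
  unfolding clen_def by auto

end

section \<open>Ideals of finite colength in a Noetherian local ring\<close>

locale noetherian_local = noetherian_cring +
  fixes \<mm>
  assumes maximal_iff: "maximalideal M R \<longleftrightarrow> M = \<mm>"
begin

lemma m_maximal: "maximalideal \<mm> R"
  using maximal_iff by blast

lemma m_ideal: "ideal \<mm> R"
  using m_maximal by (rule maximalideal.axioms(1))

lemma m_proper: "\<mm> \<noteq> carrier R"
  using m_maximal maximalideal.I_notcarr by blast

lemma proper_sub_m: "ideal A R \<Longrightarrow> A \<noteq> carrier R \<Longrightarrow> A \<subseteq> \<mm>"
  using proper_in_maximal maximal_iff by blast

lemma len_m: "len \<mm> (carrier R) = 1"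
  using m_ideal m_proper ideal_sub_carrier[OF m_ideal] maximalideal.I_maximal[OF m_maximal]
  by (intro len_maximal oneideal) auto

text \<open>With \<open>E = R\<close> and \<open>D = \<mm>\<close>, \<open>len_prod_le\<close>
  bounds the length of \<open>\<mm>^k/\<mm>^(k+1)\<close> by the number of generators of
  \<open>\<mm>^k\<close>.\<close>

lemma len_mpow_finite: "len (ipow \<mm> k) (carrier R) \<noteq> \<infinity>"
proof (induction k)
  case 0
  then show ?case by (simp add: ipow_0 len_self)
next
  case (Suc k)
  let ?M = "ipow \<mm> k"
  have M: "ideal ?M R" by (rule ipow_ideal[OF m_ideal])
  have M1: "ideal (ipow \<mm> (Suc k)) R" by (rule ipow_ideal[OF m_ideal])
  obtain S where S: "S \<subseteq> carrier R" "finite S" "?M = Idl S" using finetely_gen[OF M] by blast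
  have "len (?M \<cdot> \<mm>) (?M \<cdot> carrier R) \<le> enat (card S) * 1"
    using len_prod_le[OF S(2,1) m_ideal oneideal ideal_sub_carrier[OF m_ideal]]
    unfolding S(3)[symmetric] len_m .
  then have "len (ipow \<mm> (Suc k)) ?M \<noteq> \<infinity>"
    unfolding ipow_Suc ideal_prod_one[OF M] by (auto dest: enat_ile)
  moreover have "len (ipow \<mm> (Suc k)) (carrier R) = len (ipow \<mm> (Suc k)) ?M + len ?M (carrier R)"
    by (rule len_add[OF M1 M oneideal ipow_antimono[OF m_ideal] ideal_sub_carrier[OF M]]) simp
  ultimately show ?case using Suc by auto
qed

text \<open>For proper ideals this is being \<open>\<mm>\<close>-primary
  (\<open>m_primary_cofinite\<close>, \<open>m_primaryI\<close>). It also admits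
  \<open>R = I^0\<close> and is closed under products and larger ideals.\<close>

definition cofinite :: "'a set \<Rightarrow> bool" where
  "cofinite A \<longleftrightarrow> ideal A R \<and> (\<exists>k. ipow \<mm> k \<subseteq> A)"

lemma cofinite_ideal: "cofinite A \<Longrightarrow> ideal A R"
  by (simp add: cofinite_def)

lemma cofinite_carrier: "cofinite (carrier R)"
  unfolding cofinite_def using oneideal ideal_sub_carrier[OF ipow_ideal[OF m_ideal]] by blast

lemma cofinite_m: "cofinite \<mm>"
  unfolding cofinite_def using m_ideal ipow_1[OF m_ideal] by blast

lemma cofinite_mono: "cofinite A \<Longrightarrow> ideal B R \<Longrightarrow> A \<subseteq> B \<Longrightarrow> cofinite B"
  unfolding cofinite_def by blast

lemma cofinite_prod:
  assumes "cofinite A" "cofinite B" shows "cofinite (A \<cdot> B)"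
proof -
  obtain i j where "ipow \<mm> i \<subseteq> A" "ipow \<mm> j \<subseteq> B" using assms unfolding cofinite_def by blast
  then have "ipow \<mm> (i + j) \<subseteq> A \<cdot> B" unfolding ipow_add[OF m_ideal] by (rule prod_mono)
  then show ?thesis using assms ideal_prod_is_ideal unfolding cofinite_def by blast
qed

lemma cofinite_ipow: "cofinite A \<Longrightarrow> cofinite (ipow A n)"
  by (induction n) (auto simp: ipow_0 ipow_Suc cofinite_carrier intro: cofinite_prod)

lemma cofinite_add: "cofinite A \<Longrightarrow> ideal B R \<Longrightarrow> cofinite (A <+> B)"
  by (meson cofinite_mono cofinite_ideal add_ideals ideal_sum_upper1)

lemma cofinite_len: "cofinite A \<Longrightarrow> len A (carrier R) = enat (clen A)"
proof (rule finite_clen)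
  assume A: "cofinite A"
  then obtain k where k: "ipow \<mm> k \<subseteq> A" unfolding cofinite_def by blast
  have "len A (carrier R) \<le> len (ipow \<mm> k) (carrier R)"
    using cofinite_ideal[OF A] k by (intro len_antimono ipow_ideal m_ideal oneideal ideal_sub_carrier)
  then show "len A (carrier R) \<noteq> \<infinity>" using len_mpow_finite[of k] by (auto dest: enat_ile)
qed

lemma cofinite_len_diff:
  assumes "cofinite A" "ideal B R" "A \<subseteq> B"
  shows "len A B = enat (clen A - clen B)" "clen B \<le> clen A"
proof -
  have B: "cofinite B" using assms cofinite_mono by blast
  have "len A (carrier R) = len A B + len B (carrier R)"
    using assms cofinite_ideal[OF assms(1)] ideal_sub_carrier[OF assms(2)] by (intro len_add oneideal)
  then have "len A B + enat (clen B) = enat (clen A)"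
    using cofinite_len[OF assms(1)] cofinite_len[OF B] by simp
  then show "len A B = enat (clen A - clen B)" "clen B \<le> clen A" by (cases "len A B"; simp)+
qed

lemma clen_eq_imp_eq:
  assumes "cofinite A" "ideal B R" "A \<subseteq> B" "clen A \<le> clen B" shows "A = B"
proof (rule ccontr)
  assume "A \<noteq> B"
  then have "1 \<le> len A B" using assms cofinite_ideal by (intro len_ge_1) auto
  then show False using cofinite_len_diff[OF assms(1-3)] assms(4) by (simp add: one_enat_def)
qed

text \<open>The inequality \<open>dim R \<le> deg \<lambda>(R/Q\<^sup>n)\<close>.\<close>

lemma dimension_growth:
  assumes "\<And>i. i \<le> k \<Longrightarrow> primeideal (P i) R" "\<And>i. i < k \<Longrightarrow> P i \<subset> P (Suc i)"
    and Q: "cofinite Q" "Q \<subseteq> \<mm>"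
  shows "\<exists>c>0. \<exists>N. \<forall>n\<ge>N. c * real n ^ k \<le> real (clen (P 0 <+> ipow Q n))"
  using assms(1,2)
proof (induction k arbitrary: P)
  case 0
  have "primeideal (P 0) R" using 0(1) by simp
  then have P: "ideal (P 0) R" "P 0 \<noteq> carrier R"
    by (auto dest: primeideal.I_notcarr intro: primeideal.axioms(1))
  have "1 \<le> clen (P 0 <+> ipow Q n)" if "n \<ge> 1" for n
  proof -
    let ?A = "P 0 <+> ipow Q n"
    have cof: "cofinite ?A"
      using cofinite_mono[OF cofinite_ipow[OF Q(1)]] P(1) ipow_ideal[OF cofinite_ideal[OF Q(1)]]
      by (meson add_ideals ideal_sum_upper2)
    have "ipow Q n \<subseteq> Q" using ipow_antimono[OF cofinite_ideal[OF Q(1)] that] ipow_1[OF cofinite_ideal[OF Q(1)]] by simp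
    then have "?A \<subseteq> \<mm>" using Q(2) proper_sub_m[OF P] by (intro ideal_sum_least m_ideal) auto
    then have "?A \<subset> carrier R" using m_proper ideal_sub_carrier[OF m_ideal] by blast
    then have "1 \<le> len ?A (carrier R)" by (intro len_ge_1 cofinite_ideal[OF cof] oneideal)
    then show ?thesis unfolding cofinite_len[OF cof] by (simp add: one_enat_def)
  qed
  then show ?case by (intro exI[of _ 1] conjI exI[of _ 1]) auto
next
  case (Suc k)
  note QI = cofinite_ideal[OF Q(1)]
  have P: "primeideal (P i) R" if "i \<le> Suc k" for i using Suc.prems(1) that .
  have PI: "ideal (P 0) R" "ideal (P 1) R" using P[of 0] P[of 1] primeideal.axioms(1) by auto
  have "\<exists>c>0. \<exists>N. \<forall>n\<ge>N. c * real n ^ k \<le> real (clen (P (Suc 0) <+> ipow Q n))"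
    by (rule Suc.IH) (use Suc.prems in auto)
  then obtain c N where c: "c > 0" "\<And>n. n \<ge> N \<Longrightarrow> c * real n ^ k \<le> real (clen (P 1 <+> ipow Q n))"
    by auto
  obtain x where x: "x \<in> P 1" "x \<notin> P 0" using Suc.prems(2)[of 0] by auto
  have xc: "x \<in> carrier R" using x PI ideal_mem_carrier by blast
  obtain K where K: "\<And>n. n \<ge> K \<Longrightarrow>
      {y \<in> carrier R. x \<otimes> y \<in> P 0 <+> ipow Q n} \<subseteq> P 0 <+> ipow Q (n - K)"
    using prime_colon[OF P[of 0] xc x(2) QI] by auto
  have cof: "cofinite (B <+> ipow Q n)" if "ideal B R" for B n
    using cofinite_mono[OF cofinite_ipow[OF Q(1)]] that ipow_ideal[OF QI] by (meson add_ideals ideal_sum_upper2)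
  \<comment> \<open>In \<open>R/(P 0 + Q^n)\<close> the multiples of \<open>x\<close> form a
    submodule of length at least that of \<open>R/(P 0 + Q^(n-K))\<close>, by
    \<open>prime_colon\<close>; the quotient by it maps onto \<open>R/(P 1 + Q^n)\<close>. The step
    is \<open>Suc K\<close> since \<open>growth_step\<close> asks for a positive one.\<close>
  have "clen (P 1 <+> ipow Q n) + clen (P 0 <+> ipow Q (n - Suc K)) \<le> clen (P 0 <+> ipow Q n)"
    if n: "n \<ge> Suc K" for n
  proof -
    let ?A = "P 0 <+> ipow Q n" and ?B = "P 1 <+> ipow Q n" and ?C = "P 0 <+> ipow Q (n - Suc K)"
    let ?W = "?A <+> scale x (carrier R)" and ?N = "{y \<in> carrier R. x \<otimes> y \<in> ?A}"
    have A: "ideal ?A R" and B: "ideal ?B R" and C: "ideal ?C R"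
      using cof PI cofinite_ideal by auto
    have sx: "ideal (scale x (carrier R)) R" by (rule scale_ideal[OF xc oneideal])
    have Xi: "ideal ?W R" by (rule add_ideals[OF A sx])
    have AX: "?A \<subseteq> ?W" by (rule ideal_sum_upper1[OF A sx])
    have N: "ideal ?N R" by (rule colon_ideal[OF xc oneideal A])
    have "?N \<subseteq> P 0 <+> ipow Q (n - K)" using K[of n] n by simp
    also have "\<dots> \<subseteq> ?C" by (intro ideal_sum_mono order_refl ipow_antimono QI) simp
    finally have NC: "?N \<subseteq> ?C" .
    have XB: "?W \<subseteq> ?B"
    proof (rule ideal_sum_least[OF B])
      show "?A \<subseteq> ?B" using Suc.prems(2)[of 0] by (intro ideal_sum_mono) auto
      have "scale x (carrier R) \<subseteq> P 1"
        using x PI by (auto simp: scale_def intro: ideal.I_r_closed)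
      then show "scale x (carrier R) \<subseteq> ?B" using ideal_sum_upper1[OF PI(2) ipow_ideal[OF QI]] by blast
    qed
    have "enat (clen ?C) = len ?C (carrier R)" by (rule cofinite_len[OF cof[OF PI(1)], symmetric])
    also have "\<dots> \<le> len ?N (carrier R)"
      by (rule len_antimono[OF N C oneideal NC ideal_sub_carrier[OF C]])
    also have "\<dots> = len ?A ?W" by (rule len_scale[OF xc oneideal A, symmetric])
    also have "\<dots> = enat (clen ?A - clen ?W)" by (rule cofinite_len_diff[OF cof[OF PI(1)] Xi AX])
    finally have "clen ?C \<le> clen ?A - clen ?W" by simp
    moreover have "clen ?W \<le> clen ?A" by (rule cofinite_len_diff[OF cof[OF PI(1)] Xi AX])
    moreover have "clen ?B \<le> clen ?W"
      by (rule cofinite_len_diff[OF cofinite_mono[OF cof[OF PI(1)] Xi AX] B XB])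
    ultimately show ?thesis by simp
  qed
  then show ?case by (intro growth_step[OF c(1) _ c(2)]) auto
qed

end

section \<open>Reductions, the Samuel function and the special fiber function\<close>

context cring
begin

text \<open>Iteration of the reduction identity. It presents the shifted powers of \<open>A\<close>
  as the family \<open>J^n E\<close> with \<open>E = A^r\<close>, to which the results on graded
  families apply.\<close>

lemma reduction_ipow:
  assumes "ideal A R" "ideal J R" "ipow A (Suc r) = J \<cdot> ipow A r"
  shows "ipow A (n + r) = ipow J n \<cdot> ipow A r"
proof (induction n)
  case 0
  show ?case by (simp add: ipow_0 carrier_prod ipow_ideal assms)
next
  case (Suc n)
  note [simp] = ipow_ideal[OF assms(1)] ipow_ideal[OF assms(2)] assms(1,2)
  have "ipow A (Suc n + r) = (ipow J n \<cdot> ipow A r) \<cdot> A" using Suc by (simp add: ipow_Suc)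
  also have "\<dots> = ipow J n \<cdot> (J \<cdot> ipow A r)" by (simp add: ideal_prod_assoc assms(3)[symmetric] ipow_Suc)
  also have "\<dots> = ipow J (Suc n) \<cdot> ipow A r" by (simp add: ipow_Suc ideal_prod_assoc)
  finally show ?case .
qed

end

context noetherian_local
begin

text \<open>The Hilbert function of the special fiber ring.\<close>

definition fib :: "'a set \<Rightarrow> nat \<Rightarrow> nat" where
  "fib A n = clen (\<mm> \<cdot> ipow A n) - clen (ipow A n)"

lemma m_prod_sub: "ideal B R \<Longrightarrow> \<mm> \<cdot> B \<subseteq> B"
  by (rule prod_subset_right[OF m_ideal])

lemma cofinite_m_prod: "cofinite A \<Longrightarrow> cofinite (\<mm> \<cdot> A)"
  by (rule cofinite_prod[OF cofinite_m])

lemma len_fib: "cofinite A \<Longrightarrow> len (\<mm> \<cdot> ipow A n) (ipow A n) = enat (fib A n)"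
  unfolding fib_def using cofinite_ipow cofinite_ideal
  by (intro cofinite_len_diff(1) cofinite_m_prod m_prod_sub) auto

lemma int_fib: "cofinite A \<Longrightarrow> int (fib A n) = int (clen (\<mm> \<cdot> ipow A n)) - int (clen (ipow A n))"
  unfolding fib_def using cofinite_len_diff(2)[OF cofinite_m_prod[OF cofinite_ipow]
      cofinite_ideal[OF cofinite_ipow] m_prod_sub[OF cofinite_ideal[OF cofinite_ipow]]]
  by simp

text \<open>After the shift by \<open>r\<close> these are the lengths of a graded quotient of the
  family \<open>J^n A^r\<close>, so the degree is bounded by the generators of \<open>J\<close>. The
  shift is undone by \<open>numpoly_unshift\<close>.\<close>

lemma hilbert_reduction:
  assumes S: "finite S" "S \<subseteq> carrier R" and A: "cofinite A" "ipow A (Suc r) = (Idl S) \<cdot> ipow A r"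
    and D: "\<And>n. cofinite (D n)" "\<And>n. D n \<subseteq> ipow A n"
      "\<And>n c e. c \<in> Idl S \<Longrightarrow> e \<in> D n \<Longrightarrow> c \<otimes> e \<in> D (Suc n)"
  shows "numpoly (card S) (\<lambda>n. int (clen (D n)) - int (clen (ipow A n)))"
proof -
  note AI = cofinite_ideal[OF A(1)] and DI = cofinite_ideal[OF D(1)]
  let ?J = "Idl S" and ?E = "ipow A r" and ?D = "\<lambda>n. D (n + r)"
  have J: "ideal ?J R" by (rule genideal_ideal[OF S(2)])
  have pow: "ipow A (n + r) = ipow ?J n \<cdot> ?E" for n by (rule reduction_ipow[OF AI J A(2)])
  have diff: "len (D n) (ipow A n) = enat (clen (D n) - clen (ipow A n))" "clen (ipow A n) \<le> clen (D n)" for n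
    using cofinite_len_diff[OF D(1) ipow_ideal[OF AI] D(2)] by auto
  have "graded ?J ?E ?D"
    unfolding graded_def using DI D(2,3) by (auto simp flip: pow)
  from hilbert_function_numpoly[OF S ipow_ideal[OF AI] this] diff(1)[of r]
  obtain h where h: "\<And>n. len (D (n + r)) (ipow A (n + r)) = enat (h n)"
      and np: "numpoly (card S) (\<lambda>n. int (h n))" unfolding pow by auto
  have "int (h n) = int (clen (D (n + r))) - int (clen (ipow A (n + r)))" for n
    using h[of n] diff[of "n + r"] by simp
  then show ?thesis using np numpoly_unshift[of "card S" "\<lambda>n. int (clen (D n)) - int (clen (ipow A n))" r] by simp
qed

text \<open>The differences are the lengths of \<open>A^n/A^(n+1)\<close>, covered by
  \<open>hilbert_reduction\<close>; summation raises the degree by one.\<close>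

lemma samuel_function:
  assumes S: "finite S" "S \<subseteq> carrier R" and A: "cofinite A" "ipow A (Suc r) = (Idl S) \<cdot> ipow A r"
    and SA: "Idl S \<subseteq> A"
  shows "numpoly (Suc (card S)) (\<lambda>n. int (clen (ipow A n)))"
proof -
  have "numpoly (card S) (\<lambda>n. int (clen (ipow A (Suc n))) - int (clen (ipow A n)))"
  proof (rule hilbert_reduction[OF S A])
    show "ipow A (Suc n) \<subseteq> ipow A n" for n by (rule ipow_antimono[OF cofinite_ideal[OF A(1)]]) simp
    fix n c e assume "c \<in> Idl S" "e \<in> ipow A (Suc n)"
    then show "c \<otimes> e \<in> ipow A (Suc (Suc n))"
      using SA unfolding ipow_Suc'[OF cofinite_ideal[OF A(1)], of "Suc n"] by (auto intro: ideal_prod.prod)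
  qed (rule cofinite_ipow[OF A(1)])
  then show ?thesis by simp
qed

lemma m_prod_graded:
  assumes "ideal A R" "c \<in> A" "e \<in> \<mm> \<cdot> ipow A n" shows "c \<otimes> e \<in> \<mm> \<cdot> ipow A (Suc n)"
proof -
  have "c \<otimes> e \<in> A \<cdot> (\<mm> \<cdot> ipow A n)" using assms by (intro ideal_prod.prod)
  also have "\<dots> = (\<mm> \<cdot> ipow A n) \<cdot> A"
    by (intro ideal_prod_commute ideal_prod_is_ideal m_ideal ipow_ideal assms)
  also have "\<dots> = \<mm> \<cdot> ipow A (Suc n)"
    unfolding ipow_Suc by (intro ideal_prod_assoc m_ideal ipow_ideal assms)
  finally show ?thesis .
qed

lemma fib_numpoly:
  assumes S: "finite S" "S \<subseteq> carrier R" and A: "cofinite A" "ipow A (Suc r) = (Idl S) \<cdot> ipow A r"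
    and SA: "Idl S \<subseteq> A"
  shows "numpoly (card S) (\<lambda>n. int (fib A n))"
  unfolding int_fib[OF A(1)]
proof (rule hilbert_reduction[OF S A])
  note AI = cofinite_ideal[OF A(1)]
  show "cofinite (\<mm> \<cdot> ipow A n)" for n by (intro cofinite_m_prod cofinite_ipow A)
  show "\<mm> \<cdot> ipow A n \<subseteq> ipow A n" for n by (intro m_prod_sub ipow_ideal AI)
  show "c \<otimes> e \<in> \<mm> \<cdot> ipow A (Suc n)" if "c \<in> Idl S" "e \<in> \<mm> \<cdot> ipow A n" for n c e
    using m_prod_graded[OF AI _ that(2)] that(1) SA by blast
qed

text \<open>Take \<open>\<mm>^k \<subseteq> A\<close> and filter \<open>A^n\<close> by the ideals
  \<open>\<mm>^j A^n\<close> with \<open>j \<le> k\<close>. The factor at \<open>j\<close> has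
  length at most the number of generators of \<open>\<mm>^j\<close> times \<open>fib A n\<close>;
  \<open>C\<close> is the sum of these numbers over \<open>j < k\<close>, independent of
  \<open>n\<close>.\<close>

lemma len_powers_fib:
  assumes A: "cofinite A"
  shows "\<exists>C. \<forall>n. clen (ipow A (Suc n)) - clen (ipow A n) \<le> C * fib A n"
proof -
  note AI = cofinite_ideal[OF A]
  have "\<exists>C. \<forall>n. len (ipow \<mm> k \<cdot> ipow A n) (ipow A n) \<le> enat (C * fib A n)" for k
  proof (induction k)
    case 0
    have "len (ipow \<mm> 0 \<cdot> ipow A n) (ipow A n) = 0" for n
      by (simp add: ipow_0 carrier_prod[OF ipow_ideal[OF AI]] len_self)
    then show ?case by simp
  next
    case (Suc k)
    then obtain C where C: "\<And>n. len (ipow \<mm> k \<cdot> ipow A n) (ipow A n) \<le> enat (C * fib A n)" by blast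
    have M: "ideal (ipow \<mm> k) R" by (rule ipow_ideal[OF m_ideal])
    obtain S where S: "S \<subseteq> carrier R" "finite S" "ipow \<mm> k = Idl S" using finetely_gen[OF M] by blast
    have "len (ipow \<mm> (Suc k) \<cdot> ipow A n) (ipow A n) \<le> enat ((card S + C) * fib A n)" for n
    proof -
      let ?P = "ipow A n"
      have P: "ideal ?P R" and mP: "ideal (\<mm> \<cdot> ?P) R" by (auto intro: ipow_ideal AI m_ideal ideal_prod_is_ideal)
      have eq: "ipow \<mm> (Suc k) \<cdot> ?P = ipow \<mm> k \<cdot> (\<mm> \<cdot> ?P)"
        unfolding ipow_Suc by (rule ideal_prod_assoc[OF M m_ideal P])
      have "len (ipow \<mm> k \<cdot> (\<mm> \<cdot> ?P)) ?P
        = len (ipow \<mm> k \<cdot> (\<mm> \<cdot> ?P)) (ipow \<mm> k \<cdot> ?P) + len (ipow \<mm> k \<cdot> ?P) ?P"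
        by (intro len_add ideal_prod_is_ideal M mP P prod_mono order_refl m_prod_sub prod_subset_right)
      also have "len (ipow \<mm> k \<cdot> (\<mm> \<cdot> ?P)) (ipow \<mm> k \<cdot> ?P) \<le> enat (card S) * enat (fib A n)"
        using len_prod_le[OF S(2,1) mP P m_prod_sub[OF P]] unfolding S(3)[symmetric] len_fib[OF A] .
      also have "len (ipow \<mm> k \<cdot> ?P) ?P \<le> enat (C * fib A n)" by (rule C)
      finally show ?thesis unfolding eq by (simp add: algebra_simps)
    qed
    then show ?case by blast
  qed
  moreover obtain k where k: "ipow \<mm> k \<subseteq> A" using A unfolding cofinite_def by blast
  ultimately obtain C where C: "\<And>n. len (ipow \<mm> k \<cdot> ipow A n) (ipow A n) \<le> enat (C * fib A n)" by blast
  have "clen (ipow A (Suc n)) - clen (ipow A n) \<le> C * fib A n" for n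
  proof -
    have "enat (clen (ipow A (Suc n)) - clen (ipow A n)) = len (ipow A (Suc n)) (ipow A n)"
      by (rule cofinite_len_diff(1)[symmetric, OF cofinite_ipow[OF A] ipow_ideal[OF AI] ipow_antimono[OF AI]]) simp
    also have "\<dots> \<le> len (ipow \<mm> k \<cdot> ipow A n) (ipow A n)"
    proof (rule len_antimono)
      show "ipow \<mm> k \<cdot> ipow A n \<subseteq> ipow A (Suc n)"
        unfolding ipow_Suc'[OF AI] by (intro prod_mono k order_refl)
      show "ipow A (Suc n) \<subseteq> ipow A n" by (rule ipow_antimono[OF AI]) simp
    qed (auto intro: ideal_prod_is_ideal ipow_ideal m_ideal AI)
    also have "\<dots> \<le> enat (C * fib A n)" by (rule C)
    finally show ?thesis by simp
  qed
  then show ?thesis by blast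
qed

text \<open>Otherwise \<open>len_powers_fib\<close> makes the lengths of \<open>A^n/A^(n+1)\<close>
  smaller than any multiple of \<open>n^e\<close>, and summation pushes the colength of
  \<open>A^n\<close> below the bound \<open>c n^(e+1)\<close> that \<open>dimension_growth\<close>
  draws from a chain of primes with \<open>e + 1\<close> steps.\<close>

lemma fib_not_small:
  assumes dim: "krull_dim R = enat (Suc e)"
    and A: "cofinite A" "A \<subseteq> \<mm>"
  shows "\<not> (\<lambda>n. real (fib A n) / real n ^ e) \<longlonglongrightarrow> 0"
proof
  assume lim: "(\<lambda>n. real (fib A n) / real n ^ e) \<longlonglongrightarrow> 0"
  note AI = cofinite_ideal[OF A(1)]
  have "{P. primeideal P R} \<noteq> {}"
  proof
    assume no_prime: "{P. primeideal P R} = {}"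
    have "krull_dim R \<le> enat 0" unfolding krull_dim_def no_prime by (rule chain_height_leI) blast
    then show False using dim by simp
  qed
  then obtain P where "\<forall>i\<le>Suc e. P i \<in> {P. primeideal P R}" "\<forall>i<Suc e. P i \<subset> P (Suc i)"
    using chain_height_attained[OF dim[unfolded krull_dim_def]] by blast
  then have P: "\<And>i. i \<le> Suc e \<Longrightarrow> primeideal (P i) R" "\<And>i. i < Suc e \<Longrightarrow> P i \<subset> P (Suc i)"
    by simp_all
  obtain c N where c: "c > 0" "\<And>n. n \<ge> N \<Longrightarrow> c * real n ^ Suc e \<le> real (clen (P 0 <+> ipow A n))"
    using dimension_growth[of "Suc e" P, OF _ _ A] P by blast
  have low: "c * real n ^ Suc e \<le> real (clen (ipow A n))" if "n \<ge> N" for n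
  proof -
    have PI: "ideal (P 0) R" using P(1)[of 0] primeideal.axioms(1) by auto
    have "clen (P 0 <+> ipow A n) \<le> clen (ipow A n)"
      by (intro cofinite_len_diff(2) cofinite_ipow A add_ideals PI ipow_ideal AI ideal_sum_upper2)
    with c(2)[OF that] show ?thesis by linarith
  qed
  obtain C where C: "\<And>n. clen (ipow A (Suc n)) - clen (ipow A n) \<le> C * fib A n"
    using len_powers_fib[OF A(1)] by blast
  \<comment> \<open>Chosen so that \<open>C \<epsilon> \<le> c / 4\<close>; \<open>C + 1\<close>
    keeps the denominator positive.\<close>
  define \<epsilon> where "\<epsilon> = c / (4 * (real C + 1))"
  have \<epsilon>: "\<epsilon> > 0" using c(1) by (simp add: \<epsilon>_def)
  have C\<epsilon>: "real C * \<epsilon> \<le> c / 4"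
  proof -
    have "real C * \<epsilon> = c / 4 * (real C / (real C + 1))" by (simp add: \<epsilon>_def)
    also have "\<dots> \<le> c / 4 * 1" using c(1) by (intro mult_left_mono) auto
    finally show ?thesis by simp
  qed
  have "\<forall>\<^sub>F n in sequentially. real (fib A n) / real n ^ e < \<epsilon>"
    using order_tendstoD(2)[OF lim \<epsilon>] .
  then obtain M where M: "\<And>n. n \<ge> M \<Longrightarrow> real (fib A n) / real n ^ e < \<epsilon>"
    unfolding eventually_sequentially by blast
  define M' where "M' = max M 1"
  have step: "real (clen (ipow A (Suc n))) \<le> real (clen (ipow A n)) + c / 4 * real n ^ e" if "n \<ge> M'" for n
  proof -
    have "real (fib A n) \<le> \<epsilon> * real n ^ e"
      using M[of n] that by (simp add: M'_def field_simps less_eq_real_def)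
    then have "real C * real (fib A n) \<le> real C * (\<epsilon> * real n ^ e)" by (rule mult_left_mono) simp
    also have "\<dots> \<le> c / 4 * real n ^ e" unfolding mult.assoc[symmetric] by (intro mult_right_mono C\<epsilon>) simp
    finally have "real (C * fib A n) \<le> c / 4 * real n ^ e" by simp
    moreover have "real (clen (ipow A (Suc n))) \<le> real (clen (ipow A n)) + real (C * fib A n)"
      using C[of n] by linarith
    ultimately show ?thesis by linarith
  qed
  have up: "real (clen (ipow A (M' + j))) \<le> real (clen (ipow A M')) + real j * (c / 4 * real (M' + j) ^ e)" for j
  proof (induction j)
    case (Suc j)
    define a where "a = c / 4 * real (M' + j) ^ e"
    have "a \<le> c / 4 * real (M' + Suc j) ^ e"
      unfolding a_def using c(1) by (intro mult_left_mono power_mono) auto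
    then have "real (Suc j) * a \<le> real (Suc j) * (c / 4 * real (M' + Suc j) ^ e)"
      by (rule mult_left_mono) simp
    moreover have "real (Suc j) * a = real j * a + a" by (simp add: algebra_simps)
    moreover have "real (clen (ipow A (M' + Suc j))) \<le> real (clen (ipow A (M' + j))) + a"
      using step[of "M' + j"] by (simp add: a_def)
    moreover have "real (clen (ipow A (M' + j))) \<le> real (clen (ipow A M')) + real j * a"
      using Suc by (simp add: a_def)
    ultimately show ?case by linarith
  qed simp
  define L where "L = real (clen (ipow A M'))"
  obtain k :: nat where k: "L / (c / 4) < real k" using reals_Archimedean2 by blast
  \<comment> \<open>Large enough for the lower bound (\<open>N\<close>), the upper bound
    (\<open>M'\<close>) and \<open>L < c / 4 * n\<close> (\<open>k\<close>). Together these give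
    \<open>c n^(e+1) < c / 2 * n^(e+1)\<close>.\<close>
  define n where "n = M' + (N + k)"
  have n1: "n \<ge> 1" "n \<ge> N" "real n \<ge> real k" by (auto simp: n_def M'_def)
  have "c * real n ^ Suc e \<le> L + real (N + k) * (c / 4 * real n ^ e)"
    using low[OF n1(2)] up[of "N + k"] unfolding n_def L_def by linarith
  also have "real (N + k) * (c / 4 * real n ^ e) \<le> real n * (c / 4 * real n ^ e)"
    using c(1) by (intro mult_right_mono) (auto simp: n_def)
  finally have 1: "c * real n ^ Suc e \<le> L + c / 4 * real n ^ Suc e" by (simp add: algebra_simps)
  have "L < c / 4 * real k" using k c(1) by (simp add: field_simps)
  also have "\<dots> \<le> c / 4 * real n" using c(1) n1 by (intro mult_left_mono) auto
  also have "\<dots> \<le> c / 4 * real n ^ Suc e"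
  proof (rule mult_left_mono)
    show "real n \<le> real n ^ Suc e" using n1(1) by (simp add: one_le_power)
  qed (use c(1) in simp)
  finally have "c * real n ^ Suc e < c / 2 * real n ^ Suc e" using 1 by linarith
  moreover have "real n ^ Suc e > 0" using n1 by simp
  ultimately show False using c(1) by (simp add: mult_less_cancel_right)
qed

text \<open>The hypothesis says that beyond degree \<open>r\<close> the special fiber ring is
  generated over the images of \<open>T\<close>. Iteration bounds \<open>fib A (n + r)\<close> by a
  multiple of the number of monomials in \<open>card T \<le> e\<close> variables, which is
  \<open>o(n^e)\<close>, against \<open>fib_not_small\<close>.\<close>

lemma no_small_reduction:
  assumes dim: "krull_dim R = enat (Suc e)"
    and A: "cofinite A" "A \<subseteq> \<mm>"
    and T: "finite T" "T \<subseteq> carrier R" "card T \<le> e" "Idl T \<subseteq> A"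
    and red: "\<And>n. n \<ge> r \<Longrightarrow> ipow A (Suc n) \<subseteq> \<mm> \<cdot> ipow A (Suc n) <+> (Idl T) \<cdot> ipow A n"
  shows False
proof -
  note AI = cofinite_ideal[OF A(1)]
  let ?Y = "Idl T" and ?E = "ipow A r" and ?m = "\<lambda>n. \<mm> \<cdot> ipow A n"
  have Y: "ideal ?Y R" by (rule genideal_ideal[OF T(2)])
  have E: "ideal ?E R" by (rule ipow_ideal[OF AI])
  have mI: "ideal (?m n) R" for n by (intro ideal_prod_is_ideal m_ideal ipow_ideal AI)
  have YE: "ideal (ipow ?Y n \<cdot> ?E) R" for n by (intro ideal_prod_is_ideal ipow_ideal Y E)
  have sub: "ipow A (n + r) \<subseteq> ?m (n + r) <+> ipow ?Y n \<cdot> ?E" for n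
  proof (induction n)
    case 0
    show ?case using ideal_sum_upper2[OF mI E] by (simp add: ipow_0 carrier_prod[OF E])
  next
    case (Suc n)
    let ?W = "?m (Suc n + r) <+> ipow ?Y (Suc n) \<cdot> ?E"
    have W: "ideal ?W R" by (intro add_ideals mI YE)
    have "ipow A (Suc n + r) \<subseteq> ?m (Suc n + r) <+> ?Y \<cdot> ipow A (n + r)" using red[of "n + r"] by simp
    also have "\<dots> \<subseteq> ?W"
    proof (rule ideal_sum_least[OF W ideal_sum_upper1[OF mI YE]])
      show "?Y \<cdot> ipow A (n + r) \<subseteq> ?W"
      proof (rule prod_least[OF W])
        fix y b assume y: "y \<in> ?Y" and "b \<in> ipow A (n + r)"
        then obtain u v where uv: "u \<in> ?m (n + r)" "v \<in> ipow ?Y n \<cdot> ?E" "b = u \<oplus> v"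
          using Suc.IH by (auto simp: ideal_sum_mem subset_iff)
        have yc: "y \<in> carrier R" "u \<in> carrier R" "v \<in> carrier R"
          using y uv Y mI YE ideal_mem_carrier by blast+
        have "y \<otimes> b = y \<otimes> u \<oplus> y \<otimes> v" unfolding uv(3) using yc by (simp add: r_distr)
        moreover have "y \<otimes> u \<in> ?m (Suc n + r)"
          using m_prod_graded[OF AI _ uv(1), of y] y T(4) by auto
        moreover have "y \<otimes> v \<in> ipow ?Y (Suc n) \<cdot> ?E"
          using ideal_prod.prod[OF y uv(2), of R]
          unfolding ipow_Suc'[OF Y] ideal_prod_assoc[OF Y ipow_ideal[OF Y] E] .
        ultimately show "y \<otimes> b \<in> ?W" unfolding ideal_sum_mem by blast
      qed
    qed
    finally show ?case .
  qed
  \<comment> \<open>By \<open>len_diamond\<close>, \<open>Y^n E\<close> modulo \<open>?D n\<close>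
    has the length of its image modulo \<open>\<mm>A^(n+r)\<close>, and this image covers
    \<open>A^(n+r)/\<mm>A^(n+r)\<close> by \<open>sub\<close>.\<close>
  let ?D = "\<lambda>n. ipow ?Y n \<cdot> ?E \<inter> ?m (n + r)"
  have D: "graded ?Y ?E ?D" unfolding graded_def
  proof (intro allI conjI ballI)
    fix n
    show "ideal (?D n) R" by (intro i_intersect YE mI)
    show "?D n \<subseteq> ipow ?Y n \<cdot> ?E" by blast
    fix c b assume cb: "c \<in> ?Y" "b \<in> ?D n"
    have "c \<otimes> b \<in> ?Y \<cdot> (ipow ?Y n \<cdot> ?E)" using cb by (intro ideal_prod.prod) auto
    moreover have "c \<otimes> b \<in> ?m (Suc n + r)" using m_prod_graded[OF AI, of c b "n + r"] cb T(4) by auto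
    ultimately show "c \<otimes> b \<in> ?D (Suc n)"
      unfolding ipow_Suc'[OF Y] ideal_prod_assoc[OF Y ipow_ideal[OF Y] E] by blast
  qed
  have D0: "?D 0 = ?m r"
    using m_prod_sub[OF E] by (auto simp: ipow_0 carrier_prod[OF E])
  have bound: "fib A (n + r) \<le> fib A r * monomials (card T) n" for n
  proof -
    have "enat (fib A (n + r)) = len (?m (n + r)) (ipow A (n + r))" by (rule len_fib[OF A(1), symmetric])
    also have "\<dots> \<le> len (?m (n + r)) (?m (n + r) <+> ipow ?Y n \<cdot> ?E)"
      by (intro len_mono mI ipow_ideal AI add_ideals YE m_prod_sub sub)
    also have "\<dots> = len (?D n) (ipow ?Y n \<cdot> ?E)" by (rule len_diamond[OF YE mI])
    also have "\<dots> \<le> len (?D 0) ?E * enat (monomials (card T) n)"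
      by (rule len_graded_bound[OF T(1,2) E D])
    finally show ?thesis unfolding D0 len_fib[OF A(1)] by simp
  qed
  have "(\<lambda>n. real (fib A r) * (real (monomials (card T) (n - r)) / real (n - r) ^ e)) \<longlonglongrightarrow> real (fib A r) * 0"
    by (intro tendsto_intros filterlim_compose[OF monomials_lim_zero[OF T(3)] filterlim_minus_const_nat_at_top])
  then have z: "(\<lambda>n. real (fib A r) * (real (monomials (card T) (n - r)) / real (n - r) ^ e)) \<longlonglongrightarrow> 0"
    by simp
  have "(\<lambda>n. real (fib A n) / real n ^ e) \<longlonglongrightarrow> 0"
  proof (rule tendsto_sandwich[OF _ _ tendsto_const z])
    show "\<forall>\<^sub>F n in sequentially. real (fib A n) / real n ^ e
        \<le> real (fib A r) * (real (monomials (card T) (n - r)) / real (n - r) ^ e)"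
      using eventually_gt_at_top[of r]
    proof eventually_elim
      case (elim n)
      have "fib A n \<le> fib A r * monomials (card T) (n - r)" using bound[of "n - r"] elim by simp
      then have 1: "real (fib A n) \<le> real (fib A r * monomials (card T) (n - r))" by (simp only: of_nat_le_iff)
      have "real (fib A n) / real n ^ e \<le> real (fib A r * monomials (card T) (n - r)) / real n ^ e"
        by (rule divide_right_mono[OF 1]) simp
      also have "\<dots> \<le> real (fib A r * monomials (card T) (n - r)) / real (n - r) ^ e"
        using elim by (intro divide_left_mono power_mono mult_pos_pos zero_less_power) auto
      finally show ?case by simp
    qed
  qed simp
  with fib_not_small[OF dim A] show False by blast
qed

text \<open>A generator outside \<open>W\<close> is added to \<open>W\<close>, which lowers the
  remaining length by at least one; after at most \<open>k\<close> additions everything is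
  absorbed.\<close>

lemma choose_generators:
  assumes S: "finite S" "S \<subseteq> carrier R" and W: "ideal W R" "W \<subseteq> Idl S" "len W (Idl S) \<le> enat k"
  shows "\<exists>T\<subseteq>S. card T \<le> k \<and> Idl S \<subseteq> W <+> Idl T"
  using W
proof (induction k arbitrary: W)
  case 0
  have J: "ideal (Idl S) R" by (rule genideal_ideal[OF S(2)])
  have "W = Idl S"
  proof (rule ccontr)
    assume "W \<noteq> Idl S"
    then have "1 \<le> len W (Idl S)" using 0 J by (intro len_ge_1) auto
    then have "1 \<le> enat 0" using 0(3) by (rule order_trans)
    then show False by (simp add: one_enat_def)
  qed
  then show ?case using ideal_sum_upper1[OF 0(1) genideal_ideal[of "{}"]] by (intro exI[of _ "{}"]) auto
next
  case (Suc k)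
  have J: "ideal (Idl S) R" by (rule genideal_ideal[OF S(2)])
  show ?case
  proof (cases "S \<subseteq> W")
    case True
    then have "Idl S \<subseteq> W" by (rule genideal_minimal[OF Suc.prems(1)])
    then show ?thesis using ideal_sum_upper1[OF Suc.prems(1) genideal_ideal[of "{}"]]
      by (intro exI[of _ "{}"]) auto
  next
    case False
    then obtain x where x: "x \<in> S" "x \<notin> W" by blast
    have xc: "x \<in> carrier R" using x S by blast
    have X: "ideal (PIdl x) R" by (rule cgenideal_ideal[OF xc])
    let ?W = "W <+> PIdl x"
    have W': "ideal ?W R" by (rule add_ideals[OF Suc.prems(1) X])
    have WW: "W \<subseteq> ?W" by (rule ideal_sum_upper1[OF Suc.prems(1) X])
    have xW: "x \<in> ?W" using ideal_sum_upper2[OF Suc.prems(1) X] cgenideal_self[OF xc] by blast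
    have WJ: "?W \<subseteq> Idl S"
      using genideal_self[OF S(2)] x by (intro ideal_sum_least J Suc.prems cgenideal_minimal) auto
    have "len W (Idl S) = len W ?W + len ?W (Idl S)"
      by (rule len_add[OF Suc.prems(1) W' J WW WJ])
    moreover have "1 \<le> len W ?W" using WW xW x by (intro len_ge_1 Suc.prems W') auto
    ultimately have "1 + len ?W (Idl S) \<le> enat (Suc k)"
      using Suc.prems(3) by (metis add_right_mono order_trans)
    then have "len ?W (Idl S) \<le> enat k" by (cases "len ?W (Idl S)") (auto simp: one_enat_def)
    from Suc.IH[OF W' WJ this] obtain T where T: "T \<subseteq> S" "card T \<le> k" "Idl S \<subseteq> ?W <+> Idl T" by blast
    have Tc: "T \<subseteq> carrier R" using T S by blast
    have TI: "ideal (Idl T) R" and xTI: "ideal (Idl (insert x T)) R"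
      using Tc xc by (auto intro: genideal_ideal)
    have "?W <+> Idl T \<subseteq> W <+> Idl (insert x T)"
    proof (rule ideal_sum_least[OF _ ideal_sum_least])
      show i: "ideal (W <+> Idl (insert x T)) R" by (rule add_ideals[OF Suc.prems(1) xTI])
      then show "ideal (W <+> Idl (insert x T)) R" .
      show "W \<subseteq> W <+> Idl (insert x T)" by (rule ideal_sum_upper1[OF Suc.prems(1) xTI])
      have u: "Idl (insert x T) \<subseteq> W <+> Idl (insert x T)" by (rule ideal_sum_upper2[OF Suc.prems(1) xTI])
      have "PIdl x <+> Idl T \<subseteq> W <+> Idl (insert x T)" using u unfolding Idl_insert[OF xc Tc] .
      then show "PIdl x \<subseteq> W <+> Idl (insert x T)" "Idl T \<subseteq> W <+> Idl (insert x T)"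
        using ideal_sum_upper1[OF X TI] ideal_sum_upper2[OF X TI] by blast+
    qed
    moreover have "card (insert x T) \<le> Suc k" using T(2) card_insert_le_m1[of "Suc k" T x] by simp
    ultimately show ?thesis using T x by (intro exI[of _ "insert x T"]) auto
  qed
qed

end

section \<open>Minimal generators of reductions and the bound for the fiber multiplicity\<close>

context noetherian_local
begin

text \<open>Stated for a generating set, because the bounds on Hilbert functions depend on
  \<open>card S\<close>.\<close>

definition reduction :: "'a set \<Rightarrow> 'a set \<Rightarrow> bool" where
  "reduction A S \<longleftrightarrow> finite S \<and> S \<subseteq> carrier R \<and> Idl S \<subseteq> A \<and> (\<exists>r. ipow A (Suc r) = (Idl S) \<cdot> ipow A r)"

lemma reduction_cofinite:
  assumes "cofinite A" "reduction A S" shows "cofinite (Idl S)"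
proof -
  from assms(2) obtain r where r: "ipow A (Suc r) = (Idl S) \<cdot> ipow A r" and S: "S \<subseteq> carrier R"
    unfolding reduction_def by blast
  have J: "ideal (Idl S) R" by (rule genideal_ideal[OF S])
  have "ipow A (Suc r) \<subseteq> Idl S"
    unfolding r using ideal_prod_inter[OF J ipow_ideal[OF cofinite_ideal[OF assms(1)]]] by blast
  then show ?thesis using cofinite_mono[OF cofinite_ipow[OF assms(1)] J] by blast
qed

text \<open>Minimal generators of a minimal reduction are part of a minimal generating system of \<open>A\<close>:
  otherwise \<open>A\<close> would have a reduction with fewer than \<open>dim R\<close> generators.\<close>

lemma reduction_minimal_generators:
  assumes dim: "krull_dim R = enat (Suc e)" and A: "cofinite A" "A \<subseteq> \<mm>"
    and red: "reduction A S" and card: "card S \<le> Suc e"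
  shows "Idl S \<inter> (\<mm> \<cdot> A) = \<mm> \<cdot> (Idl S)" "clen (\<mm> \<cdot> (Idl S)) = clen (Idl S) + Suc e"
proof -
  note AI = cofinite_ideal[OF A(1)]
  let ?J = "Idl S"
  from red obtain r where S: "finite S" "S \<subseteq> carrier R" and JA: "?J \<subseteq> A"
    and r: "ipow A (Suc r) = ?J \<cdot> ipow A r" unfolding reduction_def by blast
  have J: "ideal ?J R" by (rule genideal_ideal[OF S(2)])
  have mA: "ideal (\<mm> \<cdot> A) R" by (intro ideal_prod_is_ideal m_ideal AI)
  have mJ: "ideal (\<mm> \<cdot> ?J) R" by (intro ideal_prod_is_ideal m_ideal J)
  let ?W = "?J \<inter> (\<mm> \<cdot> A)"
  have W: "ideal ?W R" by (rule i_intersect[OF J mA])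
  \<comment> \<open>Otherwise at most \<open>e\<close> of the generators, together with
    \<open>J \<inter> \<mm>A\<close>, would generate \<open>J\<close>; multiplication by
    \<open>A^n\<close> turns this into the hypothesis of \<open>no_small_reduction\<close>.\<close>
  have large: "\<not> len ?W ?J \<le> enat e"
  proof
    assume "len ?W ?J \<le> enat e"
    from choose_generators[OF S W _ this] obtain T where
      T: "T \<subseteq> S" "card T \<le> e" "?J \<subseteq> ?W <+> Idl T" by blast
    have Tc: "T \<subseteq> carrier R" and Tf: "finite T" using T S finite_subset by auto
    have Y: "ideal (Idl T) R" by (rule genideal_ideal[OF Tc])
    have YJ: "Idl T \<subseteq> ?J" by (rule subset_Idl_subset[OF S(2) T(1)])
    have "ipow A (Suc n) \<subseteq> \<mm> \<cdot> ipow A (Suc n) <+> (Idl T) \<cdot> ipow A n" (is "_ \<subseteq> ?V") if n: "n \<ge> r" for n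
    proof -
      have P: "ideal (ipow A n) R" by (rule ipow_ideal[OF AI])
      have V: "ideal ?V R" by (intro add_ideals ideal_prod_is_ideal m_ideal ipow_ideal AI Y)
      have pow: "ipow A (k + r) = ipow ?J k \<cdot> ipow A r" for k by (rule reduction_ipow[OF AI J r])
      have "ipow A (Suc n) = ipow ?J (Suc (n - r)) \<cdot> ipow A r" using pow[of "Suc (n - r)"] n by simp
      also have "\<dots> = ?J \<cdot> ipow A n"
        using pow[of "n - r"] n by (simp add: ipow_Suc'[OF J] ideal_prod_assoc J ipow_ideal AI)
      also have "\<dots> \<subseteq> ?V"
      proof (rule prod_least[OF V])
        fix j b assume j: "j \<in> ?J" and b: "b \<in> ipow A n"
        then obtain w y where wy: "w \<in> \<mm> \<cdot> A" "y \<in> Idl T" "j = w \<oplus> y"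
          using T(3) by (auto simp: ideal_sum_mem subset_iff)
        have c: "b \<in> carrier R" "w \<in> carrier R" "y \<in> carrier R"
          using b wy P mA Y ideal_mem_carrier by blast+
        have "w \<otimes> b \<in> (\<mm> \<cdot> A) \<cdot> ipow A n" by (rule ideal_prod.prod[OF wy(1) b])
        also have "\<dots> = \<mm> \<cdot> ipow A (Suc n)" unfolding ipow_Suc'[OF AI] by (rule ideal_prod_assoc[OF m_ideal AI P])
        finally have "w \<otimes> b \<in> \<mm> \<cdot> ipow A (Suc n)" .
        moreover have "y \<otimes> b \<in> (Idl T) \<cdot> ipow A n" by (rule ideal_prod.prod[OF wy(2) b])
        moreover have "j \<otimes> b = w \<otimes> b \<oplus> y \<otimes> b" unfolding wy(3) using c by (simp add: l_distr)
        ultimately show "j \<otimes> b \<in> ?V" unfolding ideal_sum_mem by blast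
      qed
      finally show ?thesis .
    qed
    then show False using no_small_reduction[OF dim A Tf Tc T(2), of r] YJ JA by blast
  qed
  have WmJ: "\<mm> \<cdot> ?J \<subseteq> ?W"
    using prod_subset_right[OF m_ideal J] prod_mono[OF order_refl JA, of \<mm>] by blast
  have Jcof: "cofinite ?J" by (rule reduction_cofinite[OF A(1) red])
  have mJcof: "cofinite (\<mm> \<cdot> ?J)" by (rule cofinite_m_prod[OF Jcof])
  have "?J \<cdot> \<mm> = \<mm> \<cdot> ?J" by (rule ideal_prod_commute[OF J m_ideal])
  then have "len (\<mm> \<cdot> ?J) ?J \<le> enat (card S) * 1"
    using len_prod_le[OF S m_ideal oneideal ideal_sub_carrier[OF m_ideal]]
    unfolding len_m ideal_prod_one[OF J] by simp
  also have "\<dots> \<le> enat (Suc e)" using card by simp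
  finally have up: "len (\<mm> \<cdot> ?J) ?J \<le> enat (Suc e)" .
  \<comment> \<open>The interval from \<open>\<mm>J\<close> to \<open>J\<close> has length at most
    \<open>e + 1\<close>, and already its part above \<open>?W\<close> has length at least
    \<open>e + 1\<close>. So \<open>?W\<close> is \<open>\<mm>J\<close> and the length is exactly
    \<open>e + 1\<close>.\<close>
  have add: "len (\<mm> \<cdot> ?J) ?J = len (\<mm> \<cdot> ?J) ?W + len ?W ?J"
    by (rule len_add[OF mJ W J WmJ]) blast
  have "\<mm> \<cdot> ?J = ?W"
  proof (rule ccontr)
    assume "\<mm> \<cdot> ?J \<noteq> ?W"
    then have "1 \<le> len (\<mm> \<cdot> ?J) ?W" using WmJ by (intro len_ge_1 mJ W) auto
    then have "1 + len ?W ?J \<le> enat (Suc e)" using up add by (metis add_right_mono order_trans)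
    then show False using large by (cases "len ?W ?J") (auto simp: one_enat_def)
  qed
  then show eq: "?W = \<mm> \<cdot> ?J" by simp
  have "len (\<mm> \<cdot> ?J) ?J = enat (Suc e)"
    using up large unfolding eq by (cases "len (\<mm> \<cdot> ?J) ?J") auto
  then show "clen (\<mm> \<cdot> ?J) = clen ?J + Suc e"
    using cofinite_len_diff[OF mJcof J prod_subset_right[OF m_ideal J]] by simp
qed

text \<open>\<open>len_graded_bound\<close> with \<open>E = R\<close> and
  \<open>D n = \<mm>J^n\<close>: the length in degree 0 is that of \<open>R/\<mm>\<close>, which is
  1.\<close>

lemma fib_le_monomials:
  assumes S: "finite S" "S \<subseteq> carrier R" "cofinite (Idl S)"
  shows "fib (Idl S) n \<le> monomials (card S) n"
proof -
  let ?J = "Idl S" and ?D = "\<lambda>n. \<mm> \<cdot> ipow (Idl S) n"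
  have J: "ideal ?J R" by (rule genideal_ideal[OF S(2)])
  have one: "ipow ?J n \<cdot> carrier R = ipow ?J n" for n by (rule ideal_prod_one[OF ipow_ideal[OF J]])
  have "graded ?J (carrier R) ?D" unfolding graded_def one
    by (intro allI conjI ballI ideal_prod_is_ideal m_ideal ipow_ideal J m_prod_sub m_prod_graded)
  from len_graded_bound[OF S(1,2) oneideal this, of n]
  have "enat (fib ?J n) \<le> 1 * enat (monomials (card S) n)"
    unfolding one len_fib[OF S(3)] by (simp add: ipow_0 ideal_prod_one[OF m_ideal] len_m)
  then show ?thesis by simp
qed

context
  fixes e :: nat and A S :: "'a set" and eA eJ c :: "nat \<Rightarrow> int"
  assumes A: "cofinite A" and red: "reduction A S" and card: "card S \<le> Suc e"
    and eA: "\<forall>\<^sub>F n in sequentially. int (clen (ipow A n)) = binom_exp (Suc e) eA n"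
    and eJ: "\<forall>\<^sub>F n in sequentially. int (clen (ipow (Idl S) n)) = binom_exp (Suc e) eJ n"
    and c: "\<forall>\<^sub>F n in sequentially. int (fib A n) = binom_exp e c n"
begin

lemma reduction_gens: "finite S" "S \<subseteq> carrier R" "Idl S \<subseteq> A" "ideal (Idl S) R"
  using red genideal_ideal[of S] unfolding reduction_def by auto

abbreviation (input) diff_length :: "nat \<Rightarrow> int" where
  "diff_length n \<equiv> int (clen (ipow (Idl S) n)) - int (clen (ipow A n))"

lemma diff_length_binom_exp:
  "\<forall>\<^sub>F n in sequentially. diff_length n = binom_exp (Suc e) (\<lambda>i. eJ i - eA i) n"
  using eA eJ by eventually_elim (simp add: binom_exp_minus)

text \<open>By \<open>hilbert_reduction\<close> with \<open>D n = J^n\<close>, the lengths of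
  \<open>A^n/J^n\<close> grow at most like \<open>n^e\<close>, so the coefficients at
  \<open>n^(e+1)\<close> agree.\<close>

lemma multiplicity_eq: "eA 0 = eJ 0"
proof -
  obtain r where r: "ipow A (Suc r) = (Idl S) \<cdot> ipow A r" using red unfolding reduction_def by blast
  note J = reduction_gens(4)
  have "numpoly (card S) (\<lambda>n. diff_length n)"
  proof (rule hilbert_reduction[OF reduction_gens(1,2) A r cofinite_ipow ipow_mono])
    fix n a b assume "a \<in> Idl S" "b \<in> ipow (Idl S) n"
    then show "a \<otimes> b \<in> ipow (Idl S) (Suc n)" unfolding ipow_Suc'[OF J] by (rule ideal_prod.prod)
  qed (rule reduction_cofinite[OF A red] reduction_gens(3))+
  from numpoly_lim_zero[OF this card]
  have 1: "(\<lambda>n. real_of_int (diff_length n) / real n ^ Suc e) \<longlonglongrightarrow> 0" .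
  have 2: "(\<lambda>n. real_of_int (diff_length n) / real n ^ Suc e) \<longlonglongrightarrow> real_of_int (eJ 0 - eA 0) / fact (Suc e)"
    by (rule Lim_transform_eventually[OF binom_exp_lim[of "Suc e" "\<lambda>i. eJ i - eA i"]])
      (use diff_length_binom_exp in \<open>eventually_elim, simp\<close>)
  have "real_of_int (eJ 0 - eA 0) / fact (Suc e) = 0" by (rule LIMSEQ_unique[OF 2 1])
  then show ?thesis by simp
qed

text \<open>With the multiplicities cancelled, \<open>binom_exp_drop\<close> leaves minus an
  expansion of degree \<open>e\<close> with leading coefficient \<open>eJ 1 - eA 1\<close>.\<close>

lemma diff_length_lim:
  "(\<lambda>n. real_of_int (diff_length n) / real n ^ e) \<longlonglongrightarrow> real_of_int (eA 1 - eJ 1) / fact e"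
proof (rule Lim_transform_eventually)
  show "(\<lambda>n. - (real_of_int (binom_exp e (\<lambda>i. eJ (Suc i) - eA (Suc i)) n) / real n ^ e))
      \<longlonglongrightarrow> real_of_int (eA 1 - eJ 1) / fact e"
    using tendsto_minus[OF binom_exp_lim[of e "\<lambda>i. eJ (Suc i) - eA (Suc i)"]]
    by (simp add: diff_divide_distrib)
  show "\<forall>\<^sub>F n in sequentially. - (real_of_int (binom_exp e (\<lambda>i. eJ (Suc i) - eA (Suc i)) n) / real n ^ e)
      = real_of_int (diff_length n) / real n ^ e"
    using diff_length_binom_exp
  proof eventually_elim
    case (elim n)
    have "binom_exp (Suc e) (\<lambda>i. eJ i - eA i) n = - binom_exp e (\<lambda>i. eJ (Suc i) - eA (Suc i)) n"
      by (rule binom_exp_drop) (simp add: multiplicity_eq)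
    then show ?case unfolding elim by simp
  qed
qed

lemma fib_lim: "(\<lambda>n. real (fib A n) / real n ^ e) \<longlonglongrightarrow> real_of_int (c 0) / fact e"
proof (rule Lim_transform_eventually[OF binom_exp_lim])
  show "\<forall>\<^sub>F n in sequentially. real_of_int (binom_exp e c n) / real n ^ e = real (fib A n) / real n ^ e"
    using c
  proof eventually_elim
    case (elim n)
    show ?case unfolding elim[symmetric] by simp
  qed
qed

lemma fib_reduction_le: "fib (Idl S) n \<le> monomials (Suc e) n"
  using fib_le_monomials[OF reduction_gens(1,2) reduction_cofinite[OF A red], of n]
    monomials_mono[OF card, of n] by linarith

text \<open>Since \<open>\<mm>J\<^sup>n \<subseteq> \<mm>A\<^sup>n\<close> for \<open>J = Idl S\<close>, \<open>\<lambda>(A\<^sup>n/\<mm>A\<^sup>n) \<le> \<lambda>(J\<^sup>n/\<mm>J\<^sup>n) + \<lambda>(A\<^sup>n/J\<^sup>n)\<close>.\<close>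

lemma fiber_multiplicity_le: "c 0 \<le> eA 1 - eJ 1 + 1"
proof -
  note AI = cofinite_ideal[OF A] and J = reduction_gens(4) and Jcof = reduction_cofinite[OF A red]
  have le: "int (fib A n) \<le> int (monomials (Suc e) n) + diff_length n" for n
  proof -
    have "clen (\<mm> \<cdot> ipow A n) \<le> clen (\<mm> \<cdot> ipow (Idl S) n)"
      by (intro cofinite_len_diff(2) cofinite_m_prod cofinite_ipow Jcof ideal_prod_is_ideal m_ideal
          ipow_ideal AI prod_mono order_refl ipow_mono reduction_gens(3))
    then show ?thesis
      using fib_reduction_le[of n] int_fib[OF A, of n] int_fib[OF Jcof, of n] by linarith
  qed
  have "real (fib A n) / real n ^ e
      \<le> real (monomials (Suc e) n) / real n ^ e + real_of_int (diff_length n) / real n ^ e" for n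
  proof -
    have "real_of_int (int (fib A n)) \<le> real_of_int (int (monomials (Suc e) n) + diff_length n)"
      using le[of n] by (simp only: of_int_le_iff)
    then have "real (fib A n) \<le> real (monomials (Suc e) n) + real_of_int (diff_length n)" by simp
    from divide_right_mono[OF this, of "real n ^ e"] show ?thesis by (simp add: add_divide_distrib)
  qed
  then have "real_of_int (c 0) / fact e \<le> 1 / fact e + real_of_int (eA 1 - eJ 1) / fact e"
    by (intro LIMSEQ_le[OF fib_lim tendsto_add[OF monomials_lim diff_length_lim]]) blast
  then have "real_of_int (c 0) / fact e \<le> (1 + real_of_int (eA 1 - eJ 1)) / fact e"
    by (simp only: add_divide_distrib)
  then have "real_of_int (c 0) \<le> 1 + real_of_int (eA 1 - eJ 1)" by (simp add: divide_le_cancel)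
  then show ?thesis by linarith
qed

text \<open>If some \<open>a \<in> \<mm>A\<close> lies outside \<open>J = Idl S\<close>, then \<open>aJ\<^sup>n + J\<^sup>n\<^sup>+\<^sup>1\<close> is contained in
  \<open>\<mm>A\<^sup>n\<^sup>+\<^sup>1 + J\<^sup>n\<^sup>+\<^sup>1\<close>, which improves the bound by one.\<close>

lemma m_prod_sub_reduction:
  assumes l: "int (clen (Idl S)) = eJ 0" and eq: "c 0 = eA 1 - eJ 1 + 1"
  shows "\<mm> \<cdot> A \<subseteq> Idl S"
proof -
  note AI = cofinite_ideal[OF A] and Jcof = reduction_cofinite[OF A red]
  let ?J = "Idl S" and ?q = diff_length and ?L = "real_of_int (eA 1 - eJ 1)" and ?M = "monomials (Suc e)"
  note S = reduction_gens(1,2) and JA = reduction_gens(3) and J = reduction_gens(4)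
  have intfib: "int (fib A n) = int (clen (\<mm> \<cdot> ipow A n)) - int (clen (ipow A n))" for n
    by (rule int_fib[OF A])
  have ideals: "ideal (ipow A n) R" "ideal (ipow ?J n) R" "ideal (\<mm> \<cdot> ipow A n) R" "ideal (\<mm> \<cdot> ipow ?J n) R" for n
    by (auto intro: ideal_prod_is_ideal m_ideal ipow_ideal AI J)
  show ?thesis
  proof
    fix a assume a: "a \<in> \<mm> \<cdot> A"
    show "a \<in> ?J"
    proof (rule ccontr)
      assume aJ: "a \<notin> ?J"
      have mA: "ideal (\<mm> \<cdot> A) R" by (intro ideal_prod_is_ideal m_ideal AI)
      have ac: "a \<in> carrier R" using a mA ideal_mem_carrier by blast
      \<comment> \<open>In degree 0 this is \<open>J + aR\<close>, strictly larger than
        \<open>J\<close>, so its colength is at most \<open>clen J - 1\<close>. The bound by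
        monomials carries this gain to every degree.\<close>
      let ?D = "\<lambda>n. ipow ?J (Suc n) <+> scale a (ipow ?J n)"
      have sc: "ideal (scale a (ipow ?J n)) R" for n by (intro scale_ideal ac ideals)
      have D: "ideal (?D n) R" for n by (intro add_ideals ideals sc)
      have one: "ipow ?J n \<cdot> carrier R = ipow ?J n" for n by (rule ideal_prod_one[OF ideals(2)])
      have Dsub: "?D n \<subseteq> ipow ?J n" for n
        by (intro ideal_sum_least ideals ipow_antimono J scale_subset ac order_refl) simp
      have Dcof: "cofinite (?D n)" for n by (intro cofinite_add cofinite_ipow Jcof sc)
      have "graded ?J (carrier R) ?D" unfolding graded_def one
      proof (intro allI conjI ballI D Dsub)
        fix n j b assume j: "j \<in> ?J" and "b \<in> ?D n"
        then obtain u v where uv: "u \<in> ipow ?J (Suc n)" "v \<in> ipow ?J n" "b = u \<oplus> a \<otimes> v"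
          by (auto simp: ideal_sum_mem scale_def)
        have c: "j \<in> carrier R" "u \<in> carrier R" "v \<in> carrier R" using j uv J ideals ideal_mem_carrier by blast+
        have "j \<otimes> b = j \<otimes> u \<oplus> a \<otimes> (j \<otimes> v)" unfolding uv(3) using c ac by algebra
        moreover have "j \<otimes> u \<in> ipow ?J (Suc (Suc n))" "j \<otimes> v \<in> ipow ?J (Suc n)"
          unfolding ipow_Suc'[OF J, of "Suc n"] ipow_Suc'[OF J, of n]
          using ideal_prod.prod[OF j uv(1)] ideal_prod.prod[OF j uv(2)] by (simp_all add: ipow_Suc'[OF J])
        ultimately show "j \<otimes> b \<in> ?D (Suc n)" unfolding ideal_sum_mem scale_def by blast
      qed
      from len_graded_bound[OF S oneideal this]
      have lenD: "len (?D n) (ipow ?J n) \<le> len (?D 0) (carrier R) * enat (monomials (card S) n)" for n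
        unfolding one .
      have D0: "clen (?D 0) < clen ?J"
      proof (rule ccontr)
        have sub: "?J \<subseteq> ?D 0" using ideal_sum_upper1[OF ideals(2) sc, of "Suc 0" 0] by (simp add: ipow_1[OF J])
        assume "\<not> clen (?D 0) < clen ?J"
        then have "?J = ?D 0" using clen_eq_imp_eq[OF Jcof D sub] by simp
        moreover have "a \<in> ?D 0"
        proof -
          have "a \<in> scale a (ipow ?J 0)" using ac by (auto simp: scale_def ipow_0 intro!: rev_image_eqI[of \<one>])
          then show ?thesis using ideal_sum_upper2[OF ideals(2) sc] by blast
        qed
        ultimately show False using aJ by simp
      qed
      have bnd: "clen (?D n) \<le> clen (ipow ?J n) + (clen ?J - 1) * ?M n" for n
      proof -
        have "enat (clen (?D n) - clen (ipow ?J n)) = len (?D n) (ipow ?J n)"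
          by (rule cofinite_len_diff(1)[OF Dcof ideals(2) Dsub, symmetric])
        also have "\<dots> \<le> enat (clen (?D 0) * monomials (card S) n)"
          using lenD[of n] unfolding cofinite_len[OF Dcof] by simp
        finally have "clen (?D n) - clen (ipow ?J n) \<le> clen (?D 0) * monomials (card S) n" by simp
        also have "\<dots> \<le> (clen ?J - 1) * ?M n" using D0 by (intro mult_mono monomials_mono card) auto
        finally show ?thesis by linarith
      qed
      \<comment> \<open>The colength of \<open>\<mm>A^(n+1)\<close> is estimated through
        \<open>?V = \<mm>A^(n+1) + J^(n+1)\<close>: the length of \<open>?V\<close> over
        \<open>\<mm>A^(n+1)\<close> is at most \<open>fib J (n+1)\<close>, and \<open>?V\<close>
        contains \<open>?D n\<close>, whose colength is bounded by \<open>bnd\<close>.\<close>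
      have step: "int (fib A (Suc n)) \<le> int (?M (Suc n)) + ?q (Suc n)
          - (int (clen (ipow ?J (Suc n))) - int (clen (ipow ?J n))) + int (clen ?J - 1) * int (?M (Suc n))" for n
      proof -
        let ?B = "\<mm> \<cdot> ipow A (Suc n)"
        let ?V = "?B <+> ipow ?J (Suc n)"
        have V: "ideal ?V R" by (intro add_ideals ideals)
        have BV: "?B \<subseteq> ?V" by (intro ideal_sum_upper1 ideals)
        have Bcof: "cofinite ?B" by (intro cofinite_m_prod cofinite_ipow A)
        have "len ?B ?V \<le> len (\<mm> \<cdot> ipow ?J (Suc n)) (ipow ?J (Suc n))"
          by (intro len_sum_le ideals m_prod_sub prod_mono order_refl ipow_mono JA)
        then have "clen ?B - clen ?V \<le> fib ?J (Suc n)"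
          unfolding len_fib[OF Jcof] cofinite_len_diff(1)[OF Bcof V BV] by simp
        then have 1: "clen ?B \<le> clen ?V + ?M (Suc n)" using fib_reduction_le[of "Suc n"] by linarith
        have "?D n \<subseteq> ?V"
        proof (rule ideal_sum_least[OF V ideal_sum_upper2[OF ideals(3,2)]])
          have "scale a (ipow ?J n) \<subseteq> ?B"
          proof
            fix z assume "z \<in> scale a (ipow ?J n)"
            then obtain v where v: "v \<in> ipow ?J n" "z = a \<otimes> v" by (auto simp: scale_def)
            then have "v \<in> ipow A n" using ipow_mono[OF JA] by blast
            then have "z \<in> (\<mm> \<cdot> A) \<cdot> ipow A n" unfolding v(2) using a by (intro ideal_prod.prod)
            then show "z \<in> ?B" unfolding ipow_Suc'[OF AI] ideal_prod_assoc[OF m_ideal AI ideals(1)] .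
          qed
          then show "scale a (ipow ?J n) \<subseteq> ?V" using BV by blast
        qed
        then have 2: "clen ?V \<le> clen (?D n)" by (rule cofinite_len_diff(2)[OF Dcof V])
        have "(clen ?J - 1) * ?M n \<le> (clen ?J - 1) * ?M (Suc n)"
          by (intro mult_left_mono monomials_Suc_arg) auto
        then have 3: "clen ?B \<le> ?M (Suc n) + clen (ipow ?J n) + (clen ?J - 1) * ?M (Suc n)"
          using 1 2 bnd[of n] by linarith
        have "int (clen ?B) \<le> int (?M (Suc n)) + int (clen (ipow ?J n)) + int (clen ?J - 1) * int (?M (Suc n))"
          using 3 by (simp only: of_nat_le_iff flip: of_nat_add of_nat_mult)
        then show ?thesis using intfib[of "Suc n"] by linarith
      qed
      \<comment> \<open>By \<open>binom_exp_diff\<close> this is eventually the length of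
        \<open>J^(n-1)/J^n\<close>, with leading coefficient \<open>eJ 0\<close>.\<close>
      let ?b = "\<lambda>n. binom_exp e eJ n"
      have ev: "\<forall>\<^sub>F n in sequentially. real (fib A n) / real n ^ e
          \<le> real (?M n) / real n ^ e + real_of_int (?q n) / real n ^ e
            - real_of_int (?b n) / real n ^ e + real (clen ?J - 1) * (real (?M n) / real n ^ e)"
        using eJ eventually_seq_diff[OF eJ, of 1] eventually_gt_at_top[of 0]
      proof eventually_elim
        case (elim n)
        then obtain k where n: "n = Suc k" by (cases n) auto
        have "int (clen (ipow ?J (Suc k))) - int (clen (ipow ?J k)) = ?b (Suc k)"
          using elim(1,2) binom_exp_diff[of e eJ k] unfolding n by simp
        with step[of k] have "int (fib A n) \<le> int (?M n) + ?q n - ?b n + int (clen ?J - 1) * int (?M n)"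
          unfolding n by linarith
        then have "real_of_int (int (fib A n)) \<le> real_of_int (int (?M n) + ?q n - ?b n + int (clen ?J - 1) * int (?M n))"
          by (simp only: of_int_le_iff)
        then have "real (fib A n) \<le> real (?M n) + real_of_int (?q n) - real_of_int (?b n)
            + real (clen ?J - 1) * real (?M n)" by simp
        from divide_right_mono[OF this, of "real n ^ e"] show ?case
          by (simp add: add_divide_distrib diff_divide_distrib)
      qed
      have "real_of_int (c 0) / fact e \<le> 1 / fact e + ?L / fact e - real_of_int (eJ 0) / fact e
          + real (clen ?J - 1) * (1 / fact e)"
        proof (rule tendsto_le[OF _ _ fib_lim ev])
        show "(\<lambda>n. real (?M n) / real n ^ e + real_of_int (?q n) / real n ^ e
            - real_of_int (?b n) / real n ^ e + real (clen ?J - 1) * (real (?M n) / real n ^ e))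
          \<longlonglongrightarrow> 1 / fact e + ?L / fact e - real_of_int (eJ 0) / fact e + real (clen ?J - 1) * (1 / fact e)"
          by (intro tendsto_add tendsto_diff tendsto_mult_left monomials_lim diff_length_lim binom_exp_lim)
      qed simp
      then have "real_of_int (c 0) / fact e \<le> (1 + ?L - real_of_int (eJ 0) + real (clen ?J - 1)) / fact e"
        by (simp only: add_divide_distrib diff_divide_distrib times_divide_eq_right mult_1_right)
      then have "real_of_int (c 0) \<le> 1 + ?L - real_of_int (eJ 0) + real (clen ?J - 1)"
        by (simp add: divide_le_cancel)
      \<comment> \<open>\<open>D0\<close> makes \<open>clen J\<close> positive, so the truncated
        subtraction is genuine. Inserting the value gives \<open>c 0 \<le> eA 1 - eJ 1\<close>, one
        less than \<open>eq\<close> asserts.\<close>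
      moreover have "real (clen ?J - 1) = real_of_int (eJ 0) - 1"
      proof -
        have "real_of_int (int (clen ?J)) = real_of_int (eJ 0)" unfolding l ..
        then show ?thesis using D0 by simp
      qed
      ultimately show False unfolding eq by simp
    qed
  qed
qed

end

text \<open>Otherwise \<open>fib A n\<close> would be \<open>o(n^e)\<close>, contrary to
  \<open>fib_not_small\<close>. In effect, the fiber ring has the full dimension
  \<open>e + 1\<close>.\<close>

lemma fiber_leading_coeff:
  assumes dim: "krull_dim R = enat (Suc e)" and A: "cofinite A" "A \<subseteq> \<mm>"
    and c: "\<forall>\<^sub>F n in sequentially. int (fib A n) = binom_exp e c n"
  shows "c 0 \<noteq> 0"
proof
  assume c0: "c 0 = 0"
  have "(\<lambda>n. real (fib A n) / real n ^ e) \<longlonglongrightarrow> real_of_int (c 0) / fact e"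
  proof (rule Lim_transform_eventually[OF binom_exp_lim])
    show "\<forall>\<^sub>F n in sequentially. real_of_int (binom_exp e c n) / real n ^ e = real (fib A n) / real n ^ e"
      using c by eventually_elim (metis of_int_of_nat_eq)
  qed
  then show False using fib_not_small[OF dim A] c0 by simp
qed

end

section \<open>The special fiber ring\<close>

context cring
begin

text \<open>Submodules of \<open>M\<close> and ideals between \<open>D\<close> and \<open>E\<close>
  correspond by image and preimage under \<open>\<phi>\<close>. \<open>M\<close> is described only
  through equations for \<open>\<phi>\<close>, which suits records such as
  \<open>special_fiber_component\<close>, obtained by changing the carrier of a quotient
  algebra.\<close>

lemma module_length_image:
  assumes D: "ideal D R" and E: "ideal E R" and DE: "D \<subseteq> E"
    and car: "carrier M = \<phi> ` E" and zero: "\<zero>\<^bsub>M\<^esub> = \<phi> \<zero>"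
    and add: "\<And>a b. a \<in> E \<Longrightarrow> b \<in> E \<Longrightarrow> \<phi> a \<oplus>\<^bsub>M\<^esub> \<phi> b = \<phi> (a \<oplus> b)"
    and smult: "\<And>r a. r \<in> carrier R \<Longrightarrow> a \<in> E \<Longrightarrow> r \<odot>\<^bsub>M\<^esub> \<phi> a = \<phi> (r \<otimes> a)"
    and kernel: "\<And>a. a \<in> E \<Longrightarrow> \<phi> a = \<zero>\<^bsub>M\<^esub> \<longleftrightarrow> a \<in> D"
  shows "module_length R M = len D E"
proof -
  have Ec: "a \<in> carrier R" if "a \<in> E" for a using that E ideal_mem_carrier by blast
  have neg: "\<ominus> a \<in> E" if "a \<in> E" for a
    using that E by (simp add: additive_subgroup.a_inv_closed ideal.axioms(1))
  have eqD: "a \<ominus> b \<in> D" if "a \<in> E" "b \<in> E" "\<phi> a = \<phi> b" for a b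
  proof -
    have "\<phi> (a \<ominus> b) = \<phi> a \<oplus>\<^bsub>M\<^esub> \<phi> (\<ominus> b)"
      using that(1,2) neg by (simp add: add a_minus_def)
    also have "\<dots> = \<phi> (b \<oplus> \<ominus> b)" unfolding that(3) by (rule add[OF that(2) neg[OF that(2)]])
    also have "\<dots> = \<zero>\<^bsub>M\<^esub>" using Ec[OF that(2)] by (simp add: zero r_neg)
    finally show ?thesis using kernel[of "a \<ominus> b"] that E by (simp add: ideal_mem_minus)
  qed
  \<comment> \<open>Submodules are closed under the inverse of \<open>add_monoid M\<close>, which is
    a definite description, so uniqueness is checked inside the image of \<open>E\<close>.\<close>
  have inv: "inv\<^bsub>add_monoid M\<^esub> (\<phi> a) = \<phi> (\<ominus> a)" if a: "a \<in> E" for a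
    unfolding m_inv_def
  proof (rule the_equality)
    show "\<phi> (\<ominus> a) \<in> carrier (add_monoid M) \<and> \<phi> a \<otimes>\<^bsub>add_monoid M\<^esub> \<phi> (\<ominus> a) = \<one>\<^bsub>add_monoid M\<^esub>
        \<and> \<phi> (\<ominus> a) \<otimes>\<^bsub>add_monoid M\<^esub> \<phi> a = \<one>\<^bsub>add_monoid M\<^esub>"
      using a neg Ec[OF a] by (simp add: car add zero r_neg l_neg)
    fix y assume "y \<in> carrier (add_monoid M) \<and> \<phi> a \<otimes>\<^bsub>add_monoid M\<^esub> y = \<one>\<^bsub>add_monoid M\<^esub>
        \<and> y \<otimes>\<^bsub>add_monoid M\<^esub> \<phi> a = \<one>\<^bsub>add_monoid M\<^esub>"
    then obtain b where b: "b \<in> E" "y = \<phi> b" "\<phi> (a \<oplus> b) = \<zero>\<^bsub>M\<^esub>" using a by (auto simp: car add)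
    have ab: "a \<oplus> b \<in> E" using a b E ideal_mem_add by blast
    have z: "\<phi> (a \<oplus> b) = \<phi> \<zero>" using b(3) zero by simp
    have "\<phi> (\<ominus> a) = \<phi> (\<ominus> a) \<oplus>\<^bsub>M\<^esub> \<phi> \<zero>"
      using a neg Ec ideal_mem_zero[OF E] by (simp add: add)
    also have "\<dots> = \<phi> (\<ominus> a \<oplus> (a \<oplus> b))" unfolding z[symmetric] using a neg ab by (simp add: add)
    also have "\<ominus> a \<oplus> (a \<oplus> b) = b" using Ec[OF a] Ec[OF b(1)] by algebra
    finally show "y = \<phi> (\<ominus> a)" using b by simp
  qed
  have kerE: "\<phi> a = \<phi> \<zero>" if "a \<in> D" "a \<in> E" for a using kernel[OF that(2)] that zero by simp
  have le: "len D E \<le> module_length R M"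
    unfolding len_def module_length_def
  proof (rule chain_height_mono_map[where F = "\<lambda>K. \<phi> ` K"])
    fix K assume "K \<in> {K. ideal K R \<and> D \<subseteq> K \<and> K \<subseteq> E}"
    then have K: "ideal K R" "D \<subseteq> K" "K \<subseteq> E" by auto
    have negK: "\<ominus> a \<in> K" if "a \<in> K" for a
      using that K by (simp add: additive_subgroup.a_inv_closed ideal.axioms(1))
    have "submodule (\<phi> ` K) R M"
    proof (intro submodule.intro subgroup.intro submodule_axioms.intro)
      show "\<phi> ` K \<subseteq> carrier (add_monoid M)" using K by (auto simp: car)
      show "\<one>\<^bsub>add_monoid M\<^esub> \<in> \<phi> ` K" using ideal_mem_zero[OF K(1)] by (simp add: zero)
    next
      fix x y assume "x \<in> \<phi> ` K" "y \<in> \<phi> ` K"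
      then obtain a b where "a \<in> K" "b \<in> K" "x = \<phi> a" "y = \<phi> b" by blast
      then show "x \<otimes>\<^bsub>add_monoid M\<^esub> y \<in> \<phi> ` K" using K ideal_mem_add[OF K(1)] by (auto simp: add subset_iff)
    next
      fix x assume "x \<in> \<phi> ` K"
      then obtain a where "a \<in> K" "x = \<phi> a" by blast
      then show "inv\<^bsub>add_monoid M\<^esub> x \<in> \<phi> ` K" using K negK inv by auto
    next
      fix r x assume r: "r \<in> carrier R" and "x \<in> \<phi> ` K"
      then obtain a where "a \<in> K" "x = \<phi> a" by blast
      then show "r \<odot>\<^bsub>M\<^esub> x \<in> \<phi> ` K" using K r ideal_mem_mult[OF K(1) r] by (auto simp: smult subset_iff)
    qed
    then show "\<phi> ` K \<in> {N. submodule N R M}" by simp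
  next
    fix K L assume K: "K \<in> {K. ideal K R \<and> D \<subseteq> K \<and> K \<subseteq> E}" and L: "L \<in> {K. ideal K R \<and> D \<subseteq> K \<and> K \<subseteq> E}"
      and KL: "K \<subset> L"
    obtain a where a: "a \<in> L" "a \<notin> K" using KL by blast
    have "\<phi> a \<notin> \<phi> ` K"
    proof
      assume "\<phi> a \<in> \<phi> ` K"
      then obtain k where k: "k \<in> K" "\<phi> a = \<phi> k" by blast
      have kE: "k \<in> E" "a \<in> E" using k a K L by auto
      then have "a \<ominus> k \<in> K" using eqD k K by blast
      then have "(a \<ominus> k) \<oplus> k \<in> K" using k K by (auto intro: ideal_mem_add)
      moreover have "(a \<ominus> k) \<oplus> k = a" using Ec[OF kE(1)] Ec[OF kE(2)] by algebra
      ultimately show False using a by simp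
    qed
    then show "\<phi> ` K \<subset> \<phi> ` L" using KL a by blast
  qed
  have ge: "module_length R M \<le> len D E"
    unfolding len_def module_length_def
  proof (rule chain_height_mono_map[where F = "\<lambda>N. {a \<in> E. \<phi> a \<in> N}"])
    fix N assume "N \<in> {N. submodule N R M}"
    then interpret N: submodule N R M by simp
    have zN: "\<phi> \<zero> \<in> N" using N.one_closed by (simp add: zero)
    have "ideal {a \<in> E. \<phi> a \<in> N} R"
    proof (rule ideal_memI)
      fix x y assume xy: "x \<in> {a \<in> E. \<phi> a \<in> N}" "y \<in> {a \<in> E. \<phi> a \<in> N}"
      then have "\<phi> x \<oplus>\<^bsub>M\<^esub> \<phi> y \<in> N" using N.m_closed[of "\<phi> x" "\<phi> y"] by simp
      then show "x \<oplus> y \<in> {a \<in> E. \<phi> a \<in> N}" using xy E by (auto simp: add intro: ideal_mem_add)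
    next
      fix r x assume r: "r \<in> carrier R" and x: "x \<in> {a \<in> E. \<phi> a \<in> N}"
      then have "r \<odot>\<^bsub>M\<^esub> \<phi> x \<in> N" using N.smult_closed by simp
      then show "r \<otimes> x \<in> {a \<in> E. \<phi> a \<in> N}" using r x E by (auto simp: smult intro: ideal_mem_mult)
    qed (use Ec zN ideal_mem_zero[OF E] in auto)
    moreover note DE
    ultimately show "{a \<in> E. \<phi> a \<in> N} \<in> {K. ideal K R \<and> D \<subseteq> K \<and> K \<subseteq> E}"
      using kerE zN by auto
  next
    fix N L assume N: "N \<in> {N. submodule N R M}" and L: "L \<in> {N. submodule N R M}" and NL: "N \<subset> L"
    have sub: "L \<subseteq> carrier M" using L subgroup.subset[of L "add_monoid M"] by (auto simp: submodule_def)
    obtain y where y: "y \<in> L" "y \<notin> N" using NL by blast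
    then obtain a where "a \<in> E" "y = \<phi> a" using sub by (auto simp: car)
    then show "{a \<in> E. \<phi> a \<in> N} \<subset> {a \<in> E. \<phi> a \<in> L}" using NL y by blast
  qed
  show ?thesis by (rule antisym[OF ge le])
qed

lemma module_length_quot:
  assumes A: "ideal A R"
  shows "module_length R (quot_module (self_module R) A) = len A (carrier R)"
proof -
  interpret A: ideal A R by fact
  let ?M = "quot_module (self_module R) A"
  have cos: "A +>\<^bsub>self_module R\<^esub> a = A +> a" for a by (simp add: a_r_coset_def' self_module_def)
  have Quot: "carrier ?M = (\<lambda>a. A +> a) ` carrier R" "\<zero>\<^bsub>?M\<^esub> = A"
    "\<And>C D. C \<oplus>\<^bsub>?M\<^esub> D = C <+> D"
    "\<And>r C. r \<odot>\<^bsub>?M\<^esub> C = (\<Union>x\<in>C. A +> (r \<otimes> x))"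
    by (auto simp: quot_module_def FactRing_def A_RCOSETS_def' cos self_module_def a_r_coset_def' set_add_def')
  have zero: "A +> \<zero> = A" by (rule a_rcos_zero[OF A ideal_mem_zero[OF A]])
  show ?thesis
  proof (rule module_length_image[where \<phi> = "\<lambda>a. A +> a"])
    fix r a assume r: "r \<in> carrier R" and a: "a \<in> carrier R"
    \<comment> \<open>The scalar action of \<open>quot_module\<close> is a union over the coset, so
      its members must be the same for all representatives.\<close>
    have "A +> (r \<otimes> x) = A +> (r \<otimes> a)" if x: "x \<in> A +> a" for x
    proof -
      obtain i where i: "i \<in> A" "x = i \<oplus> a" using x by (auto simp: a_r_coset_def')
      have ic: "i \<in> carrier R" using i A.Icarr by blast
      have "r \<otimes> x \<ominus> r \<otimes> a = r \<otimes> i" unfolding i(2) using r a ic by algebra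
      also have "\<dots> \<in> A" using i r by (simp add: A.I_l_closed)
      finally show ?thesis
        using quotient_eq_iff_same_a_r_cos[OF A, of "r \<otimes> x" "r \<otimes> a"] i r a ic by simp
    qed
    moreover have "a \<in> A +> a" by (rule A.a_rcos_self[OF a])
    ultimately show "r \<odot>\<^bsub>?M\<^esub> (A +> a) = A +> (r \<otimes> a)" unfolding Quot(4) by blast
  next
    fix a assume "a \<in> carrier R"
    then show "A +> a = \<zero>\<^bsub>?M\<^esub> \<longleftrightarrow> a \<in> A"
      unfolding Quot(2) using A.rcos_const_imp_mem a_rcos_zero[OF A] by blast
  qed (simp_all add: A oneideal Quot A.a_rcos_sum zero A.a_subset)
qed

lemma ideal_finsum:
  assumes "ideal A R" "finite T" "\<And>i. i \<in> T \<Longrightarrow> f i \<in> A"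
  shows "(\<Oplus>i\<in>T. f i) \<in> A"
  using assms(2,3)
proof (induction T rule: finite_induct)
  case (insert i T)
  then have "f \<in> T \<rightarrow> carrier R" "f i \<in> carrier R" using assms(1) ideal_mem_carrier by auto
  then show ?case using insert by (simp add: ideal_mem_add[OF assms(1)])
qed (simp add: ideal_mem_zero[OF assms(1)])

lemma rees_carrier:
  "p \<in> carrier (rees_algebra R A) \<longleftrightarrow>
    p \<in> carrier (UP R) \<and> (\<forall>n. up_ring.coeff (UP R) p n \<in> ipow A n)"
  by (simp add: rees_algebra_def ipow_def)

lemma rees_cring:
  assumes A: "ideal A R" shows "cring (rees_algebra R A)"
proof -
  interpret U: UP_cring R "UP R" by unfold_locales (rule reflexive)
  let ?H = "carrier (rees_algebra R A)"
  note I = ipow_ideal[OF A]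
  have "subring ?H (UP R)"
  proof (rule U.P.subringI)
    show "?H \<subseteq> carrier (UP R)" by (auto simp: rees_carrier)
    show "\<one>\<^bsub>UP R\<^esub> \<in> ?H" using ideal_mem_zero[OF I] by (simp add: rees_carrier ipow_0)
    show "\<ominus>\<^bsub>UP R\<^esub> p \<in> ?H" if "p \<in> ?H" for p
      using that I by (simp add: rees_carrier additive_subgroup.a_inv_closed ideal.axioms(1))
    show "p \<oplus>\<^bsub>UP R\<^esub> q \<in> ?H" if "p \<in> ?H" "q \<in> ?H" for p q
      using that by (simp add: rees_carrier ideal_mem_add[OF I])
    show "p \<otimes>\<^bsub>UP R\<^esub> q \<in> ?H" if pq: "p \<in> ?H" "q \<in> ?H" for p q
    proof -
      have "up_ring.coeff (UP R) p i \<otimes> up_ring.coeff (UP R) q (n - i) \<in> ipow A n" if "i \<le> n" for i n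
      proof -
        have "up_ring.coeff (UP R) p i \<otimes> up_ring.coeff (UP R) q (n - i) \<in> ipow A i \<cdot> ipow A (n - i)"
          using pq by (intro ideal_prod.prod) (auto simp: rees_carrier)
        then show ?thesis using that by (simp flip: ipow_add[OF A])
      qed
      then show ?thesis using pq by (auto simp: rees_carrier intro!: ideal_finsum[OF I])
    qed
  qed
  then have "subcring ?H (UP R)" by (rule U.P.subcringI')
  then have "cring (UP R \<lparr>carrier := ?H\<rparr>)" using U.P.subcring_iff subringE(1)[OF \<open>subring ?H (UP R)\<close>] by blast
  then show ?thesis by (simp add: rees_algebra_def)
qed

text \<open>The polynomials whose \<open>n\<close>-th coefficient lies in \<open>M A^n\<close> for
  all \<open>n\<close> form an ideal of the Rees algebra containing the generators, which gives one
  direction. For the other, \<open>i j t^n\<close> is \<open>i t^0\<close> times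
  \<open>j t^n\<close> with \<open>i \<in> M\<close> and \<open>j \<in> A^n\<close>.\<close>

lemma rees_ext_ideal_monom:
  assumes M: "ideal M R" and A: "ideal A R"
  shows "ideal (rees_ext_ideal R M A) (rees_algebra R A)"
    and "a \<in> ipow A n \<Longrightarrow> up_ring.monom (UP R) a n \<in> rees_ext_ideal R M A \<longleftrightarrow> a \<in> M \<cdot> ipow A n"
proof -
  interpret U: UP_cring R "UP R" by unfold_locales (rule reflexive)
  interpret P: cring "rees_algebra R A" by (rule rees_cring[OF A])
  let ?m = "up_ring.monom (UP R)" and ?E = "rees_ext_ideal R M A" and ?co = "up_ring.coeff (UP R)"
  note I = ipow_ideal[OF A]
  have ops: "ring.add (rees_algebra R A) = ring.add (UP R)" "monoid.mult (rees_algebra R A) = monoid.mult (UP R)"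
    "\<zero>\<^bsub>rees_algebra R A\<^esub> = \<zero>\<^bsub>UP R\<^esub>" by (simp_all add: rees_algebra_def)
  have mono: "?m a n \<in> carrier (rees_algebra R A)" if "a \<in> ipow A n" for a n
    using that ideal_mem_carrier[OF I that] ideal_mem_zero[OF I] by (simp add: rees_carrier)
  have gens: "(\<lambda>a. ?m a 0) ` M \<subseteq> carrier (rees_algebra R A)"
    using mono[of _ 0] ideal_mem_carrier[OF M] by (auto simp: ipow_0)
  show E: "ideal ?E (rees_algebra R A)" unfolding rees_ext_ideal_def by (rule P.genideal_ideal[OF gens])
  let ?F = "{p \<in> carrier (rees_algebra R A). \<forall>n. ?co p n \<in> M \<cdot> ipow A n}"
  have MI: "ideal (M \<cdot> ipow A n) R" for n by (rule ideal_prod_is_ideal[OF M I])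
  have "ideal ?F (rees_algebra R A)"
  proof (rule P.ideal_memI)
    show "\<zero>\<^bsub>rees_algebra R A\<^esub> \<in> ?F" using ideal_mem_zero[OF MI] P.zero_closed by (simp add: ops)
    show "p \<oplus>\<^bsub>rees_algebra R A\<^esub> q \<in> ?F" if "p \<in> ?F" "q \<in> ?F" for p q
      using that P.a_closed[of p q] by (auto simp: ops rees_carrier ideal_mem_add[OF MI])
    show "r \<otimes>\<^bsub>rees_algebra R A\<^esub> p \<in> ?F" if r: "r \<in> carrier (rees_algebra R A)" and p: "p \<in> ?F" for r p
    proof -
      have "?co r i \<otimes> ?co p (n - i) \<in> M \<cdot> ipow A n" if "i \<le> n" for i n
      proof -
        have "?co r i \<otimes> ?co p (n - i) \<in> ipow A i \<cdot> (M \<cdot> ipow A (n - i))"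
          using r p by (intro ideal_prod.prod) (auto simp: rees_carrier)
        also have "\<dots> = M \<cdot> (ipow A i \<cdot> ipow A (n - i))"
          by (metis I M ideal_prod_assoc ideal_prod_commute)
        also have "\<dots> = M \<cdot> ipow A n" using that by (simp flip: ipow_add[OF A])
        finally show ?thesis .
      qed
      then show ?thesis using r p P.m_closed[of r p]
        by (auto simp: ops rees_carrier intro!: ideal_finsum[OF MI])
    qed
  qed blast
  moreover have "(\<lambda>a. ?m a 0) ` M \<subseteq> ?F"
    using gens ideal_mem_carrier[OF M] ideal_mem_zero[OF MI]
    by (auto simp: ipow_0 ideal_prod_one[OF M])
  ultimately have EF: "?E \<subseteq> ?F" unfolding rees_ext_ideal_def by (rule P.genideal_minimal)
  assume a: "a \<in> ipow A n"
  have ac: "a \<in> carrier R" using a I ideal_mem_carrier by blast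
  show "?m a n \<in> ?E \<longleftrightarrow> a \<in> M \<cdot> ipow A n"
  proof
    assume "?m a n \<in> ?E"
    then have "?co (?m a n) n \<in> M \<cdot> ipow A n" using EF by blast
    then show "a \<in> M \<cdot> ipow A n" using ac by simp
  next
    assume "a \<in> M \<cdot> ipow A n"
    then show "?m a n \<in> ?E"
    proof induction
      case (prod i j)
      have c: "i \<in> carrier R" "j \<in> carrier R" using prod M I ideal_mem_carrier by blast+
      have "?m i 0 \<in> ?E" unfolding rees_ext_ideal_def using P.genideal_self[OF gens] prod by blast
      then have "?m i 0 \<otimes>\<^bsub>rees_algebra R A\<^esub> ?m j n \<in> ?E" using mono[OF prod(2)] by (rule ideal.I_r_closed[OF E])
      then show ?case using U.monom_mult[OF c, of 0 n] by (simp add: ops)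
    next
      case (sum s t)
      have c: "s \<in> carrier R" "t \<in> carrier R" using sum(1,2) MI ideal_mem_carrier by blast+
      have "?m s n \<oplus>\<^bsub>rees_algebra R A\<^esub> ?m t n \<in> ?E" using sum(3,4) by (rule P.ideal_mem_add[OF E])
      then show ?case using c by (simp add: ops)
    qed
  qed
qed

text \<open>The map from \<open>A^n\<close> sending \<open>a\<close> to the class of
  \<open>a t^n\<close> has kernel \<open>M A^n\<close> by \<open>rees_ext_ideal_monom\<close>. It
  respects scalars because \<open>r\<close> acts as multiplication by the constant polynomial
  \<open>r t^0\<close>, which preserves the extended ideal.\<close>

lemma module_length_special_fiber:
  assumes M: "ideal M R" and A: "ideal A R"
  shows "module_length R (special_fiber_component R M A n) = len (M \<cdot> ipow A n) (ipow A n)"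
proof -
  interpret U: UP_cring R "UP R" by unfold_locales (rule reflexive)
  interpret P: cring "rees_algebra R A" by (rule rees_cring[OF A])
  let ?m = "\<lambda>a. up_ring.monom (UP R) a n" and ?E = "rees_ext_ideal R M A" and ?P = "rees_algebra R A"
  let ?M = "special_fiber_component R M A n"
  note I = ipow_ideal[OF A]
  note E = rees_ext_ideal_monom(1)[OF M A]
  interpret E: ideal ?E ?P by (rule E)
  have ops: "ring.add ?P = ring.add (UP R)" "monoid.mult ?P = monoid.mult (UP R)"
    "\<zero>\<^bsub>?P\<^esub> = \<zero>\<^bsub>UP R\<^esub>" "module.smult ?P = module.smult (UP R)" by (simp_all add: rees_algebra_def)
  have car: "a \<in> carrier R" if "a \<in> ipow A k" for a k using that I ideal_mem_carrier by blast
  have mono: "up_ring.monom (UP R) a k \<in> carrier ?P" if "a \<in> ipow A k" for a k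
    using that car[OF that] ideal_mem_zero[OF I] by (simp add: rees_carrier)
  have Quot: "carrier ?M = (\<lambda>a. ?E +>\<^bsub>?P\<^esub> ?m a) ` ipow A n" "\<zero>\<^bsub>?M\<^esub> = ?E"
    "\<And>C D. C \<oplus>\<^bsub>?M\<^esub> D = C <+>\<^bsub>?P\<^esub> D"
    "\<And>r C. r \<odot>\<^bsub>?M\<^esub> C = (\<Union>x\<in>C. ?E +>\<^bsub>?P\<^esub> (r \<odot>\<^bsub>?P\<^esub> x))"
    by (simp_all add: special_fiber_component_def special_fiber_ring_def quot_module_def FactRing_def ipow_def)
  show ?thesis
  proof (rule module_length_image[where \<phi> = "\<lambda>a. ?E +>\<^bsub>?P\<^esub> ?m a"])
    show "ideal (M \<cdot> ipow A n) R" "ideal (ipow A n) R" by (intro ideal_prod_is_ideal M I)+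
    show "M \<cdot> ipow A n \<subseteq> ipow A n" by (rule prod_subset_right[OF M I])
    show "carrier ?M = (\<lambda>a. ?E +>\<^bsub>?P\<^esub> ?m a) ` ipow A n" by (rule Quot)
    have "?E +>\<^bsub>?P\<^esub> \<zero>\<^bsub>?P\<^esub> = ?E" by (rule P.a_rcos_zero[OF E E.zero_closed])
    then show "\<zero>\<^bsub>?M\<^esub> = ?E +>\<^bsub>?P\<^esub> ?m \<zero>" by (simp add: Quot ops)
    show "(?E +>\<^bsub>?P\<^esub> ?m a) \<oplus>\<^bsub>?M\<^esub> (?E +>\<^bsub>?P\<^esub> ?m b) = ?E +>\<^bsub>?P\<^esub> ?m (a \<oplus> b)"
      if "a \<in> ipow A n" "b \<in> ipow A n" for a b
      using E.a_rcos_sum[OF mono[OF that(1)] mono[OF that(2)]] car that by (simp add: Quot ops)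
    show "(?E +>\<^bsub>?P\<^esub> ?m a = \<zero>\<^bsub>?M\<^esub>) = (a \<in> M \<cdot> ipow A n)" if "a \<in> ipow A n" for a
      unfolding Quot(2) rees_ext_ideal_monom(2)[OF M A that, symmetric]
      using E.rcos_const_imp_mem[OF mono[OF that]] P.a_rcos_zero[OF E] by blast
    fix r a assume r: "r \<in> carrier R" and a: "a \<in> ipow A n"
    have ra: "r \<otimes> a \<in> ipow A n" by (rule ideal_mem_mult[OF I r a])
    have r0: "up_ring.monom (UP R) r 0 \<in> carrier ?P" using mono[of r 0] r by (simp add: ipow_0)
    have "?E +>\<^bsub>?P\<^esub> (r \<odot>\<^bsub>?P\<^esub> x) = ?E +>\<^bsub>?P\<^esub> ?m (r \<otimes> a)" if x: "x \<in> ?E +>\<^bsub>?P\<^esub> ?m a" for x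
    proof -
      obtain p where p: "p \<in> ?E" "x = p \<oplus>\<^bsub>?P\<^esub> ?m a" using x by (auto simp: a_r_coset_def')
      have pc: "p \<in> carrier ?P" "p \<in> carrier (UP R)" using p E.Icarr by (auto simp: rees_carrier)
      have rp: "up_ring.monom (UP R) r 0 \<otimes>\<^bsub>?P\<^esub> p \<in> ?E" by (rule E.I_l_closed[OF p(1) r0])
      have "r \<odot>\<^bsub>?P\<^esub> x = r \<odot>\<^bsub>UP R\<^esub> p \<oplus>\<^bsub>UP R\<^esub> r \<odot>\<^bsub>UP R\<^esub> ?m a"
        unfolding p(2) ops using r pc car[OF a] by (intro U.UP_smult_r_distr) auto
      also have "\<dots> = (up_ring.monom (UP R) r 0 \<otimes>\<^bsub>?P\<^esub> p) \<oplus>\<^bsub>?P\<^esub> ?m (r \<otimes> a)"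
        unfolding ops using U.monom_mult_is_smult[OF r pc(2)] U.monom_mult_smult[OF r car[OF a], of n] by simp
      finally have "r \<odot>\<^bsub>?P\<^esub> x = (up_ring.monom (UP R) r 0 \<otimes>\<^bsub>?P\<^esub> p) \<oplus>\<^bsub>?P\<^esub> ?m (r \<otimes> a)" .
      then have "?E +>\<^bsub>?P\<^esub> (r \<odot>\<^bsub>?P\<^esub> x)
        = (?E +>\<^bsub>?P\<^esub> (up_ring.monom (UP R) r 0 \<otimes>\<^bsub>?P\<^esub> p)) <+>\<^bsub>?P\<^esub> (?E +>\<^bsub>?P\<^esub> ?m (r \<otimes> a))"
        using E.a_rcos_sum[OF E.Icarr[OF rp] mono[OF ra]] by simp
      also have "\<dots> = (?E +>\<^bsub>?P\<^esub> \<zero>\<^bsub>?P\<^esub>) <+>\<^bsub>?P\<^esub> (?E +>\<^bsub>?P\<^esub> ?m (r \<otimes> a))"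
        using P.a_rcos_zero[OF E rp] P.a_rcos_zero[OF E E.zero_closed] by simp
      also have "\<dots> = ?E +>\<^bsub>?P\<^esub> ?m (r \<otimes> a)"
        using E.a_rcos_sum[OF P.zero_closed mono[OF ra]] P.l_zero[OF mono[OF ra]] by simp
      finally show ?thesis .
    qed
    moreover have "?m a \<in> ?E +>\<^bsub>?P\<^esub> ?m a" by (rule E.a_rcos_self[OF mono[OF a]])
    ultimately show "r \<odot>\<^bsub>?M\<^esub> (?E +>\<^bsub>?P\<^esub> ?m a) = ?E +>\<^bsub>?P\<^esub> ?m (r \<otimes> a)" unfolding Quot(4) by blast
  qed
qed

end

section \<open>Hilbert coefficients, primary ideals and minimal reductions in terms of
  colengths\<close>

lemma hilbert_coeff_eq:
  assumes "\<forall>\<^sub>F n in sequentially. int (colength R (ideal_pow R A n)) = binom_exp d e n" "i \<le> d"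
  shows "hilbert_coeff R d A i = e i"
  unfolding hilbert_coeff_def
proof (rule the_equality)
  have ex: "hilbert_expansion R d A e' \<longleftrightarrow>
      (\<forall>\<^sub>F n in sequentially. int (colength R (ideal_pow R A n)) = binom_exp d e' n)" for e'
    by (simp add: hilbert_expansion_def binom_exp_def)
  show "\<exists>e'. hilbert_expansion R d A e' \<and> e i = e' i" using assms(1) ex by blast
  fix c assume "\<exists>e'. hilbert_expansion R d A e' \<and> c = e' i"
  then obtain e' where e': "\<forall>\<^sub>F n in sequentially. int (colength R (ideal_pow R A n)) = binom_exp d e' n" "c = e' i"
    using ex by blast
  have "\<forall>\<^sub>F n in sequentially. binom_exp d e' n = binom_exp d e n"
    using e'(1) assms(1) by eventually_elim simp
  then show "c = e i" using binom_exp_unique assms(2) e'(2) by blast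
qed

context noetherian_local
begin

lemma colength_clen: "ideal A R \<Longrightarrow> colength R A = clen A"
  by (simp add: colength_def clen_def module_length_quot)

lemma special_fiber_fib: "cofinite A \<Longrightarrow> special_fiber_hilbert_function R \<mm> A n = fib A n"
  unfolding special_fiber_hilbert_function_def
  by (simp add: module_length_special_fiber m_ideal cofinite_ideal len_fib)

text \<open>Each of finitely many generators of \<open>\<mm>\<close> has a power in
  \<open>A\<close>, since the radical is \<open>\<mm>\<close>; hence so does
  \<open>\<mm>\<close>.\<close>

lemma m_primary_cofinite:
  assumes "m_primary R \<mm> A" shows "cofinite A" "A \<subseteq> \<mm>"
proof -
  have A: "ideal A R" "A \<noteq> carrier R" and rad: "radical R A = \<mm>"
    using assms by (auto simp: m_primary_def primary_ideal_def)
  show "A \<subseteq> \<mm>" by (rule proper_sub_m[OF A])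
  obtain S where S: "S \<subseteq> carrier R" "finite S" "\<mm> = Idl S" using finetely_gen[OF m_ideal] by blast
  have "\<exists>n::nat. s [^] n \<in> A" if "s \<in> S" for s
    using genideal_self[OF S(1)] that S(3) rad by (auto simp: radical_def)
  from ipow_subset_of_gens[OF S(2,1) A(1) this] show "cofinite A"
    unfolding cofinite_def S(3)[symmetric] using A(1) by simp
qed

text \<open>If \<open>a b \<in> A\<close> with \<open>b\<close> outside \<open>\<mm>\<close>, the
  ideal of all \<open>y\<close> with \<open>a y \<in> A\<close> is not inside \<open>\<mm>\<close>,
  hence is \<open>R\<close>, and \<open>y = 1\<close> gives \<open>a \<in> A\<close>.\<close>

lemma m_primaryI:
  assumes A: "cofinite A" "A \<subseteq> \<mm>" shows "m_primary R \<mm> A"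
proof -
  note AI = cofinite_ideal[OF A(1)]
  interpret m: primeideal \<mm> R by (rule maximalideal_prime[OF m_maximal])
  obtain k where k: "ipow \<mm> k \<subseteq> A" using A(1) unfolding cofinite_def by blast
  have rad: "radical R A = \<mm>"
  proof
    show "\<mm> \<subseteq> radical R A"
    proof
      fix a assume a: "a \<in> \<mm>"
      then have "a [^] k \<in> A" using pow_mem_ipow[OF m_ideal a, of k] k by blast
      then show "a \<in> radical R A" using m.Icarr[OF a] by (auto simp: radical_def)
    qed
    show "radical R A \<subseteq> \<mm>"
    proof
      fix a assume "a \<in> radical R A"
      then obtain n :: nat where a: "a \<in> carrier R" "a [^] n \<in> \<mm>" using A(2) by (auto simp: radical_def)
      from a(2) show "a \<in> \<mm>"
      proof (induction n)
        case 0
        then show ?case using m.one_imp_carrier m_proper by simp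
      next
        case (Suc n)
        then show ?case using m.I_prime[of "a [^] n" a] a(1) by auto
      qed
    qed
  qed
  have "a \<in> A \<or> b \<in> radical R A" if ab: "a \<in> carrier R" "b \<in> carrier R" "a \<otimes> b \<in> A" for a b
  proof (cases "b \<in> \<mm>")
    case False
    let ?C = "{y \<in> carrier R. a \<otimes> y \<in> A}"
    have "ideal ?C R" by (rule colon_ideal[OF ab(1) oneideal AI])
    moreover have "\<not> ?C \<subseteq> \<mm>" using ab False by blast
    ultimately have "?C = carrier R" using proper_sub_m by blast
    then have "a \<otimes> \<one> \<in> A" using one_closed by blast
    then show ?thesis using ab by simp
  qed (use rad in simp)
  moreover have "A \<noteq> carrier R" using A(2) m_proper ideal_sub_carrier[OF m_ideal] by blast
  ultimately show ?thesis unfolding m_primary_def primary_ideal_def using AI rad by blast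
qed

lemma minimal_reductionD:
  assumes "minimal_reduction R d A J"
  obtains x where "J = Idl (x ` {..<d})" "reduction A (x ` {..<d})" "card (x ` {..<d}) \<le> d"
proof -
  obtain x r where x: "x ` {..<d} \<subseteq> carrier R" "J = Idl (x ` {..<d})"
    and r: "ideal_pow R A (r + 1) = J \<cdot> ideal_pow R A r" and JA: "J \<subseteq> A"
    using assms unfolding minimal_reduction_def by blast
  have "reduction A (x ` {..<d})" unfolding reduction_def ipow_def
    using x JA r by (auto simp del: nat_pow_Suc)
  moreover have "card (x ` {..<d}) \<le> d" using card_image_le[of "{..<d}" x] by simp
  ultimately show thesis using that x by blast
qed

text \<open>This makes the Buchsbaum condition applicable to every minimal reduction.\<close>

lemma reduction_parameters:
  assumes "cofinite A" "A \<subseteq> \<mm>" "reduction A (x ` {..<d})"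
  shows "system_of_parameters R \<mm> d x"
proof -
  have x: "x ` {..<d} \<subseteq> carrier R" "Idl (x ` {..<d}) \<subseteq> A" using assms(3) unfolding reduction_def by auto
  have "m_primary R \<mm> (Idl (x ` {..<d}))"
    using reduction_cofinite[OF assms(1,3)] x assms(2) by (intro m_primaryI) auto
  then show ?thesis unfolding system_of_parameters_def using genideal_self[OF x(1)] x(2) assms(2) by blast
qed

text \<open>The listed generators of a minimal reduction may repeat, so only
  \<open>card S \<le> Suc e\<close> is at hand; \<open>numpoly_mono\<close> brings all three
  functions to their nominal degrees.\<close>

lemma hilbert_expansions:
  assumes A: "cofinite A" and red: "reduction A S" and card: "card S \<le> Suc e"
  obtains eA eJ c where
    "\<forall>\<^sub>F n in sequentially. int (clen (ipow A n)) = binom_exp (Suc e) eA n"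
    "\<forall>\<^sub>F n in sequentially. int (clen (ipow (Idl S) n)) = binom_exp (Suc e) eJ n"
    "\<forall>\<^sub>F n in sequentially. int (fib A n) = binom_exp e c n"
proof -
  obtain r where S: "finite S" "S \<subseteq> carrier R" "Idl S \<subseteq> A" and r: "ipow A (Suc r) = (Idl S) \<cdot> ipow A r"
    using red unfolding reduction_def by blast
  have J: "ideal (Idl S) R" by (rule genideal_ideal[OF S(2)])
  have 1: "numpoly (Suc (Suc e)) (\<lambda>n. int (clen (ipow A n)))"
    by (rule numpoly_mono[OF samuel_function[OF S(1,2) A r S(3)]]) (use card in simp)
  have "ipow (Idl S) (Suc 0) = (Idl S) \<cdot> ipow (Idl S) 0" by (rule ipow_Suc'[OF J])
  from samuel_function[OF S(1,2) reduction_cofinite[OF A red] this order_refl]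
  have 2: "numpoly (Suc (Suc e)) (\<lambda>n. int (clen (ipow (Idl S) n)))"
    by (rule numpoly_mono) (use card in simp)
  have 3: "numpoly (Suc e) (\<lambda>n. int (fib A n))"
    by (rule numpoly_mono[OF fib_numpoly[OF S(1,2) A r S(3)] card])
  from numpoly_binom_exp[OF 1] numpoly_binom_exp[OF 2] numpoly_binom_exp[OF 3]
  show thesis by (elim exE) (rule that)
qed

end

theorem theorem3p5:
  fixes R :: "('a, 'b) ring_scheme" and \<mm> I J :: "'a set" and d :: nat
  assumes "buchsbaum_ring R \<mm> d"
    and "infinite (carrier (R Quot \<mm>))"
    and "m_primary R \<mm> I"
    and "minimal_reduction R d I J"
  shows "special_fiber_multiplicity R \<mm> d I
      \<le> of_int (hilbert_coeff R d I 1 + int (buchsbaum_invariant R \<mm> d) - hilbert_coeff R d J 1 + 1)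
    \<and> (special_fiber_multiplicity R \<mm> d I
      = of_int (hilbert_coeff R d I 1 + int (buchsbaum_invariant R \<mm> d) - hilbert_coeff R d J 1 + 1)
      \<longrightarrow> goto_minimal_multiplicity R \<mm> d I)"
proof -
  have loc: "local_noetherian_ring R \<mm> d" and "d > 0" and inv_ex: "\<exists>b. is_buchsbaum_invariant R \<mm> d b"
    using assms(1) unfolding buchsbaum_ring_def by auto
  then obtain e where d: "d = Suc e" by (cases d) auto
  have "cring R" "noetherian_ring R" "\<And>M. maximalideal M R \<longleftrightarrow> M = \<mm>" and dim: "krull_dim R = enat (Suc e)"
    using loc unfolding local_noetherian_ring_def d by auto
  then interpret noetherian_local R \<mm>
    by (simp add: noetherian_local_def noetherian_local_axioms_def noetherian_cring_def)
  note I = m_primary_cofinite[OF assms(3)]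
  have II: "ideal I R" by (rule cofinite_ideal[OF I(1)])
  obtain b where b: "is_buchsbaum_invariant R \<mm> d b" using inv_ex by blast
  have colen: "int (clen K) - hilbert_coeff R d K 0 = int b'"
    if b': "is_buchsbaum_invariant R \<mm> d b'" and K: "K = Idl\<^bsub>R\<^esub> (x ` {..<d})" and red: "reduction I (x ` {..<d})"
    for K x b'
    using b' reduction_parameters[OF I red] colength_clen[OF cofinite_ideal[OF reduction_cofinite[OF I(1) red]]]
    unfolding is_buchsbaum_invariant_def Let_def K by auto
  obtain x where x: "J = Idl\<^bsub>R\<^esub> (x ` {..<d})" "reduction I (x ` {..<d})" "card (x ` {..<d}) \<le> d"
    using minimal_reductionD[OF assms(4)] .
  have xc: "card (x ` {..<d}) \<le> Suc e" using x(3) by (simp add: d)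
  \<comment> \<open>The description of the invariant is unique because \<open>J\<close> supplies a
    system of parameters.\<close>
  have Binv: "buchsbaum_invariant R \<mm> d = b" unfolding buchsbaum_invariant_def
  proof (rule the_equality)
    show "is_buchsbaum_invariant R \<mm> d b" by (rule b)
    fix b' assume "is_buchsbaum_invariant R \<mm> d b'"
    then show "b' = b" using colen[OF _ x(1,2), of b'] colen[OF b x(1,2)] by simp
  qed
  have pow: "colength R (ideal_pow R K n) = clen (ipow K n)" if "ideal K R" for K n
    using colength_clen[OF ipow_ideal[OF that]] by (simp add: ipow_def)
  \<comment> \<open>Formulated for an arbitrary reduction \<open>K\<close>, since the case of
    equality compares \<open>J\<close> with every other minimal reduction.\<close>
  have bounds: "hilbert_coeff R d I 0 = hilbert_coeff R d K 0"
      "f \<le> hilbert_coeff R d I 1 - hilbert_coeff R d K 1 + 1"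
      "int (clen K) = hilbert_coeff R d K 0 \<Longrightarrow> f = hilbert_coeff R d I 1 - hilbert_coeff R d K 1 + 1
        \<Longrightarrow> \<mm> \<cdot>\<^bsub>R\<^esub> I \<subseteq> K"
    if K: "K = Idl\<^bsub>R\<^esub> (y ` {..<d})" and red: "reduction I (y ` {..<d})" and card: "card (y ` {..<d}) \<le> d"
      and f: "special_fiber_multiplicity R \<mm> d I = of_int f" for K y f
  proof -
    have card': "card (y ` {..<d}) \<le> Suc e" using card by (simp add: d)
    obtain eI eK c where
      eI: "\<forall>\<^sub>F n in sequentially. int (clen (ipow I n)) = binom_exp (Suc e) eI n" and
      eK: "\<forall>\<^sub>F n in sequentially. int (clen (ipow (Idl\<^bsub>R\<^esub> (y ` {..<d})) n)) = binom_exp (Suc e) eK n" and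
      c: "\<forall>\<^sub>F n in sequentially. int (fib I n) = binom_exp e c n"
      using hilbert_expansions[OF I(1) red card'] .
    have KI: "ideal K R" unfolding K by (rule cofinite_ideal[OF reduction_cofinite[OF I(1) red]])
    have hI: "hilbert_coeff R d I i = eI i" and hK: "hilbert_coeff R d K i = eK i" if "i \<le> d" for i
    proof -
      show "hilbert_coeff R d I i = eI i"
        by (rule hilbert_coeff_eq[OF _ that]) (use eI in \<open>simp only: pow[OF II] d\<close>)
      show "hilbert_coeff R d K i = eK i"
        by (rule hilbert_coeff_eq[OF _ that]) (use eK[folded K] in \<open>simp only: pow[OF KI] d\<close>)
    qed
    have "lead_coeff (special_fiber_hilbert_poly R \<mm> I) = of_int (c 0) / fact e"
      unfolding special_fiber_hilbert_poly_def special_fiber_fib[OF I(1)]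
      by (rule the_hilbert_poly[OF c fiber_leading_coeff[OF dim I c]])
    then have fc: "f = c 0" using f by (simp add: special_fiber_multiplicity_def d)
    have "1 \<le> d" by (simp add: d)
    note h1 = hI[OF this] hK[OF this]
    note prem = I(1) red card' eI eK c
    show "hilbert_coeff R d I 0 = hilbert_coeff R d K 0"
      using multiplicity_eq[OF prem] by (simp add: hI hK)
    show "f \<le> hilbert_coeff R d I 1 - hilbert_coeff R d K 1 + 1"
      unfolding h1 fc by (rule fiber_multiplicity_le[OF prem])
    assume "int (clen K) = hilbert_coeff R d K 0" "f = hilbert_coeff R d I 1 - hilbert_coeff R d K 1 + 1"
    then show "\<mm> \<cdot>\<^bsub>R\<^esub> I \<subseteq> K" using m_prod_sub_reduction[OF prem] unfolding h1 fc hK[of 0, simplified] K[symmetric] by blast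
  qed
  \<comment> \<open>The multiplicity is defined as a rational number; its integer value
    \<open>f\<close> can be compared with Hilbert coefficients in \<open>int\<close>.\<close>
  have "\<exists>f. special_fiber_multiplicity R \<mm> d I = of_int f"
  proof -
    obtain c where c: "\<forall>\<^sub>F n in sequentially. int (fib I n) = binom_exp e c n"
      using hilbert_expansions[OF I(1) x(2) xc] by blast
    have "lead_coeff (special_fiber_hilbert_poly R \<mm> I) = of_int (c 0) / fact e"
      unfolding special_fiber_hilbert_poly_def special_fiber_fib[OF I(1)]
      by (rule the_hilbert_poly[OF c fiber_leading_coeff[OF dim I c]])
    then show ?thesis by (intro exI[of _ "c 0"]) (simp add: special_fiber_multiplicity_def d)
  qed
  then obtain f where f: "special_fiber_multiplicity R \<mm> d I = of_int f" by blast
  have le: "f \<le> hilbert_coeff R d I 1 - hilbert_coeff R d J 1 + 1" by (rule bounds(2)[OF x f])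
  have "goto_minimal_multiplicity R \<mm> d I"
    if eq: "f = hilbert_coeff R d I 1 + int b - hilbert_coeff R d J 1 + 1"
    unfolding goto_minimal_multiplicity_def
  proof (intro allI impI)
    \<comment> \<open>\<open>le\<close> bounds \<open>f\<close> without the term \<open>b\<close>,
      so equality leaves \<open>b \<le> 0\<close>.\<close>
    from eq le have b0: "b = 0" by simp
    have J0: "int (clen J) = hilbert_coeff R d J 0" using colen[OF b x(1,2)] b0 by simp
    have mIJ: "\<mm> \<cdot>\<^bsub>R\<^esub> I \<subseteq> J" by (rule bounds(3)[OF x f J0]) (use eq b0 in simp)
    note meetJ = reduction_minimal_generators[OF dim I x(2) xc, folded x(1)]
    have mJ: "\<mm> \<cdot>\<^bsub>R\<^esub> I = \<mm> \<cdot>\<^bsub>R\<^esub> J" using meetJ(1) mIJ by blast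
    fix K assume "minimal_reduction R d I K"
    then obtain y where y: "K = Idl\<^bsub>R\<^esub> (y ` {..<d})" "reduction I (y ` {..<d})" "card (y ` {..<d}) \<le> d"
      by (rule minimal_reductionD)
    have yc: "card (y ` {..<d}) \<le> Suc e" using y(3) by (simp add: d)
    note meetK = reduction_minimal_generators[OF dim I y(2) yc, folded y(1)]
    have "int (clen K) = hilbert_coeff R d K 0" using colen[OF b y(1,2)] b0 by simp
    \<comment> \<open>Both reductions have the multiplicity of \<open>I\<close>, and with invariant
      0 the multiplicity is the colength.\<close>
    then have clen: "clen K = clen J" using bounds(1)[OF y f] bounds(1)[OF x f] J0 by simp
    have K: "cofinite K" unfolding y(1) by (rule reduction_cofinite[OF I(1) y(2)])
    have J: "ideal J R" unfolding x(1) by (rule cofinite_ideal[OF reduction_cofinite[OF I(1) x(2)]])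
    have "K \<subseteq> I" using y unfolding reduction_def by blast
    then have "\<mm> \<cdot>\<^bsub>R\<^esub> K \<subseteq> \<mm> \<cdot>\<^bsub>R\<^esub> J" unfolding mJ[symmetric] by (intro prod_mono order_refl)
    \<comment> \<open>Both ideals have colength \<open>clen J + d\<close> by
      \<open>reduction_minimal_generators\<close>, so the inclusion is an equality.\<close>
    then have "\<mm> \<cdot>\<^bsub>R\<^esub> K = \<mm> \<cdot>\<^bsub>R\<^esub> J"
      by (intro clen_eq_imp_eq cofinite_m_prod K ideal_prod_is_ideal m_ideal J) (simp_all add: meetJ(2) meetK(2) clen)
    then show "\<mm> \<cdot>\<^bsub>R\<^esub> I = \<mm> \<cdot>\<^bsub>R\<^esub> K" using mJ by simp
  qed
  with le show ?thesis unfolding f Binv by (simp only: of_int_le_iff of_int_eq_iff) auto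
qed

end
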